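(* Let $F=P_{\ell_1}\cup\cdots\cup P_{\ell_k}$ be a linear forest with $k\ge 2$, $\ell_1\ge\cdots\ge\ell_k\ge 2$ and $\ell_i\neq 3$ for all $1\le i\le k$. Let $s$ be a positive integer with $s\le \delta_F+1$, and let $n$ be an integer with $$n\ \ge\ \frac{5\binom{|F|-1}{s}^2}{(|F|-1)\binom{\delta_F}{s-1}}+\delta_F .$$ If $F$ is not of the form $2P_\ell$ with $\ell$ odd, then $$ex(n,K_s,F)=\max\left\{\mathcal{N}_s(G_F(n)),\ ex(n,K_s,P_{\ell_1})\right\}.$$ If $F=2P_\ell$ with $\ell$ odd, then $ex(n,K_s,F)=\mathcal{N}_s(G_F(n))$ when $s\le\delta_F$, and $$ex(n,K_s,F)=\left\lfloor\frac{n-1}{\ell-1}\right\rfloor\ell+\mu\quad\text{when } s=\delta_F+1,$$ where $\mu=1$ if $n-1\equiv \ell-2 \pmod{\ell-1}$ and $\mu=0$ otherwise.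
   Context: $P_m$, $K_m$, $E_m$ denote the path, complete graph and edgeless graph on $m$ vertices. $G\cup H$ is the disjoint union, $tG$ is $t$ disjoint copies of $G$, and $G+H$ (join) is obtained from $G\cup H$ by adding all edges between $V(G)$ and $V(H)$. A linear forest is written $F=P_{\ell_1}\cup\cdots\cup P_{\ell_k}$ with $\ell_1\ge\cdots\ge\ell_k\ge 2$, and $|F|=\sum_{i=1}^k\ell_i$ is its number of vertices. Define $\delta_F=\sum_{i=1}^k\lfloor \ell_i/2\rfloor-1$. Define the $n$-vertex graph $G_F(n)=K_{\delta_F}+E_{n-\delta_F}$ if some $\ell_i$ is even, and $G_F(n)=K_{\delta_F}+(E_{n-\delta_F-2}\cup K_2)$ if all $\ell_i$ are odd. A graph is $H$-free if it has no subgraph isomorphic to $H$. $\mathcal{N}_s(G)$ denotes the number of copies of $K_s$ in $G$ (i.e. the number of $s$-element cliques), and $ex(n,K_s,H)$ is the maximum of $\mathcal{N}_s(G)$ over all $H$-free graphs $G$ on $n$ vertices. *)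

theory Defs
  imports Complex_Main
begin

text \<open>Simple graphs are given by a finite vertex set V and a set E of 2-element edges.\<close>

definition subgraph_copy :: "'b set \<Rightarrow> 'b set set \<Rightarrow> 'a set \<Rightarrow> 'a set set \<Rightarrow> bool" where
  "subgraph_copy VH EH VG EG \<longleftrightarrow>
     (\<exists>f. inj_on f VH \<and> f ` VH \<subseteq> VG \<and> (\<forall>u v. {u, v} \<in> EH \<longrightarrow> {f u, f v} \<in> EG))"

definition H_free :: "'a set \<Rightarrow> 'a set set \<Rightarrow> 'b set \<Rightarrow> 'b set set \<Rightarrow> bool" where
  "H_free VG EG VH EH \<longleftrightarrow> \<not> subgraph_copy VH EH VG EG"

definition num_cliques :: "nat \<Rightarrow> 'a set \<Rightarrow> 'a set set \<Rightarrow> nat" where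
  "num_cliques s V E = card {K. K \<subseteq> V \<and> card K = s \<and> (\<forall>u\<in>K. \<forall>v\<in>K. u \<noteq> v \<longrightarrow> {u, v} \<in> E)}"

definition graphs_on :: "nat \<Rightarrow> nat set set set" where
  "graphs_on n = {E. E \<subseteq> {{u, v} | u v. u < n \<and> v < n \<and> u \<noteq> v}}"

definition ex_gen :: "nat \<Rightarrow> nat \<Rightarrow> 'b set \<Rightarrow> 'b set set \<Rightarrow> nat" where
  "ex_gen n s VH EH = Max {num_cliques s {0..<n} E | E. E \<in> graphs_on n \<and> H_free {0..<n} E VH EH}"

text \<open>Linear forest P_{l_1} \<union> ... \<union> P_{l_k}, given by the list [l_1,...,l_k];
  vertex (i,j) is the j-th vertex of the i-th path.\<close>
definition lf_V :: "nat list \<Rightarrow> (nat \<times> nat) set" where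
  "lf_V ls = {(i, j). i < length ls \<and> j < ls ! i}"

definition lf_E :: "nat list \<Rightarrow> (nat \<times> nat) set set" where
  "lf_E ls = {{(i, j), (i, Suc j)} | i j. i < length ls \<and> Suc j < ls ! i}"

definition ex_lf :: "nat \<Rightarrow> nat \<Rightarrow> nat list \<Rightarrow> nat" where
  "ex_lf n s ls = ex_gen n s (lf_V ls) (lf_E ls)"

definition order_lf :: "nat list \<Rightarrow> nat" where
  "order_lf ls = sum_list ls"

definition delta_F :: "nat list \<Rightarrow> nat" where
  "delta_F ls = sum_list (map (\<lambda>l. l div 2) ls) - 1"

text \<open>G_F(n) on vertex set {0..<n}: the clique K_{delta_F} is {0..<delta_F}; if all l_i are odd,
  an extra edge {delta_F, delta_F+1} is added.\<close>
definition GF_E :: "nat list \<Rightarrow> nat \<Rightarrow> nat set set" where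
  "GF_E ls n = {{u, v} | u v. u < v \<and> v < n \<and>
      (u < delta_F ls \<or> ((\<forall>l\<in>set ls. odd l) \<and> u = delta_F ls \<and> v = Suc (delta_F ls)))}"

end

(*
Write d for delta_F. Deleting vertices that lie in few cliques leaves an induced subgraph of minimum
degree at least d, and each deletion costs fewer cliques than a vertex contributes to G_F(n). If few
vertices survive, the lower bound on n makes the total smaller than that of G_F(n). If the remainder is
disconnected, a component on more than 2d vertices would leave room for F, and if there are only small
components then either there are few of them or there is no path on l_1 vertices at all.

Otherwise take a longest path of the connected remainder, which has between 2d + 1 and |F| - 1 vertices.
If many vertices off the path have no neighbour off the path, Hall's theorem matches the path vertices
next to them into them. A path with sum l_i div 2 nonconsecutive vertices that have private neighbours
off the path can be cut into a copy of F (this fails for l_i = 3), and rerouting shows that all these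
vertices share the same d neighbours; so the remainder is a subgraph of G_F. If many components off the
path have at least two vertices, comparing the lengths of the paths obtained by detours through a
component shows that the components are cliques on about d vertices hanging off one or two vertices of
the path. Such graphs have fewer cliques than G_F(n), except that for F = 2P_l with l odd and s = d + 1
they are the extremal graphs.
*)

theory Submission
  imports Defs "HOL-Library.Multiset"
begin

section \<open>Paths, components and cliques in induced subgraphs\<close>

text \<open>The deletion threshold is \<open>k = (d - 1) choose (s - 1)\<close>, a bound for the
  cliques through a vertex of degree below \<open>d\<close>. In G_F(n) every further vertex adds at
  least \<open>c = d choose (s - 1)\<close> cliques, and \<open>c = k + c'\<close> by Pascal, with
  \<open>c' = (d - 1) choose (s - 2)\<close>. So each deletion saves \<open>c'\<close>, and these
  savings must pay for the remainder. A remainder on at most 4(|F| - 1) vertices has at most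
  \<open>4 * A\<close> cliques, \<open>A = (|F| - 1) choose s\<close>, and
  \<open>c * d \<le> A\<close> is lost because only \<open>n - d\<close> vertices add
  \<open>c\<close>; this is the 5 in the bound on \<open>n\<close>. The 4 leaves enough vertices off
  a longest path for the matching argument. Whole sets are deleted, not only vertices: for F = 2P_l
  a component on d + 1 vertices may satisfy the degree condition and is disposed of as a set. This
  works for s \<le> d; for s = d + 1 the threshold is 0, such cliques stay, and joined at a common
  vertex they overtake G_F(n). With \<open>h = d + 1\<close> and \<open>q\<close> odd lengths, |F| =
  2h + q. As no length is 3, every odd length is at least 5, whence 2q \<le> h; the packing
  arguments rest on this.\<close>

locale loopless =
  fixes E :: "'a set set"
  assumes no_loop: "{v} \<notin> E"
begin

definition adj :: "'a \<Rightarrow> 'a \<Rightarrow> bool" where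
  "adj u v \<longleftrightarrow> {u, v} \<in> E"

definition nb :: "'a set \<Rightarrow> 'a \<Rightarrow> 'a set" where
  "nb V v = {u \<in> V. adj u v}"

definition path :: "'a set \<Rightarrow> 'a list \<Rightarrow> bool" where
  "path V xs \<longleftrightarrow> distinct xs \<and> set xs \<subseteq> V \<and> successively adj xs"

definition longest :: "'a set \<Rightarrow> 'a list \<Rightarrow> bool" where
  "longest V xs \<longleftrightarrow> path V xs \<and> (\<forall>ys. path V ys \<longrightarrow> length ys \<le> length xs)"

text \<open>Connectivity is encoded by cuts: every use below needs an edge leaving a given set,
  never a walk.\<close>

definition conn :: "'a set \<Rightarrow> bool" where
  "conn V \<longleftrightarrow> V \<noteq> {} \<and> (\<forall>X. X \<subseteq> V \<longrightarrow> X \<noteq> {} \<longrightarrow> X \<noteq> V \<longrightarrow> (\<exists>u\<in>X. \<exists>v\<in>V - X. adj u v))"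

definition comp :: "'a set \<Rightarrow> 'a set \<Rightarrow> bool" where
  "comp V C \<longleftrightarrow> C \<subseteq> V \<and> conn C \<and> (\<forall>u\<in>C. \<forall>v\<in>V - C. \<not> adj u v)"

definition packs :: "'a set \<Rightarrow> nat list \<Rightarrow> bool" where
  "packs V ls \<longleftrightarrow> (\<exists>pss. map length pss = ls \<and> distinct (concat pss) \<and> (\<forall>ps\<in>set pss. path V ps))"

lemma adj_sym: "adj u v \<longleftrightarrow> adj v u"
  by (simp add: adj_def insert_commute)

lemma adj_irrefl [simp]: "\<not> adj v v"
  using no_loop by (simp add: adj_def)

lemma successively_adj_flip: "successively (\<lambda>x y. adj y x) xs \<longleftrightarrow> successively adj xs"
  using adj_sym by (intro successively_cong) auto

lemma nb_iff: "u \<in> nb V v \<longleftrightarrow> u \<in> V \<and> adj u v"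
  by (simp add: nb_def)

lemma finite_nb: "finite V \<Longrightarrow> finite (nb V v)"
  by (simp add: nb_def)

subsection \<open>Paths\<close>

lemma path_Nil [simp]: "path V []"
  by (simp add: path_def)

lemma path_single [simp]: "path V [x] \<longleftrightarrow> x \<in> V"
  by (simp add: path_def)

lemma path_rev: "path V (rev xs) \<longleftrightarrow> path V xs"
  by (simp add: path_def successively_adj_flip)

lemma path_append:
  "path V (xs @ ys) \<longleftrightarrow> path V xs \<and> path V ys \<and> set xs \<inter> set ys = {} \<and>
     (xs = [] \<or> ys = [] \<or> adj (last xs) (hd ys))"
  by (auto simp: path_def successively_append_iff)

lemma path_Cons:
  "path V (x # ys) \<longleftrightarrow> x \<in> V \<and> x \<notin> set ys \<and> path V ys \<and> (ys = [] \<or> adj x (hd ys))"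
  by (auto simp: path_def successively_Cons)

lemma path_take: "path V xs \<Longrightarrow> path V (take k xs)"
  by (metis append_take_drop_id path_append)

lemma path_drop: "path V xs \<Longrightarrow> path V (drop k xs)"
  by (metis append_take_drop_id path_append)

lemma path_mono: "path U xs \<Longrightarrow> U \<subseteq> V \<Longrightarrow> path V xs"
  by (auto simp: path_def)

lemma path_subset: "path V xs \<Longrightarrow> set xs \<subseteq> U \<Longrightarrow> path U xs"
  by (auto simp: path_def)

lemma path_distinct: "path V xs \<Longrightarrow> distinct xs"
  by (simp add: path_def)

lemma path_set: "path V xs \<Longrightarrow> set xs \<subseteq> V"
  by (simp add: path_def)

lemma path_nth_adj: "path V xs \<Longrightarrow> Suc i < length xs \<Longrightarrow> adj (xs ! i) (xs ! Suc i)"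
  by (simp add: path_def successively_nth)

lemma path_length_le: "path V xs \<Longrightarrow> finite V \<Longrightarrow> length xs \<le> card V"
  by (metis card_mono distinct_card path_distinct path_set)

lemma longest_exists:
  assumes "finite V"
  obtains xs where "longest V xs"
proof -
  define xs where "xs = (ARG_MAX length xs. path V xs)"
  have "path V []" by simp
  moreover have "\<forall>ys. path V ys \<longrightarrow> length ys < Suc (card V)"
    using path_length_le assms by (simp add: less_Suc_eq_le)
  ultimately have "path V xs \<and> (\<forall>ys. path V ys \<longrightarrow> length ys \<le> length xs)"
    unfolding xs_def by (rule arg_max_nat_lemma)
  then show thesis using that by (auto simp: longest_def)
qed

lemma longest_rev: "longest V (rev xs) \<longleftrightarrow> longest V xs"
  by (simp add: longest_def path_rev)

lemma longest_nonempty: "longest V xs \<Longrightarrow> V \<noteq> {} \<Longrightarrow> xs \<noteq> []"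
proof
  assume l: "longest V xs" and "V \<noteq> {}" and "xs = []"
  then obtain v where "v \<in> V" by blast
  then have "path V [v]" by simp
  then have "length [v] \<le> length xs" using l by (simp only: longest_def)
  then show False using \<open>xs = []\<close> by simp
qed

lemma longest_hd_nb:
  assumes "longest V xs" "xs \<noteq> []"
  shows "nb V (hd xs) \<subseteq> set xs"
proof
  fix u assume u: "u \<in> nb V (hd xs)"
  show "u \<in> set xs"
  proof (rule ccontr)
    assume "u \<notin> set xs"
    then have "path V (u # xs)"
      using assms u by (auto simp: path_Cons nb_iff longest_def)
    then show False using assms(1) unfolding longest_def by fastforce
  qed
qed

lemma longest_last_nb:
  assumes "longest V xs" "xs \<noteq> []"
  shows "nb V (last xs) \<subseteq> set xs"
  using longest_hd_nb[of V "rev xs"] assms by (simp add: longest_rev hd_rev)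

section \<open>Closing a path to a cycle\<close>

lemma path_rotate:
  assumes "path V xs" "adj (last xs) (hd xs)"
  shows "path V (rotate i xs)"
proof (cases "xs = []")
  case False
  then have *: "rotate i xs = drop (i mod length xs) xs @ take (i mod length xs) xs"
    by (simp add: rotate_drop_take)
  let ?k = "i mod length xs"
  have k: "?k < length xs" using False by simp
  show ?thesis
  proof (cases "?k = 0")
    case True
    then show ?thesis using * assms by simp
  next
    case k0: False
    then have "take ?k xs \<noteq> []" using False by simp
    moreover have "drop ?k xs \<noteq> []" using k by simp
    moreover have "last (drop ?k xs) = last xs" using k by simp
    moreover have "hd (take ?k xs) = hd xs" using k0 by (simp add: hd_take)
    moreover have "set (drop ?k xs) \<inter> set (take ?k xs) = {}"
      using path_distinct[OF assms(1)] by (metis append_take_drop_id distinct_append inf_commute)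
    ultimately show ?thesis
      unfolding * path_append using assms path_take path_drop by auto
  qed
qed (use assms in simp)

text \<open>A cycle on the vertices of a longest path can be opened anywhere, so by connectivity it is spanning.\<close>

lemma longest_cycle_spanning:
  assumes "conn V" "longest V xs" "adj (last xs) (hd xs)"
  shows "set xs = V"
proof (rule ccontr)
  assume ne: "set xs \<noteq> V"
  have p: "path V xs" using assms(2) by (simp add: longest_def)
  have "xs \<noteq> []" using longest_nonempty assms(1,2) by (auto simp: conn_def)
  then obtain u v where uv: "u \<in> set xs" "v \<in> V - set xs" "adj u v"
    using assms(1) path_set[OF p] ne unfolding conn_def by (metis set_empty2)
  obtain i where i: "i < length xs" "u = xs ! i" using uv by (metis in_set_conv_nth)
  have "path V (rotate i xs)" using path_rotate p assms(3) by blast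
  moreover have "hd (rotate i xs) = u" using i by (simp add: hd_rotate_conv_nth[OF \<open>xs \<noteq> []\<close>])
  ultimately have "path V (v # rotate i xs)"
    using uv by (auto simp: path_Cons adj_sym)
  then have "length (v # rotate i xs) \<le> length xs" using assms(2) unfolding longest_def by blast
  then show False by simp
qed

text \<open>Two crossing chords at the ends: reversing the initial segment up to position
  \<open>i\<close> joins it to the rest by the first chord, and the second chord closes the
  cycle.\<close>

lemma path_crossing:
  assumes "path V xs" "Suc i < length xs" "adj (hd xs) (xs ! Suc i)" "adj (last xs) (xs ! i)"
  obtains ys where "path V ys" "set ys = set xs" "length ys = length xs" "adj (last ys) (hd ys)"
proof
  let ?ys = "rev (take (Suc i) xs) @ drop (Suc i) xs"
  have ne: "take (Suc i) xs \<noteq> []" "drop (Suc i) xs \<noteq> []" using assms(2) by auto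
  have h: "hd (drop (Suc i) xs) = xs ! Suc i" using assms(2) by (simp add: hd_drop_conv_nth)
  have l: "last (rev (take (Suc i) xs)) = hd xs" using assms(2) by (simp add: last_rev hd_take)
  have "set (take (Suc i) xs) \<inter> set (drop (Suc i) xs) = {}"
    using path_distinct[OF assms(1)] by (metis append_take_drop_id distinct_append)
  then show "path V ?ys"
    unfolding path_append path_rev using path_take path_drop assms h l by simp
  show "set ?ys = set xs" by (metis append_take_drop_id set_append set_rev)
  show "length ?ys = length xs" using assms(2) by simp
  have "hd ?ys = xs ! i" using ne assms(2) by (simp add: hd_append hd_rev last_conv_nth)
  then show "adj (last ?ys) (hd ?ys)" using ne assms(2,4) by simp
qed

text \<open>Ore's count. Shifting the neighbours of \<open>hd xs\<close> by one position places two
  sets among \<open>length xs - 1\<close> positions; their sizes add up to more, so some position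
  carries crossing chords.\<close>

lemma path_crossing_degree:
  assumes "path V xs" "xs \<noteq> []" "nb V (hd xs) \<subseteq> set xs" "nb V (last xs) \<subseteq> set xs"
    and "length xs \<le> card (nb V (hd xs)) + card (nb V (last xs))"
  obtains ys where "path V ys" "set ys = set xs" "length ys = length xs" "adj (last ys) (hd ys)"
proof -
  let ?m = "length xs"
  define A where "A = {i. Suc i < ?m \<and> adj (hd xs) (xs ! Suc i)}"
  define B where "B = {i. Suc i < ?m \<and> adj (last xs) (xs ! i)}"
  have "nb V (hd xs) \<subseteq> (\<lambda>i. xs ! Suc i) ` A"
  proof
    fix u assume u: "u \<in> nb V (hd xs)"
    then obtain j where j: "j < ?m" "u = xs ! j" using assms(3) by (metis in_set_conv_nth subsetD)
    have "j \<noteq> 0"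
    proof
      assume "j = 0"
      then have "u = hd xs" using j assms(2) by (simp add: hd_conv_nth)
      then show False using u by (simp add: nb_iff)
    qed
    then obtain i where "j = Suc i" using not0_implies_Suc by blast
    then show "u \<in> (\<lambda>i. xs ! Suc i) ` A" using u j by (auto simp: A_def nb_iff adj_sym)
  qed
  moreover have fin: "finite A" "finite B"
    by (rule finite_subset[of _ "{..<?m}"]; auto simp: A_def B_def)+
  ultimately have cA: "card (nb V (hd xs)) \<le> card A"
    by (meson card_image_le card_mono finite_imageI le_trans)
  have "nb V (last xs) \<subseteq> (\<lambda>i. xs ! i) ` B"
  proof
    fix u assume u: "u \<in> nb V (last xs)"
    then obtain j where j: "j < ?m" "u = xs ! j" using assms(4) by (metis in_set_conv_nth subsetD)
    have "Suc j \<noteq> ?m"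
    proof
      assume "Suc j = ?m"
      then have "u = last xs" using j assms(2) by (simp add: last_conv_nth flip: \<open>Suc j = ?m\<close>)
      then show False using u by (simp add: nb_iff)
    qed
    then show "u \<in> (\<lambda>i. xs ! i) ` B" using u j by (auto simp: B_def nb_iff adj_sym)
  qed
  then have cB: "card (nb V (last xs)) \<le> card B"
    using fin by (meson card_image_le card_mono finite_imageI le_trans)
  have "A \<union> B \<subseteq> {..<?m - 1}" by (auto simp: A_def B_def)
  then have "card (A \<union> B) \<le> ?m - 1" by (metis card_lessThan card_mono finite_lessThan)
  moreover have "?m > 0" using assms(2) by simp
  ultimately have "card (A \<union> B) < card A + card B" using cA cB assms(5) by linarith
  then have "A \<inter> B \<noteq> {}" using card_Un_disjoint[OF fin] by auto
  then obtain i where "i \<in> A" "i \<in> B" by blast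
  then show thesis using path_crossing[OF assms(1)] that by (auto simp: A_def B_def)
qed

text \<open>Dirac's argument: a shorter longest path has at most \<open>2 * d\<close> vertices, so
  the degrees of its ends close it to a cycle, which must then span \<open>V\<close>.\<close>

lemma longest_length_ge:
  assumes "conn V" "finite V" "longest V xs" "\<forall>v\<in>V. d \<le> card (nb V v)"
  shows "min (card V) (2 * d + 1) \<le> length xs"
proof (rule ccontr)
  assume c: "\<not> min (card V) (2 * d + 1) \<le> length xs"
  have p: "path V xs" using assms(3) by (simp add: longest_def)
  have ne: "xs \<noteq> []" using longest_nonempty assms(1,3) by (auto simp: conn_def)
  have "hd xs \<in> V" "last xs \<in> V" using ne path_set[OF p] by auto
  then have "length xs \<le> card (nb V (hd xs)) + card (nb V (last xs))"
    using c bspec[OF assms(4), of "hd xs"] bspec[OF assms(4), of "last xs"] by simp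
  then obtain ys where ys: "path V ys" "set ys = set xs" "length ys = length xs" "adj (last ys) (hd ys)"
    using path_crossing_degree[OF p ne] longest_hd_nb longest_last_nb assms(3) ne by metis
  then have "longest V ys" using assms(3) by (simp add: longest_def)
  then have "set xs = V" using longest_cycle_spanning assms(1) ys by metis
  then have "length xs = card V" using p distinct_card path_distinct by metis
  then show False using c by simp
qed

subsection \<open>Components\<close>

lemma comp_conn: "comp V C \<Longrightarrow> conn C" by (simp add: comp_def)
lemma comp_subset: "comp V C \<Longrightarrow> C \<subseteq> V" by (simp add: comp_def)
lemma comp_nonempty: "comp V C \<Longrightarrow> C \<noteq> {}" by (simp add: comp_def conn_def)

lemma comp_nb: "comp V C \<Longrightarrow> v \<in> C \<Longrightarrow> nb V v = nb C v"
  unfolding comp_def nb_def using adj_sym by blast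

text \<open>A component is a smallest set that contains \<open>v\<close> and that no edge leaves: if
  it had a cut without edges, the side of \<open>v\<close> would be smaller and still
  closed.\<close>

lemma comp_exists:
  assumes "finite V" "v \<in> V"
  obtains C where "comp V C" "v \<in> C"
proof -
  define P where "P = (\<lambda>C. C \<subseteq> V \<and> v \<in> C \<and> (\<forall>u\<in>C. \<forall>w\<in>V - C. \<not> adj u w))"
  have "P V" using assms by (simp add: P_def)
  then obtain C where C: "P C" and min: "\<And>C'. P C' \<Longrightarrow> card C \<le> card C'"
    by (metis arg_min_nat_lemma)
  have finC: "finite C" using C assms by (meson P_def finite_subset)
  have "conn C"
    unfolding conn_def
  proof (intro conjI allI impI)
    show "C \<noteq> {}" using C by (auto simp: P_def)
    fix X assume X: "X \<subseteq> C" "X \<noteq> {}" "X \<noteq> C"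
    show "\<exists>u\<in>X. \<exists>w\<in>C - X. adj u w"
    proof (rule ccontr)
      assume no: "\<not> (\<exists>u\<in>X. \<exists>w\<in>C - X. adj u w)"
      have "P (if v \<in> X then X else C - X)"
        using C X no adj_sym unfolding P_def by (cases "v \<in> X") (simp_all, blast+)
      then have "card C \<le> card (if v \<in> X then X else C - X)" by (rule min)
      moreover have "card (if v \<in> X then X else C - X) < card C"
        using X finC by (auto intro!: psubset_card_mono)
      ultimately show False by simp
    qed
  qed
  then have "comp V C" "v \<in> C" using C by (auto simp: P_def comp_def)
  then show thesis by (rule that)
qed

lemma comp_subset_or_disjoint:
  assumes "conn C" "C \<subseteq> V" "comp V D" "C \<inter> D \<noteq> {}"
  shows "C \<subseteq> D"
proof (rule ccontr)
  assume "\<not> C \<subseteq> D"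
  then have "C \<inter> D \<subseteq> C" "C \<inter> D \<noteq> C" by auto
  then obtain u v where "u \<in> C \<inter> D" "v \<in> C - (C \<inter> D)" "adj u v"
    using assms(1,4) unfolding conn_def by meson
  then show False using assms(2,3) by (auto simp: comp_def)
qed

lemma comp_eq: "comp V C \<Longrightarrow> comp V D \<Longrightarrow> C \<inter> D \<noteq> {} \<Longrightarrow> C = D"
  by (metis comp_subset_or_disjoint comp_conn comp_subset inf_commute subset_antisym)

lemma comp_disjoint: "comp V C \<Longrightarrow> comp V D \<Longrightarrow> C \<noteq> D \<Longrightarrow> C \<inter> D = {}"
  using comp_eq by blast

lemma Union_comps: "finite V \<Longrightarrow> \<Union> {C. comp V C} = V"
  by (auto elim: comp_exists dest: comp_subset)

lemma finite_comps: "finite V \<Longrightarrow> finite {C. comp V C}"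
  by (rule finite_subset[of _ "Pow V"]) (auto simp: comp_def)

lemma comp_Diff:
  assumes "comp V D" "comp (V - D) C"
  shows "comp V C"
proof -
  have "\<not> adj u v" if "u \<in> C" "v \<in> V - C" for u v
  proof (cases "v \<in> D")
    case True
    moreover have "u \<in> V - D" using that assms(2) by (auto simp: comp_def)
    ultimately show ?thesis using assms(1) adj_sym[of u v] by (simp add: comp_def)
  qed (use assms(2) that in \<open>simp add: comp_def\<close>)
  then show ?thesis using assms by (auto simp: comp_def)
qed

lemma path_conn:
  assumes "path V xs" "xs \<noteq> []"
  shows "conn (set xs)"
  unfolding conn_def
proof (intro conjI allI impI)
  show "set xs \<noteq> {}" using assms by simp
  fix X assume X: "X \<subseteq> set xs" "X \<noteq> {}" "X \<noteq> set xs"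
  show "\<exists>u\<in>X. \<exists>v\<in>set xs - X. adj u v"
  proof (rule ccontr)
    assume no: "\<not> (\<exists>u\<in>X. \<exists>v\<in>set xs - X. adj u v)"
    have *: "xs ! i \<in> X \<longleftrightarrow> xs ! 0 \<in> X" if "i < length xs" for i
      using that
    proof (induction i)
      case (Suc i)
      then have "adj (xs ! i) (xs ! Suc i)" using path_nth_adj assms by blast
      then have "xs ! i \<in> X \<longleftrightarrow> xs ! Suc i \<in> X" using no Suc.prems by (metis DiffI Suc_lessD adj_sym nth_mem)
      then show ?case using Suc by simp
    qed simp
    then show False using X by (metis in_set_conv_nth subset_antisym subsetI ex_in_conv subset_iff)
  qed
qed

lemma path_in_comp:
  assumes "path V xs" "comp V C" "set xs \<inter> C \<noteq> {}"
  shows "path C xs"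
proof -
  have "xs \<noteq> []" using assms(3) by auto
  then have "set xs \<subseteq> C"
    using comp_subset_or_disjoint[of "set xs" V C] path_conn path_set assms by blast
  then show ?thesis using assms(1) path_subset by blast
qed

subsection \<open>Packing paths\<close>

lemma packs_mono: "packs U ls \<Longrightarrow> U \<subseteq> V \<Longrightarrow> packs V ls"
  unfolding packs_def using path_mono[of U _ V] by blast

lemma packs_Nil [simp]: "packs V []"
  by (simp add: packs_def)

lemma packs_append:
  assumes "packs U ls" "packs W ks" "U \<inter> W = {}" "U \<subseteq> V" "W \<subseteq> V"
  shows "packs V (ls @ ks)"
proof -
  obtain ps where ps: "map length ps = ls" "distinct (concat ps)" "\<forall>p\<in>set ps. path U p"
    using assms by (auto simp: packs_def)
  obtain qs where qs: "map length qs = ks" "distinct (concat qs)" "\<forall>p\<in>set qs. path W p"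
    using assms by (auto simp: packs_def)
  have "set (concat ps) \<subseteq> U" "set (concat qs) \<subseteq> W" using ps qs by (auto dest!: path_set)
  then have "distinct (concat (ps @ qs))" using ps(2) qs(2) assms(3)
    unfolding concat_append distinct_append by blast
  moreover have "\<forall>p\<in>set (ps @ qs). path V p" using ps qs assms path_mono by auto
  moreover have "map length (ps @ qs) = ls @ ks" using ps qs by simp
  ultimately show ?thesis unfolding packs_def by blast
qed

lemma packs_single: "packs V [l] \<longleftrightarrow> (\<exists>xs. path V xs \<and> length xs = l)"
proof
  assume "\<exists>xs. path V xs \<and> length xs = l"
  then obtain xs where "path V xs" "length xs = l" by blast
  then show "packs V [l]" unfolding packs_def by (intro exI[of _ "[xs]"]) (simp add: path_distinct)
qed (auto simp: packs_def)

lemma packs_path: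
  assumes "path V xs" "sum_list ls \<le> length xs"
  shows "packs (set xs) ls"
  using assms
proof (induction ls arbitrary: xs)
  case (Cons l ls)
  have d: "set (take l xs) \<inter> set (drop l xs) = {}"
    using path_distinct[OF Cons.prems(1)] by (metis append_take_drop_id distinct_append)
  have "packs (set (drop l xs)) ls"
    using Cons.prems path_drop by (intro Cons.IH) auto
  moreover have "packs (set (take l xs)) [l]"
    unfolding packs_single using Cons.prems
    by (intro exI[of _ "take l xs"]) (auto intro: path_subset path_take)
  ultimately have "packs (set xs) ([l] @ ls)"
    using d by (intro packs_append) (auto dest: in_set_takeD in_set_dropD)
  then show ?case by simp
qed simp

lemma permute_map:
  "mset (map f xs) = mset ys \<Longrightarrow> \<exists>zs. mset zs = mset xs \<and> map f zs = ys"
proof (induction ys arbitrary: xs)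
  case (Cons y ys)
  have "y \<in># mset (map f xs)" unfolding Cons.prems by simp
  then obtain x where x: "x \<in> set xs" "f x = y" by auto
  then obtain us vs where xs: "xs = us @ x # vs" by (meson split_list)
  have "add_mset y (mset (map f (us @ vs))) = mset (y # ys)"
    using Cons.prems x(2) unfolding xs by auto
  then have "mset (map f (us @ vs)) = mset ys" by simp
  then obtain zs where "mset zs = mset (us @ vs)" "map f zs = ys" using Cons.IH by blast
  then have "mset (x # zs) = mset xs \<and> map f (x # zs) = y # ys" using xs x by simp
  then show ?case by (rule exI)
qed simp

lemma packs_perm:
  assumes "packs V ls" "mset ls = mset ks"
  shows "packs V ks"
proof -
  obtain ps where ps: "map length ps = ls" "distinct (concat ps)" "\<forall>p\<in>set ps. path V p"
    using assms by (auto simp: packs_def)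
  obtain qs where qs: "mset qs = mset ps" "map length qs = ks"
    using permute_map[of length ps ks] ps assms by metis
  have "mset (concat qs) = mset (concat ps)" by (metis qs(1) mset_concat mset_map sum_mset_sum_list)
  then have "distinct (concat qs)" using ps mset_eq_imp_distinct_iff by blast
  moreover have "\<forall>p\<in>set qs. path V p" using ps qs by (metis mset_eq_setD)
  ultimately show ?thesis using qs unfolding packs_def by blast
qed

lemma packs_two_paths:
  assumes "path V xs" "path V ys" "set xs \<inter> set ys = {}"
    and "mset ls = mset ls1 + mset ls2" "sum_list ls1 \<le> length xs" "sum_list ls2 \<le> length ys"
  shows "packs V ls"
proof -
  have "packs V (ls1 @ ls2)"
    using packs_append[OF packs_path[OF assms(1,5)] packs_path[OF assms(2,6)] assms(3)]
      path_set assms by blast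
  then show ?thesis using packs_perm assms(4) by (metis mset_append)
qed

end

subsection \<open>Binomial inequalities\<close>

text \<open>Factor by factor this is \<open>2 * (b - j) \<le> 2 * b - j\<close>.\<close>

lemma pow2_binomial_le: "2 ^ j * (b choose j) \<le> (2 * b) choose j"
proof (induction j)
  case (Suc j)
  have "Suc j * (2 ^ Suc j * (b choose Suc j)) = (2 ^ j * (b choose j)) * (2 * (b - j))"
    by (metis (no_types, opaque_lifting) binomial_absorb_comp mult.assoc mult.commute mult.left_commute power_Suc binomial_absorption Suc_times_binomial_eq)
  also have "\<dots> \<le> ((2 * b) choose j) * (2 * b - j)"
    by (intro mult_mono Suc.IH) auto
  also have "\<dots> = Suc j * ((2 * b) choose Suc j)"
    by (metis binomial_absorb_comp binomial_absorption mult.commute)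
  finally show ?case by (simp only: Suc_mult_le_cancel1)
qed simp

text \<open>By \<open>s \<le> 2 ^ (s - 1)\<close>. Halving the upper index thus absorbs the factor
  \<open>s\<close> that appears when the cliques at one vertex are compared with the average over a
  complete graph.\<close>

lemma mult_binomial_le:
  assumes "s \<ge> 1"
  shows "s * (b choose (s - 1)) \<le> (2 * b) choose (s - 1)"
proof -
  have "s \<le> 2 ^ (s - 1)" using assms less_exp[of "s - 1"] by linarith
  then have "s * (b choose (s - 1)) \<le> 2 ^ (s - 1) * (b choose (s - 1))" by simp
  then show ?thesis using pow2_binomial_le le_trans by blast
qed

context loopless
begin

subsection \<open>Counting cliques\<close>

definition cl :: "nat \<Rightarrow> 'a set \<Rightarrow> 'a set set" where
  "cl s V = {K. K \<subseteq> V \<and> card K = s \<and> (\<forall>u\<in>K. \<forall>v\<in>K. u \<noteq> v \<longrightarrow> adj u v)}"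

lemma num_cliques_eq: "num_cliques s V E = card (cl s V)"
  by (simp add: num_cliques_def cl_def adj_def)

lemma finite_cl: "finite V \<Longrightarrow> finite (cl s V)"
  by (rule finite_subset[of _ "Pow V"]) (auto simp: cl_def)

text \<open>These are the cliques lost when \<open>X\<close> is deleted.\<close>

definition touching :: "nat \<Rightarrow> 'a set \<Rightarrow> 'a set \<Rightarrow> 'a set set" where
  "touching s V X = {K \<in> cl s V. K \<inter> X \<noteq> {}}"

lemma finite_touching: "finite V \<Longrightarrow> finite (touching s V X)"
  by (simp add: touching_def finite_cl)

lemma card_cl_le_binomial: "finite V \<Longrightarrow> card (cl s V) \<le> card V choose s"
proof -
  assume f: "finite V"
  have "card (cl s V) \<le> card {K. K \<subseteq> V \<and> card K = s}"
    using f by (intro card_mono) (auto simp: cl_def)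
  then show ?thesis using n_subsets[OF f] by simp
qed

lemma card_cl_le_Diff:
  assumes "finite V"
  shows "card (cl s V) \<le> card (cl s (V - X)) + card (touching s V X)"
proof -
  have "cl s V \<subseteq> cl s (V - X) \<union> touching s V X" by (auto simp: cl_def touching_def)
  then have "card (cl s V) \<le> card (cl s (V - X) \<union> touching s V X)"
    using assms by (intro card_mono) (auto simp: finite_cl finite_touching)
  also have "\<dots> \<le> card (cl s (V - X)) + card (touching s V X)" by (rule card_Un_le)
  finally show ?thesis .
qed

lemma card_touching_vertex:
  assumes "finite V" "s \<ge> 1"
  shows "card (touching s V {v}) \<le> card (nb V v) choose (s - 1)"
proof -
  have "inj_on (\<lambda>K. K - {v}) (touching s V {v})"
    by (auto simp: inj_on_def touching_def)
  moreover have "(\<lambda>K. K - {v}) ` touching s V {v} \<subseteq> {J. J \<subseteq> nb V v \<and> card J = s - 1}"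
  proof (clarify, intro conjI)
    fix K assume K: "K \<in> touching s V {v}"
    then show "K - {v} \<subseteq> nb V v" by (auto simp: touching_def cl_def nb_def)
    have "v \<in> K" "finite K" "card K = s" using K assms by (auto simp: touching_def cl_def finite_subset)
    then show "card (K - {v}) = s - 1" by simp
  qed
  moreover have "finite {J. J \<subseteq> nb V v \<and> card J = s - 1}" using finite_nb assms by simp
  ultimately have "card (touching s V {v}) \<le> card {J. J \<subseteq> nb V v \<and> card J = s - 1}"
    by (rule card_inj_on_le)
  then show ?thesis using n_subsets[OF finite_nb[OF assms(1)]] by metis
qed

text \<open>No edge joins \<open>X\<close> to a vertex outside \<open>X \<union> Z\<close>, so a
  clique meeting \<open>X\<close> stays inside this set.\<close>

lemma card_touching_comp:
  assumes "finite V" "Z \<subseteq> V" "comp (V - Z) X"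
  shows "card (touching s V X) \<le> (card X + card Z) choose s"
proof -
  have X: "X \<subseteq> V - Z" using assms(3) by (simp add: comp_def)
  have "touching s V X \<subseteq> {K. K \<subseteq> X \<union> Z \<and> card K = s}"
  proof
    fix K assume K: "K \<in> touching s V X"
    then obtain x where x: "x \<in> K" "x \<in> X" by (auto simp: touching_def)
    have "y \<in> X \<union> Z" if "y \<in> K" for y
    proof (rule ccontr)
      assume "y \<notin> X \<union> Z"
      then have "y \<in> V - Z - X" "adj x y" using that K x by (auto simp: touching_def cl_def)
      then show False using assms(3) x by (auto simp: comp_def)
    qed
    then show "K \<in> {K. K \<subseteq> X \<union> Z \<and> card K = s}" using K by (auto simp: touching_def cl_def)
  qed
  moreover have fin: "finite (X \<union> Z)" using X assms by (meson Diff_subset finite_UnI finite_subset)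
  ultimately have "card (touching s V X) \<le> card {K. K \<subseteq> X \<union> Z \<and> card K = s}"
    by (intro card_mono) auto
  also have "\<dots> = card (X \<union> Z) choose s" by (rule n_subsets[OF fin])
  also have "card (X \<union> Z) = card X + card Z"
    using X fin by (intro card_Un_disjoint) auto
  finally show ?thesis .
qed

lemma card_cl_le_sum_comps:
  assumes "finite V" "s \<ge> 1"
  shows "card (cl s V) \<le> (\<Sum>C | comp V C. card (cl s C))"
proof -
  have "cl s V \<subseteq> (\<Union>C\<in>{C. comp V C}. cl s C)"
  proof
    fix K assume K: "K \<in> cl s V"
    then have "K \<noteq> {}" using assms(2) by (auto simp: cl_def)
    then obtain x where x: "x \<in> K" by blast
    then obtain C where C: "comp V C" "x \<in> C" using comp_exists[OF assms(1)] K by (auto simp: cl_def)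
    have "K \<subseteq> C"
    proof
      fix y assume y: "y \<in> K"
      show "y \<in> C"
      proof (rule ccontr)
        assume "y \<notin> C"
        then have "y \<in> V - C" "adj x y" using K x y C by (auto simp: cl_def)
        then show False using C by (auto simp: comp_def)
      qed
    qed
    then show "K \<in> (\<Union>C\<in>{C. comp V C}. cl s C)" using K C by (auto simp: cl_def)
  qed
  then have "card (cl s V) \<le> card (\<Union>C\<in>{C. comp V C}. cl s C)"
    using finite_comps[OF assms(1)] assms(1)
    by (intro card_mono finite_UN_I) (auto intro!: finite_cl dest: comp_subset intro: finite_subset)
  also have "\<dots> \<le> (\<Sum>C | comp V C. card (cl s C))"
    using finite_comps[OF assms(1)] by (rule card_UN_le)
  finally show ?thesis .
qed

text \<open>As long as some nonempty set loses at most \<open>k\<close> cliques per vertex, it is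
  removed. Allowing sets matters: the last property is applied to single vertices and also to a
  whole component.\<close>

lemma deletion:
  assumes "finite V"
  obtains W where "W \<subseteq> V" "card (cl s V) \<le> card (cl s W) + k * card (V - W)"
    "\<And>X. X \<subseteq> W \<Longrightarrow> X \<noteq> {} \<Longrightarrow> k * card X < card (touching s W X)"
proof -
  have "\<exists>W\<subseteq>V. card (cl s V) \<le> card (cl s W) + k * card (V - W) \<and>
    (\<forall>X. X \<subseteq> W \<longrightarrow> X \<noteq> {} \<longrightarrow> k * card X < card (touching s W X))"
    using assms
  proof (induction "card V" arbitrary: V rule: less_induct)
    case less
    show ?case
    proof (cases "\<forall>X. X \<subseteq> V \<longrightarrow> X \<noteq> {} \<longrightarrow> k * card X < card (touching s V X)")
      case True
      then show ?thesis by (intro exI[of _ V]) simp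
    next
      case False
      then obtain X where X: "X \<subseteq> V" "X \<noteq> {}" "card (touching s V X) \<le> k * card X"
        unfolding not_all not_imp not_less by blast
      have c: "card (V - X) < card V" using X less.prems by (intro psubset_card_mono) auto
      obtain W where W: "W \<subseteq> V - X" "card (cl s (V - X)) \<le> card (cl s W) + k * card (V - X - W)"
        "\<forall>Y. Y \<subseteq> W \<longrightarrow> Y \<noteq> {} \<longrightarrow> k * card Y < card (touching s W Y)"
        using less.hyps[OF c] less.prems by auto
      have "V - W = (V - X - W) \<union> X" using W(1) X(1) by auto
      moreover have "card ((V - X - W) \<union> X) = card (V - X - W) + card X"
        using less.prems X(1) by (intro card_Un_disjoint) (auto intro: finite_subset)
      ultimately have "k * card (V - W) = k * card (V - X - W) + k * card X"
        by (simp add: algebra_simps)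
      then have "card (cl s V) \<le> card (cl s W) + k * card (V - W)"
        using card_cl_le_Diff[OF less.prems, of s X] W(2) X(3) by linarith
      then show ?thesis using W by (intro exI[of _ W]) auto
    qed
  qed
  then show thesis using that by blast
qed

lemma comp_card_le_path:
  assumes "finite V" "comp V C" "\<forall>v\<in>V. d \<le> card (nb V v)"
  obtains xs where "path C xs" "min (card C) (2 * d + 1) \<le> length xs"
proof -
  have fin: "finite C" using assms(1) comp_subset[OF assms(2)] by (rule rev_finite_subset)
  obtain xs where xs: "longest C xs" using longest_exists fin by blast
  have "\<forall>v\<in>C. d \<le> card (nb C v)"
    using assms(3) comp_nb[OF assms(2)] comp_subset[OF assms(2)] by (metis subsetD)
  then have "min (card C) (2 * d + 1) \<le> length xs"
    using longest_length_ge comp_conn assms(2) fin xs by blast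
  then show thesis using that xs by (auto simp: longest_def)
qed

text \<open>Luo's bound: a vertex of degree at most half of the path length, or else a whole component, is removed.\<close>

lemma path_free_cliques:
  assumes "finite V" "s \<ge> 1" "p \<ge> 2" "\<forall>xs. path V xs \<longrightarrow> length xs < p"
  shows "(p - 1) * card (cl s V) \<le> card V * ((p - 1) choose s)"
  using assms(1,4)
proof (induction "card V" arbitrary: V rule: less_induct)
  case less
  have step: "(p - 1) * card (cl s V) \<le> card V * ((p - 1) choose s)"
    if X: "X \<subseteq> V" "X \<noteq> {}" "(p - 1) * card (touching s V X) \<le> card X * ((p - 1) choose s)" for X
  proof -
    have "card (V - X) < card V" using X less.prems by (intro psubset_card_mono) auto
    moreover have "\<forall>xs. path (V - X) xs \<longrightarrow> length xs < p" using less.prems(2) path_mono by blast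
    ultimately have "(p - 1) * card (cl s (V - X)) \<le> card (V - X) * ((p - 1) choose s)"
      using less.hyps less.prems by blast
    moreover have "(p - 1) * card (cl s V) \<le> (p - 1) * card (cl s (V - X)) + (p - 1) * card (touching s V X)"
      using card_cl_le_Diff[OF less.prems(1), of s X] by (metis add_mult_distrib2 mult_le_mono2)
    moreover have "card V = card (V - X) + card X"
      using X less.prems(1) by (metis card_Diff_subset card_mono finite_subset le_add_diff_inverse2)
    ultimately show ?thesis using X(3) by (simp add: algebra_simps)
  qed
  have absorb: "s * ((p - 1) choose s) = (p - 1) * ((p - 2) choose (s - 1))"
    using times_binomial_minus1_eq[of s "p - 1"] assms(2) by (simp add: numeral_2_eq_2)
  show ?case
  proof (cases "V = {}")
    case True
    then have "cl s V = {}" using assms(2) by (auto simp: cl_def)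
    then show ?thesis by simp
  next
    case ne: False
    show ?thesis
    proof (cases "\<exists>v\<in>V. card (nb V v) \<le> (p - 2) div 2")
      case True
      then obtain v where v: "v \<in> V" "card (nb V v) \<le> (p - 2) div 2" by blast
      let ?b = "(p - 2) div 2"
      have "card (touching s V {v}) \<le> card (nb V v) choose (s - 1)"
        using card_touching_vertex less.prems(1) assms(2) by blast
      also have "\<dots> \<le> ?b choose (s - 1)" using v(2) by (rule binomial_right_mono)
      finally have t: "card (touching s V {v}) \<le> ?b choose (s - 1)" .
      \<comment> \<open>Half the degree makes up for the factor \<open>s\<close>: such a vertex
        costs at most \<open>((p - 1) choose s) / (p - 1)\<close>, the average share of a vertex of
        a complete graph on \<open>p - 1\<close> vertices.\<close>
      have "s * (?b choose (s - 1)) \<le> (2 * ?b) choose (s - 1)" using mult_binomial_le assms(2) by blast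
      also have "\<dots> \<le> (p - 2) choose (s - 1)" by (rule binomial_right_mono) simp
      finally have "s * card (touching s V {v}) \<le> (p - 2) choose (s - 1)"
        using t by (meson le_trans mult_le_mono2)
      then have "(p - 1) * (s * card (touching s V {v})) \<le> s * ((p - 1) choose s)"
        unfolding absorb by (rule mult_le_mono2)
      then have "s * ((p - 1) * card (touching s V {v})) \<le> s * ((p - 1) choose s)"
        by (simp add: algebra_simps)
      then have "(p - 1) * card (touching s V {v}) \<le> (p - 1) choose s" using assms(2) by simp
      then show ?thesis using step[of "{v}"] v by simp
    next
      case False
      \<comment> \<open>Twice this degree plus one is at least \<open>p\<close>, so a component on
        \<open>p\<close> or more vertices would contain a path on \<open>p\<close> vertices.\<close>
      then have deg: "\<forall>v\<in>V. Suc ((p - 2) div 2) \<le> card (nb V v)" by force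
      obtain C where C: "comp V C" using ne comp_exists less.prems(1) by blast
      obtain xs where xs: "path C xs" "min (card C) (2 * Suc ((p - 2) div 2) + 1) \<le> length xs"
        using comp_card_le_path[OF less.prems(1) C deg] by blast
      have "path V xs" using xs C path_mono comp_subset by blast
      then have "length xs < p" using less.prems(2) by blast
      then have "card C \<le> p - 1" using xs(2) assms(3) by (simp add: min_def split: if_splits)
      have "card (touching s V C) \<le> card C choose s"
        using card_touching_comp[of V "{}" C s] less.prems(1) C by simp
      then have "s * ((p - 1) * card (touching s V C)) \<le> (p - 1) * (s * (card C choose s))"
        unfolding mult.left_commute[of s] by (intro mult_le_mono2)
      also have "s * (card C choose s) = card C * ((card C - 1) choose (s - 1))"
        using times_binomial_minus1_eq[of s "card C"] assms(2) by simp
      also have "(p - 1) * (card C * ((card C - 1) choose (s - 1))) \<le> (p - 1) * (card C * ((p - 2) choose (s - 1)))"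
        using \<open>card C \<le> p - 1\<close> by (intro mult_le_mono2 binomial_right_mono) linarith
      also have "\<dots> = s * (card C * ((p - 1) choose s))"
        unfolding mult.left_commute[of s] absorb by (rule mult.left_commute)
      finally have "(p - 1) * card (touching s V C) \<le> card C * ((p - 1) choose s)" using assms(2) by simp
      then show ?thesis using step[of C] C comp_subset comp_nonempty by blast
    qed
  qed
qed

text \<open>The components of \<open>V - Z\<close> are peeled off one at a time, each with all
  cliques that meet it; the quotient of \<open>a\<close> by \<open>b\<close> is the allowance per
  vertex, written as a fraction of natural numbers. At the end only \<open>Z\<close> is
  left.\<close>

lemma cliques_small_comps:
  assumes "finite V" "Z \<subseteq> V" "\<And>C. comp (V - Z) C \<Longrightarrow> b * ((card C + card Z) choose s) \<le> a * card C"
  shows "b * card (cl s V) \<le> a * card (V - Z) + b * (card Z choose s)"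
  using assms
proof (induction "card V" arbitrary: V rule: less_induct)
  case less
  show ?case
  proof (cases "V - Z = {}")
    case True
    then have "V = Z" using less.prems(2) by blast
    then show ?thesis using card_cl_le_binomial less.prems(1) by simp
  next
    case False
    then obtain C where C: "comp (V - Z) C" using comp_exists less.prems(1) by (metis all_not_in_conv finite_Diff)
    have C': "C \<subseteq> V - Z" "C \<noteq> {}" using C comp_subset comp_nonempty by auto
    have "card (V - C) < card V" using C' less.prems by (intro psubset_card_mono) auto
    moreover have "b * ((card D + card Z) choose s) \<le> a * card D" if "comp (V - C - Z) D" for D
      using less.prems(3) comp_Diff[OF C, of D] that by (simp add: Diff_eq Int_ac)
    moreover have "Z \<subseteq> V - C" using C' less.prems(2) by blast
    ultimately have "b * card (cl s (V - C)) \<le> a * card (V - C - Z) + b * (card Z choose s)"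
      using less.hyps[of "V - C"] less.prems(1) by simp
    moreover have "b * card (cl s V) \<le> b * card (cl s (V - C)) + b * card (touching s V C)"
      using card_cl_le_Diff[OF less.prems(1), of s C] by (metis add_mult_distrib2 mult_le_mono2)
    moreover have "b * card (touching s V C) \<le> a * card C"
      using card_touching_comp[OF less.prems(1,2) C, of s] less.prems(3)[OF C] by (meson le_trans mult_le_mono2)
    moreover have "card (V - Z) = card (V - C - Z) + card C"
    proof -
      have "V - Z = (V - C - Z) \<union> C" using C' by blast
      then show ?thesis using less.prems(1) C'
        by (metis (no_types, lifting) Diff_disjoint Diff_eq Int_Diff card_Un_disjoint finite_Diff finite_Un inf_commute inf_left_commute)
    qed
    ultimately show ?thesis by (simp add: algebra_simps)
  qed
qed

end

section \<open>Systems of distinct representatives\<close>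

text \<open>Halmos-Vaughan induction: a proper nonempty set without surplus is matched first and its
  representatives are withdrawn; if every such set has a surplus, any first choice is
  harmless.\<close>

lemma hall:
  fixes N :: "'a \<Rightarrow> 'b set"
  assumes "finite A" "\<And>x. x \<in> A \<Longrightarrow> finite (N x)" "\<And>X. X \<subseteq> A \<Longrightarrow> card X \<le> card (\<Union> (N ` X))"
  shows "\<exists>r. inj_on r A \<and> (\<forall>x\<in>A. r x \<in> N x)"
  using assms
proof (induction "card A" arbitrary: A N rule: less_induct)
  case less
  have finN: "finite (\<Union> (N ` X))" if "X \<subseteq> A" for X
    using that less.prems(1,2) by (auto intro: finite_subset)
  show ?case
  proof (cases "A = {}")
    case True
    then show ?thesis by simp
  next
    case ne: False
    show ?thesis
    proof (cases "\<exists>X\<subseteq>A. X \<noteq> {} \<and> X \<noteq> A \<and> card (\<Union> (N ` X)) \<le> card X")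
      case True
      then obtain X where X: "X \<subseteq> A" "X \<noteq> {}" "X \<noteq> A" "card (\<Union> (N ` X)) \<le> card X" by blast
      have fX: "finite X" using X less.prems(1) finite_subset by blast
      have "card X < card A" using X less.prems(1) by (intro psubset_card_mono) auto
      then obtain r where r: "inj_on r X" "\<forall>x\<in>X. r x \<in> N x"
        using less.hyps[of X N, OF _ fX less.prems(2) less.prems(3)] X(1) by blast
      have "card (A - X) < card A" using X less.prems(1) by (intro psubset_card_mono) auto
      moreover have "card Y \<le> card (\<Union> ((\<lambda>x. N x - \<Union> (N ` X)) ` Y))" if Y: "Y \<subseteq> A - X" for Y
      proof -
        have eq: "\<Union> ((\<lambda>x. N x - \<Union> (N ` X)) ` Y) = \<Union> (N ` (Y \<union> X)) - \<Union> (N ` X)" by auto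
        have "card Y + card X = card (Y \<union> X)"
          using Y fX less.prems(1) by (intro card_Un_disjoint[symmetric]) (auto intro: finite_subset)
        also have "\<dots> \<le> card (\<Union> (N ` (Y \<union> X)))" using Y X(1) by (intro less.prems(3)) auto
        also have "\<dots> = card (\<Union> (N ` (Y \<union> X)) - \<Union> (N ` X)) + card (\<Union> (N ` X))"
        proof -
          have "\<Union> (N ` X) \<subseteq> \<Union> (N ` (Y \<union> X))" by auto
          moreover have "finite (\<Union> (N ` (Y \<union> X)))" using Y X(1) by (intro finN) auto
          ultimately show ?thesis
            by (metis card_Diff_subset card_mono finite_subset le_add_diff_inverse2)
        qed
        finally show ?thesis unfolding eq using X(4) by linarith
      qed
      ultimately obtain r' where r': "inj_on r' (A - X)" "\<forall>x\<in>A - X. r' x \<in> N x - \<Union> (N ` X)"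
        using less.hyps[of "A - X" "\<lambda>x. N x - \<Union> (N ` X)"] less.prems(1,2) by auto
      let ?r = "\<lambda>x. if x \<in> X then r x else r' x"
      have "inj_on ?r A"
      proof (rule inj_onI)
        fix x y assume xy: "x \<in> A" "y \<in> A" "?r x = ?r y"
        have "r u \<noteq> r' v" if "u \<in> X" "v \<in> A - X" for u v using r(2) r'(2) that by fastforce
        then show "x = y" using xy r(1) r'(1) by (auto simp: inj_on_def split: if_splits) metis+
      qed
      moreover have "\<forall>x\<in>A. ?r x \<in> N x" using r(2) r'(2) by auto
      ultimately show ?thesis by (intro exI[of _ ?r]) simp
    next
      case False
      then have gap: "card X < card (\<Union> (N ` X))" if "X \<subseteq> A" "X \<noteq> {}" "X \<noteq> A" for X
        using that by (meson not_le)
      obtain a where a: "a \<in> A" using ne by blast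
      have "card {a} \<le> card (\<Union> (N ` {a}))" using a by (intro less.prems(3)) simp
      then have "N a \<noteq> {}" by auto
      then obtain b where b: "b \<in> N a" by blast
      have "card (A - {a}) < card A" using a less.prems(1) by (intro psubset_card_mono) auto
      moreover have "card Y \<le> card (\<Union> ((\<lambda>x. N x - {b}) ` Y))" if Y: "Y \<subseteq> A - {a}" for Y
      proof (cases "Y = {}")
        case False
        have eq: "\<Union> ((\<lambda>x. N x - {b}) ` Y) = \<Union> (N ` Y) - {b}" by auto
        have "card Y < card (\<Union> (N ` Y))" using Y False a by (intro gap) auto
        moreover have "card (\<Union> (N ` Y)) - 1 \<le> card (\<Union> (N ` Y) - {b})"
          by (simp add: card_Diff_singleton_if)
        ultimately show ?thesis unfolding eq by linarith
      qed simp
      ultimately obtain r where r: "inj_on r (A - {a})" "\<forall>x\<in>A - {a}. r x \<in> N x - {b}"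
        using less.hyps[of "A - {a}" "\<lambda>x. N x - {b}"] less.prems(1,2) by auto
      have "inj_on (r(a := b)) A" using r by (auto simp: inj_on_def)
      moreover have "\<forall>x\<in>A. (r(a := b)) x \<in> N x" using r b by auto
      ultimately show ?thesis by blast
    qed
  qed
qed

text \<open>Choosing \<open>Z\<close> maximal leaves every nonempty subset of \<open>A - Z\<close> with a surplus of one.\<close>

lemma surplus_matching:
  fixes N :: "'a \<Rightarrow> 'b set"
  assumes "finite A" "\<And>x. x \<in> A \<Longrightarrow> finite (N x)"
  obtains Z where "Z \<subseteq> A" "card (\<Union> (N ` Z)) \<le> card Z"
    "\<And>w. \<exists>r. inj_on r (A - Z) \<and> (\<forall>x\<in>A - Z. r x \<in> N x - \<Union> (N ` Z) - {w})"
proof -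
  define P where "P = (\<lambda>Z. Z \<subseteq> A \<and> card (\<Union> (N ` Z)) \<le> card Z)"
  have "P {}" by (simp add: P_def)
  moreover have "\<forall>Z. P Z \<longrightarrow> card Z < Suc (card A)"
    using assms(1) by (auto simp: P_def less_Suc_eq_le card_mono)
  ultimately obtain Z where Z: "P Z" and max: "\<And>Y. P Y \<Longrightarrow> card Y \<le> card Z"
    using arg_max_nat_lemma[of P "{}" card "Suc (card A)"] by blast
  have ZA: "Z \<subseteq> A" "card (\<Union> (N ` Z)) \<le> card Z" using Z by (auto simp: P_def)
  have fZ: "finite Z" using ZA(1) assms(1) finite_subset by blast
  have "\<exists>r. inj_on r (A - Z) \<and> (\<forall>x\<in>A - Z. r x \<in> N x - \<Union> (N ` Z) - {w})" for w
  proof (rule hall)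
    show "finite (A - Z)" using assms(1) by simp
    show "finite (N x - \<Union> (N ` Z) - {w})" if "x \<in> A - Z" for x using that assms(2) by simp
    fix X assume X: "X \<subseteq> A - Z"
    show "card X \<le> card (\<Union> ((\<lambda>x. N x - \<Union> (N ` Z) - {w}) ` X))"
    proof (cases "X = {}")
      case False
      have fX: "finite X" using X assms(1) by (meson finite_Diff finite_subset)
      have eq: "\<Union> ((\<lambda>x. N x - \<Union> (N ` Z) - {w}) ` X) = \<Union> (N ` (X \<union> Z)) - \<Union> (N ` Z) - {w}" by auto
      have c: "card (X \<union> Z) = card X + card Z" using X fX fZ by (intro card_Un_disjoint) auto
      have "card X > 0" using False fX by (simp add: card_gt_0_iff)
      \<comment> \<open>By maximality of \<open>Z\<close> the set \<open>X \<union> Z\<close> has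
        more than \<open>card X + card Z\<close> candidates, of which at most \<open>card Z\<close>
        belong to \<open>Z\<close>. So \<open>X\<close> has one to spare, and that one may be
        \<open>w\<close>.\<close>
      then have "\<not> P (X \<union> Z)" using max[of "X \<union> Z"] c by linarith
      then have big: "card X + card Z < card (\<Union> (N ` (X \<union> Z)))" using c ZA(1) X by (auto simp: P_def)
      have fin: "finite (\<Union> (N ` (X \<union> Z)))" using fX fZ assms(2) X ZA(1) by auto
      have "\<Union> (N ` Z) \<subseteq> \<Union> (N ` (X \<union> Z))" by auto
      then have "card (\<Union> (N ` (X \<union> Z)) - \<Union> (N ` Z)) = card (\<Union> (N ` (X \<union> Z))) - card (\<Union> (N ` Z))"
        using fin by (meson card_Diff_subset finite_subset)
      then have "card X < card (\<Union> (N ` (X \<union> Z)) - \<Union> (N ` Z))" using big ZA(2) by linarith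
      moreover have "card (\<Union> (N ` (X \<union> Z)) - \<Union> (N ` Z)) - 1 \<le> card (\<Union> (N ` (X \<union> Z)) - \<Union> (N ` Z) - {w})"
        by (simp add: card_Diff_singleton_if)
      ultimately show ?thesis unfolding eq by linarith
    qed simp
  qed
  then show thesis using that[OF ZA] by blast
qed

section \<open>Marked paths\<close>

definition nonconsec :: "'a set \<Rightarrow> 'a list \<Rightarrow> bool" where
  "nonconsec M xs \<longleftrightarrow> successively (\<lambda>x y. \<not> (x \<in> M \<and> y \<in> M)) xs"

definition marks :: "'a set \<Rightarrow> 'a list \<Rightarrow> nat" where
  "marks M xs = length (filter (\<lambda>x. x \<in> M) xs)"

lemma marks_append: "marks M (xs @ ys) = marks M xs + marks M ys"
  by (simp add: marks_def)

lemma marks_eq_card: "distinct xs \<Longrightarrow> M \<subseteq> set xs \<Longrightarrow> marks M xs = card M"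
proof -
  assume d: "distinct xs" "M \<subseteq> set xs"
  have "set (filter (\<lambda>x. x \<in> M) xs) = M" using d by auto
  then show ?thesis unfolding marks_def using d by (metis distinct_card distinct_filter)
qed

lemma nonconsec_drop: "nonconsec M xs \<Longrightarrow> nonconsec M (drop k xs)"
  unfolding nonconsec_def by (metis append_take_drop_id successively_append_iff)

lemma nonconsec_take: "nonconsec M xs \<Longrightarrow> nonconsec M (take k xs)"
  unfolding nonconsec_def by (metis append_take_drop_id successively_append_iff)

lemma nonconsec_nth: "nonconsec M xs \<longleftrightarrow> (\<forall>i. Suc i < length xs \<longrightarrow> \<not> (xs ! i \<in> M \<and> xs ! Suc i \<in> M))"
  by (simp add: nonconsec_def successively_conv_nth)

text \<open>Each marked vertex is charged to the unmarked vertex in front of it.\<close>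

lemma marks_le_half:
  "nonconsec M xs \<Longrightarrow> xs = [] \<or> hd xs \<notin> M \<Longrightarrow> marks M xs \<le> length xs div 2"
proof (induction "length xs" arbitrary: xs rule: less_induct)
  case less
  show ?case
  proof (cases xs)
    case (Cons x ys)
    show ?thesis
    proof (cases ys)
      case Nil
      then show ?thesis using Cons less.prems by (simp add: marks_def)
    next
      case ys: (Cons y zs)
      show ?thesis
      proof (cases "y \<in> M")
        case True
        then have "zs = [] \<or> hd zs \<notin> M" "nonconsec M zs"
          using less.prems Cons ys by (auto simp: nonconsec_def successively_Cons)
        then have "marks M zs \<le> length zs div 2" using less.hyps[of zs] Cons ys by simp
        then show ?thesis using Cons ys less.prems by (simp add: marks_def)
      next
        case False
        then have "nonconsec M ys" using less.prems Cons ys by (simp add: nonconsec_def)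
        then have "marks M ys \<le> length ys div 2" using less.hyps[of ys] Cons ys False by simp
        then show ?thesis using Cons less.prems by (simp add: marks_def)
      qed
    qed
  qed (simp add: marks_def)
qed

text \<open>The unmarked last vertex is left over by the charging of
  \<open>marks_le_half\<close>.\<close>

lemma marks_lt_half:
  assumes "nonconsec M xs" "xs \<noteq> []" "hd xs \<notin> M" "last xs \<notin> M"
  shows "2 * marks M xs + 1 \<le> length xs"
proof -
  have e: "xs = butlast xs @ [last xs]" using assms(2) by simp
  have "marks M xs = marks M (butlast xs)"
    by (subst e, subst marks_append) (simp add: marks_def assms(4))
  moreover have "marks M (butlast xs) \<le> length (butlast xs) div 2"
  proof (rule marks_le_half)
    show "nonconsec M (butlast xs)" using assms(1) by (simp add: butlast_conv_take nonconsec_take)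
    show "butlast xs = [] \<or> hd (butlast xs) \<notin> M" using assms(2,3) e by (metis hd_append2)
  qed
  moreover have "length (butlast xs) + 1 = length xs" using assms(2) by (simp add: Suc_leI)
  ultimately show ?thesis by linarith
qed

context loopless
begin

text \<open>Cutting a path greedily, a piece on \<open>l\<close> vertices consumes at most \<open>l div 2\<close> marks: whenever it
  would start at a marked vertex, the private neighbour of that vertex is put in front.\<close>

lemma packs_marks:
  assumes "path V xs" "nonconsec M xs" "inj_on r M" "r ` M \<subseteq> V" "r ` M \<inter> set xs = {}" "r ` M \<inter> M = {}"
    and "\<forall>x\<in>M. adj (r x) x" "\<forall>l\<in>set ls. 2 \<le> l \<and> l \<noteq> 3" "(\<Sum>l\<leftarrow>ls. l div 2) \<le> marks M xs"
  shows "packs (set xs \<union> r ` (M \<inter> set xs)) ls"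
  using assms(1,2,5,8,9)
proof (induction ls arbitrary: xs)
  case (Cons l ls)
  let ?U = "set xs \<union> r ` (M \<inter> set xs)"
  have l: "2 \<le> l" "l \<noteq> 3" using Cons.prems by auto
  have m: "l div 2 + (\<Sum>l\<leftarrow>ls. l div 2) \<le> marks M xs" using Cons.prems by simp
  have ne: "xs \<noteq> []" using m l by (auto simp: marks_def)
  define ys where "ys = (if hd xs \<in> M then r (hd xs) # xs else xs)"
  have ys: "path V ys" "nonconsec M ys" "ys \<noteq> []" "hd ys \<notin> M" "marks M ys = marks M xs" "set ys \<subseteq> ?U"
    "last ys = last xs"
    using Cons.prems ne assms(4,6,7)
    by (auto simp: ys_def path_Cons nonconsec_def successively_Cons marks_def)
  show ?case
  proof (cases "ls = []")
    case True
    have "\<exists>zs. path V zs \<and> set zs \<subseteq> ?U \<and> l \<le> length zs"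
    \<comment> \<open>The last length may use the whole path, and a marked last vertex is also
      followed by its private neighbour. On a path with a single marked vertex this neighbour
      already stands in front.\<close>
    proof (cases "last xs \<in> M \<and> \<not> (hd xs \<in> M \<and> length xs = 1)")
      case lastM: True
      define zs where "zs = ys @ [r (last xs)]"
      have "hd xs \<noteq> last xs" if "hd xs \<in> M"
      proof -
        have "length xs \<ge> 2" using lastM that ne by (metis One_nat_def Suc_leI le_SucE length_greater_0_conv numeral_2_eq_2 not_less_eq_eq)
        then obtain x y zs where "xs = x # y # zs" by (metis Suc_le_length_iff numeral_2_eq_2)
        then show ?thesis using path_distinct[OF Cons.prems(1)] last_in_set[of "y # zs"] by auto
      qed
      then have "r (last xs) \<notin> set ys"
        using Cons.prems(3) lastM inj_onD[OF assms(3), of "last xs" "hd xs"] ne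
        by (cases "hd xs \<in> M") (auto simp: ys_def)
      then have "path V zs"
        unfolding zs_def path_append using ys lastM assms(4,7) ne by (auto simp: adj_sym)
      moreover have "nonconsec M zs" "hd zs \<notin> M" "last zs \<notin> M" "zs \<noteq> []" "marks M zs = marks M xs"
        using ys lastM assms(6) by (auto simp: zs_def nonconsec_def successively_append_iff marks_def)
      \<comment> \<open>Both ends are unmarked, so there are at least
        \<open>2 * (l div 2) + 1 \<ge> l\<close> vertices, whatever the parity of
        \<open>l\<close>.\<close>
      moreover have "2 * marks M zs + 1 \<le> length zs" using calculation by (intro marks_lt_half) auto
      moreover have "set zs \<subseteq> ?U" using ys(6) lastM ne by (auto simp: zs_def)
      ultimately show ?thesis using m True by (intro exI[of _ zs]) auto
    next
      case False
      show ?thesis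
      proof (cases "last xs \<in> M")
        case True
        then have h: "hd xs \<in> M" "length xs = 1" using False by auto
        then have "marks M xs \<le> 1" unfolding marks_def by (metis length_filter_le)
        then have "l div 2 \<le> 1" using m by linarith
        \<comment> \<open>The length 3 must be excluded here: one marked vertex with one private
          neighbour carries only two vertices.\<close>
        then have "l = 2" using l by presburger
        moreover have "length ys = 2" using h by (simp add: ys_def)
        ultimately show ?thesis using ys by (intro exI[of _ ys]) auto
      next
        case False
        then have "2 * marks M ys + 1 \<le> length ys" using ys by (intro marks_lt_half) auto
        then show ?thesis using ys m by (intro exI[of _ ys]) auto
      qed
    qed
    then obtain zs where zs: "path V zs" "set zs \<subseteq> ?U" "l \<le> length zs" by blast
    then have "packs (set zs) [l]" by (intro packs_path) auto
    then show ?thesis using True zs(2) packs_mono by blast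
  next
    case False
    then obtain l' ls' where ls: "ls = l' # ls'" by (meson neq_Nil_conv)
    then have "(\<Sum>l\<leftarrow>ls. l div 2) \<ge> 1" using Cons.prems(4) by auto
    \<comment> \<open>At least one mark is reserved for a later length, so \<open>ys\<close> has at
      least \<open>2 * (l div 2) + 2\<close> vertices, which exceeds \<open>l\<close>.\<close>
    then have "marks M xs \<ge> Suc (l div 2)" using m by linarith
    moreover have "marks M ys \<le> length ys div 2" using ys by (intro marks_le_half) auto
    ultimately have len: "l < length ys" using ys(5) by linarith
    define rest where "rest = drop l ys"
    have d: "distinct ys" using ys(1) path_distinct by blast
    have disj: "set (take l ys) \<inter> set rest = {}"
      using d by (metis append_take_drop_id distinct_append rest_def)
    have restxs: "set rest \<subseteq> set xs"
    proof (cases "hd xs \<in> M")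
      case True
      then have "rest = drop (l - 1) xs" using l by (cases l) (auto simp: rest_def ys_def)
      then show ?thesis by (simp add: set_drop_subset)
    qed (simp add: rest_def ys_def set_drop_subset)
    have "marks M (take l ys) \<le> length (take l ys) div 2"
      using ys l by (intro marks_le_half) (auto simp: nonconsec_take)
    moreover have "marks M ys = marks M (take l ys) + marks M rest"
      by (metis append_take_drop_id marks_append rest_def)
    ultimately have "(\<Sum>l\<leftarrow>ls. l div 2) \<le> marks M rest" using m ys(5) len by simp
    then have p1: "packs (set rest \<union> r ` (M \<inter> set rest)) ls"
      using Cons.prems ys restxs by (intro Cons.IH) (auto simp: rest_def path_drop nonconsec_drop)
    have p2: "packs (set (take l ys)) [l]"
      using packs_path[OF path_take[OF ys(1), of l], of "[l]"] len by simp
    \<comment> \<open>The piece can contain only one private neighbour, that of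
      \<open>hd xs\<close>; since \<open>2 \<le> l\<close> it then contains \<open>hd xs\<close>
      itself, which is therefore no mark of \<open>rest\<close>.\<close>
    have "set (take l ys) \<inter> r ` (M \<inter> set rest) = {}"
    proof (rule ccontr)
      assume "set (take l ys) \<inter> r ` (M \<inter> set rest) \<noteq> {}"
      then obtain x where x: "x \<in> M" "x \<in> set rest" "r x \<in> set (take l ys)" by blast
      then have "r x \<in> set ys" by (meson in_set_takeD)
      moreover have "r x \<notin> set xs" using Cons.prems(3) x by auto
      ultimately have h: "hd xs \<in> M" "r x = r (hd xs)" by (auto simp: ys_def split: if_splits)
      then have "x = hd xs" using assms(3) x by (auto simp: inj_on_def)
      moreover have "hd xs \<in> set (take l ys)"
      proof -
        obtain l'' where "l = Suc (Suc l'')" using l by (metis Suc_le_D numeral_2_eq_2 Suc_le_mono)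
        then show ?thesis using h ne by (cases xs) (auto simp: ys_def)
      qed
      ultimately show False using disj x by auto
    qed
    then have "packs ?U ([l] @ ls)"
      using disj restxs ys(6) by (intro packs_append[OF p2 p1]) (auto dest: in_set_takeD)
    then show ?thesis by simp
  qed
qed simp

end

section \<open>Vertices off a longest path without neighbours off the path\<close>

context loopless
begin

text \<open>\<open>R\<close> consists of vertices off the longest path \<open>xs\<close> whose neighbours all lie in the set \<open>X\<close> of
  path vertices, and \<open>X\<close> can be matched into \<open>R\<close> avoiding any prescribed vertex.\<close>

definition singles :: "'a set \<Rightarrow> 'a list \<Rightarrow> 'a set \<Rightarrow> 'a set \<Rightarrow> nat \<Rightarrow> nat list \<Rightarrow> bool" where
  "singles V xs X R d ls \<longleftrightarrow>
     longest V xs \<and> X \<subseteq> set xs \<and> R \<subseteq> V - set xs \<and> (\<forall>w\<in>R. nb V w \<subseteq> X \<and> d \<le> card (nb V w)) \<and>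
     (\<forall>w. \<exists>r. inj_on r X \<and> (\<forall>x\<in>X. r x \<in> R - {w} \<and> adj (r x) x)) \<and>
     \<not> packs V ls \<and> (\<forall>l\<in>set ls. 2 \<le> l \<and> l \<noteq> 3) \<and> 2 \<le> length ls \<and> (\<Sum>l\<leftarrow>ls. l div 2) = Suc d"

lemma singles_rev: "singles V xs X R d ls \<Longrightarrow> singles V (rev xs) X R d ls"
  by (simp add: singles_def longest_rev)

lemma singles_matching:
  assumes "singles V xs X R d ls"
  shows "\<exists>r. inj_on r X \<and> (\<forall>x\<in>X. r x \<in> R - {w} \<and> adj (r x) x)"
  using assms unfolding singles_def by (elim conjE) (erule spec)

lemma singles_marks:
  assumes "singles V xs X R d ls" "path V zs" "M \<subseteq> X" "M \<subseteq> set zs" "nonconsec M zs"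
    and "set zs \<subseteq> insert w (set xs)" "d < card M"
  shows False
proof -
  obtain r where r: "inj_on r X" "\<forall>x\<in>X. r x \<in> R - {w} \<and> adj (r x) x"
    using singles_matching[OF assms(1), of w] by blast
  have R: "R \<subseteq> V - set xs" "X \<subseteq> set xs" using assms(1) by (auto simp: singles_def)
  have rM: "r ` M \<subseteq> R - {w}" using r(2) assms(3) by auto
  have "packs (set zs \<union> r ` (M \<inter> set zs)) ls"
  proof (rule packs_marks[OF assms(2,5)])
    show "inj_on r M" using r(1) assms(3) inj_on_subset by blast
    show "r ` M \<subseteq> V" "r ` M \<inter> M = {}" using rM R assms(3) by auto
    show "r ` M \<inter> set zs = {}" using rM R(1) assms(6) by auto
    show "\<forall>x\<in>M. adj (r x) x" using r(2) assms(3) by auto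
    show "\<forall>l\<in>set ls. 2 \<le> l \<and> l \<noteq> 3" using assms(1) by (simp add: singles_def)
    have "marks M zs = card M" using assms(2,4) path_distinct marks_eq_card by blast
    then show "(\<Sum>l\<leftarrow>ls. l div 2) \<le> marks M zs" using assms(1,7) by (simp add: singles_def)
  qed
  moreover have "set zs \<union> r ` (M \<inter> set zs) \<subseteq> V" using path_set[OF assms(2)] rM R(1) by auto
  ultimately have "packs V ls" by (rule packs_mono)
  then show False using assms(1) by (simp add: singles_def)
qed

section \<open>Rerouting a longest path through vertices off it\<close>

lemma longest_insert:
  assumes "longest V xs" "Suc i < length xs" "w \<in> V - set xs" "adj (xs ! i) w" "adj w (xs ! Suc i)"
  shows False
proof -
  have p: "path V xs" using assms(1) by (simp add: longest_def)
  have "last (take (Suc i) xs) = xs ! i" using assms(2) by (simp add: take_Suc_conv_app_nth)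
  moreover have "hd (drop (Suc i) xs) = xs ! Suc i" using assms(2) by (simp add: hd_drop_conv_nth)
  moreover have "set (take (Suc i) xs) \<inter> set (drop (Suc i) xs) = {}"
    using path_distinct[OF p] by (metis append_take_drop_id distinct_append)
  ultimately have "path V (take (Suc i) xs @ w # drop (Suc i) xs)"
    using assms p path_take path_drop by (auto simp: path_append path_Cons dest: in_set_takeD in_set_dropD)
  then have "length (take (Suc i) xs @ w # drop (Suc i) xs) \<le> length xs"
    using assms(1) unfolding longest_def by blast
  then show False using assms(2) by simp
qed

lemma nonconsec_nb:
  assumes "longest V xs" "w \<in> V - set xs"
  shows "nonconsec (nb V w) xs"
  unfolding nonconsec_nth
proof (intro allI impI)
  fix i assume i: "Suc i < length xs"
  show "\<not> (xs ! i \<in> nb V w \<and> xs ! Suc i \<in> nb V w)"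
    using longest_insert[OF assms(1) i assms(2)] adj_sym[of w] by (auto simp: nb_iff)
qed

lemma singles_nb_nonconsec: "singles V xs X R d ls \<Longrightarrow> w \<in> R \<Longrightarrow> nonconsec (nb V w) xs"
  by (rule nonconsec_nb) (auto simp: singles_def)

text \<open>The neighbours of \<open>w\<close> are not consecutive on the longest path, so more than
  \<open>d\<close> of them would be enough marks on \<open>xs\<close> itself.\<close>

lemma singles_card:
  assumes "singles V xs X R d ls" "w \<in> R"
  shows "card (nb V w) = d"
proof (rule ccontr)
  assume "card (nb V w) \<noteq> d"
  moreover have "d \<le> card (nb V w)" "nb V w \<subseteq> X" "X \<subseteq> set xs" "path V xs"
    using assms by (auto simp: singles_def longest_def)
  ultimately show False
    using singles_marks[OF assms(1), of xs "nb V w" w] singles_nb_nonconsec[OF assms] by auto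
qed

text \<open>With \<open>f\<close> and \<open>g\<close> the first and last position of a neighbour of
  \<open>w\<close>, the path x_{i+1}, ..., x_g, w, x_f, ..., x_i tears the edge between x_i and
  x_{i+1} apart. Both can then be marked, which gives \<open>d + 1\<close> marks. The position
  \<open>b\<close> ensures that there is something to reach behind x_{i+1}.\<close>

lemma singles_skip:
  assumes "singles V xs X R d ls" "w \<in> R" "Suc i < length xs"
    and "xs ! i \<in> nb V w" "xs ! Suc i \<in> X" "xs ! Suc i \<notin> nb V w"
    and "Suc (Suc i) < length xs \<Longrightarrow> xs ! Suc (Suc i) \<notin> nb V w"
    and "Suc i < b" "b < length xs" "xs ! b \<in> nb V w"
  shows False
proof -
  let ?S = "nb V w"
  define I where "I = {j. j < length xs \<and> xs ! j \<in> ?S}"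
  have finI: "finite I" by (auto simp: I_def)
  have IS: "i \<in> I" "b \<in> I" using assms by (auto simp: I_def)
  define f where "f = Min I"
  define g where "g = Max I"
  have f: "f \<in> I" "f \<le> i" and g: "g \<in> I" "b \<le> g"
    using finI IS by (auto simp: f_def g_def intro: Min_in Max_in)
  have between: "f \<le> j \<and> j \<le> g" if "j \<in> I" for j using finI that by (auto simp: f_def g_def)
  have glen: "g < length xs" using g by (simp add: I_def)
  have lp: "longest V xs" and Xx: "X \<subseteq> set xs" and SX: "?S \<subseteq> X" and wV: "w \<in> V - set xs"
    using assms(1,2) by (auto simp: singles_def)
  have p: "path V xs" using lp by (simp add: longest_def)
  have dist: "distinct xs" using p path_distinct by blast
  define us where "us = drop (Suc i) (take (Suc g) xs)"
  define vs where "vs = drop f (take (Suc i) xs)"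
  have us_len: "length us = g - i" and vs_len: "length vs = Suc i - f"
    using glen assms(3) by (auto simp: us_def vs_def min_def)
  have us_nth: "us ! k = xs ! (Suc i + k)" if "k < g - i" for k
    using that glen by (simp add: us_def)
  have vs_nth: "vs ! k = xs ! (f + k)" if "k < Suc i - f" for k
    using that assms(3) by (simp add: vs_def)
  have ne: "us \<noteq> []" "vs \<noteq> []" using us_len vs_len g f assms(8) by auto
  have hd_us: "hd us = xs ! Suc i" using us_nth[of 0] us_len ne g assms(8) by (simp add: hd_conv_nth)
  have last_us: "last us = xs ! g"
    using us_nth[of "g - i - 1"] us_len ne g assms(8) by (simp add: last_conv_nth)
  have hd_vs: "hd vs = xs ! f" using vs_nth[of 0] vs_len ne f by (simp add: hd_conv_nth)
  have last_vs: "last vs = xs ! i" using vs_nth[of "i - f"] vs_len ne f by (simp add: last_conv_nth)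
  have set_us: "set us \<subseteq> set (drop (Suc i) xs)"
    unfolding us_def drop_take by (rule set_take_subset)
  have set_vs: "set vs \<subseteq> set (take (Suc i) xs)" unfolding vs_def by (rule set_drop_subset)
  have td: "set (take (Suc i) xs) \<inter> set (drop (Suc i) xs) = {}"
    using dist by (metis append_take_drop_id distinct_append)
  have sub: "set us \<subseteq> set xs" "set vs \<subseteq> set xs"
    using set_us set_vs set_take_subset set_drop_subset by fastforce+
  let ?zs = "us @ w # vs"
  have "path V us" "path V vs" using p path_take path_drop by (auto simp: us_def vs_def)
  moreover have "adj (xs ! g) w" "adj w (xs ! f)"
    using f g adj_sym[of w] by (auto simp: I_def nb_iff)
  ultimately have pz: "path V ?zs"
    using wV td set_us set_vs sub ne last_us hd_vs by (auto simp: path_append path_Cons)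
  let ?M = "insert (xs ! Suc i) ?S"
  have Mset: "?M \<subseteq> set ?zs"
  proof
    fix y assume y: "y \<in> ?M"
    show "y \<in> set ?zs"
    proof (cases "y = xs ! Suc i")
      case True
      then show ?thesis using hd_us ne hd_in_set by fastforce
    next
      case False
      then have "y \<in> set xs" using y SX Xx by auto
      then obtain j where j: "j < length xs" "y = xs ! j" by (metis in_set_conv_nth)
      then have jI: "j \<in> I" using y False by (auto simp: I_def)
      show ?thesis
      proof (cases "j \<le> i")
        case True
        have fj: "f \<le> j" using between jI by blast
        then have "vs ! (j - f) = y" using vs_nth[of "j - f"] True j by simp
        moreover have "j - f < length vs" using fj True vs_len by simp
        ultimately show ?thesis using nth_mem by fastforce
      next
        case False
        have jg: "j \<le> g" using between jI by blast
        then have "us ! (j - Suc i) = y" using us_nth[of "j - Suc i"] False j by simp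
        moreover have "j - Suc i < length us" using jg False us_len by simp
        ultimately show ?thesis using nth_mem by fastforce
      qed
    qed
  qed
  have nS: "\<not> (xs ! j \<in> ?S \<and> xs ! Suc j \<in> ?S)" if "Suc j < length xs" for j
    using singles_nb_nonconsec[OF assms(1,2)] that by (simp add: nonconsec_nth)
  have inj: "xs ! j = xs ! Suc i \<longleftrightarrow> j = Suc i" if "j < length xs" for j
    using that assms(3) dist by (simp add: nth_eq_iff_index_eq)
  have "nonconsec ?M us"
    unfolding nonconsec_nth
  proof (intro allI impI)
    fix k assume k: "Suc k < length us"
    then have e: "us ! k = xs ! (Suc i + k)" "us ! Suc k = xs ! Suc (Suc i + k)"
      using us_nth us_len by auto
    have l: "Suc (Suc i + k) < length xs" using k us_len glen by simp
    show "\<not> (us ! k \<in> ?M \<and> us ! Suc k \<in> ?M)"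
    proof (cases k)
      case 0
      then show ?thesis using e l assms(7) inj[of "Suc (Suc i)"] by auto
    next
      case (Suc k')
      then show ?thesis using e l nS[of "Suc i + k"] inj[of "Suc i + k"] inj[of "Suc (Suc i + k)"] by auto
    qed
  qed
  moreover have "nonconsec ?M vs"
    unfolding nonconsec_nth
  proof (intro allI impI)
    fix k assume k: "Suc k < length vs"
    then have e: "vs ! k = xs ! (f + k)" "vs ! Suc k = xs ! Suc (f + k)"
      using vs_nth vs_len by auto
    have l: "Suc (f + k) < length xs" "f + k < i" using k vs_len assms(3) by auto
    show "\<not> (vs ! k \<in> ?M \<and> vs ! Suc k \<in> ?M)"
      using e l nS[of "f + k"] inj[of "f + k"] inj[of "Suc (f + k)"] by auto
  qed
  moreover have "w \<notin> ?M" using wV SX Xx assms(3) nth_mem by fastforce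
  ultimately have nc: "nonconsec ?M ?zs"
    unfolding nonconsec_def by (auto simp: successively_append_iff successively_Cons)
  have "finite ?S" using SX Xx by (meson finite_set finite_subset)
  then have "card ?M = Suc d" using singles_card[OF assms(1,2)] assms(6) by simp
  then show False
    using singles_marks[OF assms(1) pz _ Mset nc, of w] SX assms(5) sub by auto
qed

lemma singles_skip_left:
  assumes "singles V xs X R d ls" "w \<in> R" "Suc i < length xs"
    and "xs ! Suc i \<in> nb V w" "xs ! i \<in> X" "xs ! i \<notin> nb V w"
    and "i > 0 \<Longrightarrow> xs ! (i - 1) \<notin> nb V w"
    and "b < i" "xs ! b \<in> nb V w"
  shows False
proof -
  let ?n = "length xs"
  let ?i = "?n - Suc (Suc i)"
  have e: "rev xs ! ?i = xs ! Suc i" "rev xs ! Suc ?i = xs ! i" "rev xs ! (?n - Suc b) = xs ! b"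
    using assms(3,8) by (auto simp: rev_nth Suc_diff_Suc)
  show False
  proof (rule singles_skip[OF singles_rev[OF assms(1)] assms(2), of ?i "?n - Suc b"])
    show "Suc ?i < length (rev xs)" using assms(3) by simp
    show "rev xs ! ?i \<in> nb V w" "rev xs ! Suc ?i \<in> X" "rev xs ! Suc ?i \<notin> nb V w"
      "rev xs ! (?n - Suc b) \<in> nb V w" using e assms by auto
    show "rev xs ! Suc (Suc ?i) \<notin> nb V w" if "Suc (Suc ?i) < length (rev xs)"
    proof -
      have "i > 0" using that assms(3) by simp
      moreover have "rev xs ! Suc (Suc ?i) = xs ! (i - 1)"
      proof -
        have "length xs - Suc (Suc (Suc ?i)) = i - 1" using assms(3) \<open>i > 0\<close> by simp
        then show ?thesis using that by (simp add: rev_nth)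
      qed
      ultimately show ?thesis using assms(7) by simp
    qed
    show "Suc ?i < ?n - Suc b" "?n - Suc b < length (rev xs)" using assms(3,8) by auto
  qed
qed

text \<open>The stretch x_i, u, x_{i+2}, x_{i+1}, w, x_{i+3} would lengthen the path by two.\<close>

lemma longest_double_insert:
  assumes "longest V xs" "u \<in> V - set xs" "w \<in> V - set xs" "u \<noteq> w" "i + 3 < length xs"
    and "adj (xs ! i) u" "adj u (xs ! (i + 2))" "adj (xs ! (i + 1)) w" "adj w (xs ! (i + 3))"
  shows False
proof -
  have p: "path V xs" and dist: "distinct xs"
    using assms(1) path_distinct by (auto simp: longest_def)
  let ?a = "take (Suc i) xs" and ?c = "drop (i + 3) xs"
  let ?zs = "?a @ [u, xs ! (i + 2), xs ! (i + 1), w] @ ?c"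
  have split: "xs = ?a @ xs ! (i + 1) # xs ! (i + 2) # ?c"
    using assms(5) by (simp add: Cons_nth_drop_Suc numeral_3_eq_3)
  have "distinct (?a @ xs ! (i + 1) # xs ! (i + 2) # ?c)" using dist split by simp
  then have d: "set ?a \<inter> set ?c = {}" "xs ! (i + 1) \<notin> set ?a" "xs ! (i + 2) \<notin> set ?a"
    "xs ! (i + 1) \<notin> set ?c" "xs ! (i + 2) \<notin> set ?c" "xs ! (i + 1) \<noteq> xs ! (i + 2)" by auto
  have "last ?a = xs ! i" using assms(5) by (simp add: take_Suc_conv_app_nth)
  moreover have "hd ?c = xs ! (i + 3)" using assms(5) by (simp add: hd_drop_conv_nth)
  moreover have "adj (xs ! (i + 2)) (xs ! (i + 1))"
    using path_nth_adj[OF p, of "i + 1"] assms(5) adj_sym by simp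
  moreover have "xs ! (i + 1) \<in> set xs" "xs ! (i + 2) \<in> set xs" using assms(5) by auto
  moreover have "set ?a \<subseteq> set xs" "set ?c \<subseteq> set xs" by (auto dest: in_set_takeD in_set_dropD)
  ultimately have "path V ?zs"
    using assms p d path_take path_drop path_set[OF p] by (auto simp: path_append path_Cons)
  then have "length ?zs \<le> length xs" using assms(1) unfolding longest_def by blast
  then show False using assms(5) by simp
qed

lemma singles_partner:
  assumes "singles V xs X R d ls" "x \<in> X"
  obtains w' where "w' \<in> R" "w' \<noteq> w" "x \<in> nb V w'"
proof -
  obtain r where "\<forall>x\<in>X. r x \<in> R - {w} \<and> adj (r x) x"
    using singles_matching[OF assms(1), of w] by blast
  moreover have "x \<in> V" using assms by (auto simp: singles_def longest_def path_def)
  ultimately show thesis using that[of "r x"] assms(2) adj_sym by (auto simp: nb_iff)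
qed

text \<open>A partner \<open>w'\<close> of the middle vertex is not adjacent to x_i or x_{i+2},
  since \<open>xs\<close> is longest, nor to x_{i-1} or x_{i+3}, by the double insertion. As
  \<open>w\<close> has two neighbours, so does \<open>w'\<close>; its second neighbour lies farther
  away, and \<open>singles_skip\<close> or its mirror image applies to \<open>w'\<close>.\<close>

lemma singles_gap_one:
  assumes S: "singles V xs X R d ls" and "w \<in> R" "i + 2 < length xs"
    and "xs ! i \<in> nb V w" "xs ! (i + 1) \<in> X" "xs ! (i + 2) \<in> nb V w"
  shows False
proof -
  obtain w' where w': "w' \<in> R" "w' \<noteq> w" "xs ! (i + 1) \<in> nb V w'"
    using singles_partner S assms(5) by metis
  have lp: "longest V xs" and RV: "w \<in> V - set xs" "w' \<in> V - set xs" and SX: "nb V w \<subseteq> X"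
    using S assms(2) w' by (auto simp: singles_def)
  have dist: "distinct xs" using lp path_distinct by (auto simp: longest_def)
  note nc' = singles_nb_nonconsec[OF S w'(1), unfolded nonconsec_nth, rule_format]
  have n1: "xs ! i \<notin> nb V w'" using nc'[of i] w' assms(3) by simp
  have n2: "xs ! (i + 2) \<notin> nb V w'" using nc'[of "i + 1"] w' assms(3) by simp
  have n3: "xs ! (i - 1) \<notin> nb V w'" if "i > 0"
  proof
    assume "xs ! (i - 1) \<in> nb V w'"
    then show False
      using longest_double_insert[OF lp RV(2) RV(1) w'(2), of "i - 1"] that assms w'(3) adj_sym
      by (auto simp: nb_iff)
  qed
  have n4: "xs ! (i + 3) \<notin> nb V w'" if "i + 3 < length xs"
  proof
    assume "xs ! (i + 3) \<in> nb V w'"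
    then show False
      using longest_double_insert[OF lp RV(1) RV(2) w'(2)[symmetric] that] assms w'(3) adj_sym
      by (auto simp: nb_iff)
  qed
  have fin: "finite (nb V w)" using SX S by (meson finite_set finite_subset singles_def)
  have "xs ! i \<noteq> xs ! (i + 2)" using dist assms(3) by (simp add: nth_eq_iff_index_eq)
  then have "2 \<le> card (nb V w)"
    using assms(4,6) fin by (metis (no_types, lifting) card_2_iff card_mono empty_subsetI insert_subset)
  then have "2 \<le> card (nb V w')" using singles_card[OF S] assms(2) w'(1) by simp
  then have "\<not> nb V w' \<subseteq> {xs ! (i + 1)}"
    by (metis One_nat_def card.empty card_1_singleton_iff not_less_eq_eq numeral_2_eq_2 subset_singletonD zero_le order_refl le_numeral_extra(4) Suc_n_not_le_n not_numeral_le_zero)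
  then obtain y where y: "y \<in> nb V w'" "y \<noteq> xs ! (i + 1)" by blast
  then have "y \<in> set xs" using S w'(1) by (auto simp: singles_def)
  then obtain b where b: "b < length xs" "y = xs ! b" by (metis in_set_conv_nth)
  then have "b \<noteq> i" "b \<noteq> i + 1" "b \<noteq> i + 2" using y n1 n2 by auto
  then consider "b < i" | "i + 2 < b" by linarith
  then show False
  proof cases
    case 1
    show False
      using singles_skip_left[OF S w'(1), of i b] w' n1 n3 1 b y assms SX by auto
  next
    case 2
    show False
      using singles_skip[OF S w'(1), of "i + 1" b] w' n2 n4 2 b y assms SX
      by (auto simp: numeral_3_eq_3)
  qed
qed

text \<open>For \<open>d = 1\<close> the lengths have two halves in total, and without 3 this leaves
  only F = 2P_2.\<close>

lemma singles_two_edges: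
  assumes S: "singles V xs X R 1 ls" and "adj a w" "adj x w'" "distinct [a, w, x, w']" "{a, w, x, w'} \<subseteq> V"
  shows False
proof -
  have ls: "\<forall>l\<in>set ls. 2 \<le> l \<and> l \<noteq> 3" "2 \<le> length ls" "(\<Sum>l\<leftarrow>ls. l div 2) = 2"
    using S by (auto simp: singles_def)
  obtain l1 l2 ls' where e: "ls = l1 # l2 # ls'" using ls(2) by (metis Suc_le_length_iff numeral_2_eq_2)
  have d: "l1 div 2 \<ge> 1" "l2 div 2 \<ge> 1" using ls(1) e by auto
  have "ls' = []"
  proof (rule ccontr)
    assume "ls' \<noteq> []"
    then obtain l3 ls'' where "ls' = l3 # ls''" by (meson neq_Nil_conv)
    then have "l3 div 2 \<ge> 1" "l1 div 2 + l2 div 2 + l3 div 2 \<le> 2" using ls e by auto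
    then show False using d by linarith
  qed
  then have "l1 div 2 = 1" "l2 div 2 = 1" using ls(3) e d by auto
  moreover have "l1 \<noteq> 3" "l2 \<noteq> 3" using ls(1) e by auto
  ultimately have "l1 = 2" "l2 = 2" by presburger+
  then have "ls = [2, 2]" using e \<open>ls' = []\<close> by simp
  moreover have "packs V [2, 2]"
    unfolding packs_def using assms by (intro exI[of _ "[[a, w], [x, w']]"]) (auto simp: path_Cons)
  ultimately show False using S by (simp add: singles_def)
qed

text \<open>By the previous lemmas x_i would be the last neighbour of \<open>w\<close>, and x_{i+1}
  the first neighbour of a partner \<open>w'\<close>. The two neighbourhoods then lie one behind the
  other on \<open>xs\<close> and together give too many marks, except for \<open>d = 1\<close>,
  where two disjoint edges already form F.\<close>

lemma singles_no_right:
  assumes S: "singles V xs X R d ls" and "w \<in> R" "Suc i < length xs"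
    and "xs ! i \<in> nb V w" "xs ! Suc i \<in> X" "xs ! Suc i \<notin> nb V w"
  shows False
proof (cases "Suc (Suc i) < length xs \<and> xs ! Suc (Suc i) \<in> nb V w")
  case True
  then show ?thesis using singles_gap_one[OF S assms(2), of i] assms by auto
next
  case nn: False
  have lp: "longest V xs" and RV: "w \<in> V - set xs" and SX: "nb V w \<subseteq> X" "X \<subseteq> set xs"
    using S assms(2) by (auto simp: singles_def)
  have p: "path V xs" and dist: "distinct xs" using lp path_distinct by (auto simp: longest_def)
  have nolater: "b \<le> i" if "b < length xs" "xs ! b \<in> nb V w" for b
  proof (rule ccontr)
    assume "\<not> b \<le> i"
    moreover have "b \<noteq> Suc i" using that assms(6) by auto
    ultimately show False using singles_skip[OF S assms(2-6), of b] nn that by auto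
  qed
  obtain w' where w': "w' \<in> R" "w' \<noteq> w" "xs ! Suc i \<in> nb V w'"
    using singles_partner S assms(5) by metis
  note nc' = singles_nb_nonconsec[OF S w'(1), unfolded nonconsec_nth, rule_format]
  note nc = singles_nb_nonconsec[OF S assms(2), unfolded nonconsec_nth, rule_format]
  have ai: "xs ! i \<notin> nb V w'" using nc'[of i] w' assms(3) by simp
  have fin: "finite (nb V w)" "finite (nb V w')"
    using SX S w'(1) by (meson finite_set finite_subset singles_def)+
  show False
  proof (cases "\<exists>b<i. xs ! b \<in> nb V w'")
    case True
    then obtain b where b: "b < i" "xs ! b \<in> nb V w'" by blast
    show False
    proof (cases "xs ! (i - 1) \<in> nb V w'")
      case True
      moreover have "i - 1 + 1 = i" "i - 1 + 2 = Suc i" using b by auto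
      ultimately show False
        using singles_gap_one[OF S w'(1), of "i - 1"] w' assms SX by auto
    next
      case False
      show False using singles_skip_left[OF S w'(1) assms(3) w'(3) _ ai _ b] False assms(4) SX by auto
    qed
  next
    case False
    have later: "Suc i \<le> b" if "b < length xs" "xs ! b \<in> nb V w'" for b
      using False ai that by (metis not_less_eq_eq le_neq_implies_less)
    \<comment> \<open>Without x_i no two of these vertices are consecutive; there are
      \<open>2 * d - 1\<close> of them, which exceeds \<open>d\<close> as soon as
      \<open>d > 1\<close>.\<close>
    let ?M = "(nb V w - {xs ! i}) \<union> nb V w'"
    have M1: "b < i - 1" if "b < length xs" "xs ! b \<in> nb V w" "xs ! b \<noteq> xs ! i" for b
    proof -
      have "b \<le> i" "b \<noteq> i" using nolater that by auto
      moreover have "Suc b \<noteq> i"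
      proof
        assume "Suc b = i"
        then show False using nc[of b] that assms(3,4) by auto
      qed
      ultimately show ?thesis by linarith
    qed
    have "nonconsec ?M xs"
      unfolding nonconsec_nth
    proof (intro allI impI notI)
      fix k assume k: "Suc k < length xs" and "xs ! k \<in> ?M \<and> xs ! Suc k \<in> ?M"
      then show False
        using nc[of k] nc'[of k] M1[of k] M1[of "Suc k"] later[of k] later[of "Suc k"] by auto
    qed
    moreover have "card ?M = (d - 1) + d"
    proof -
      have "(nb V w - {xs ! i}) \<inter> nb V w' = {}"
      proof (rule ccontr)
        assume "(nb V w - {xs ! i}) \<inter> nb V w' \<noteq> {}"
        then obtain y where y: "y \<in> nb V w" "y \<noteq> xs ! i" "y \<in> nb V w'" by blast
        then obtain b where "b < length xs" "y = xs ! b" using SX by (metis in_set_conv_nth subsetD)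
        then show False using M1[of b] later[of b] y by auto
      qed
      then have "card ?M = card (nb V w - {xs ! i}) + card (nb V w')"
        using fin by (intro card_Un_disjoint) auto
      then show ?thesis using singles_card[OF S] assms(2,4) w'(1) by simp
    qed
    moreover have "nb V w' \<subseteq> X" using S w'(1) by (simp add: singles_def)
    then have "?M \<subseteq> X" "?M \<subseteq> set xs" using SX by auto
    ultimately have "\<not> d < (d - 1) + d" using singles_marks[OF S p, of ?M w] by auto
    moreover have "d \<ge> 1"
    proof -
      have "nb V w \<noteq> {}" using assms(4) by auto
      then show ?thesis using singles_card[OF S assms(2)] fin by (metis One_nat_def Suc_leI card_gt_0_iff)
    qed
    ultimately have "d = 1" by linarith
    moreover have "distinct [xs ! i, w, xs ! Suc i, w']" "{xs ! i, w, xs ! Suc i, w'} \<subseteq> V"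
      using RV w' assms(3) dist S path_set[OF p] nth_mem[of i xs] nth_mem[of "Suc i" xs]
      by (auto simp: nth_eq_iff_index_eq singles_def)
    ultimately show False
      using singles_two_edges[of V xs X R ls] S assms(4) w'(3) by (auto simp: nb_iff)
  qed
qed

text \<open>Neither path neighbour of a missing vertex \<open>x\<close> is adjacent to
  \<open>w\<close>, by \<open>singles_no_right\<close> and its mirror image, so \<open>x\<close> can
  be marked along with the \<open>d\<close> neighbours of \<open>w\<close>.\<close>

lemma singles_nb_eq:
  assumes S: "singles V xs X R d ls" and "w \<in> R"
  shows "nb V w = X"
proof (rule ccontr)
  assume "nb V w \<noteq> X"
  moreover have SX: "nb V w \<subseteq> X" "X \<subseteq> set xs" and p: "path V xs"
    using S assms(2) by (auto simp: singles_def longest_def)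
  ultimately obtain x where x: "x \<in> X" "x \<notin> nb V w" by blast
  then obtain j where j: "j < length xs" "x = xs ! j" using SX by (metis in_set_conv_nth subsetD)
  have dist: "distinct xs" using p path_distinct by blast
  have left: "xs ! (j - 1) \<notin> nb V w" if "j > 0"
    using singles_no_right[OF assms, of "j - 1"] x j that by auto
  have right: "xs ! Suc j \<notin> nb V w" if "Suc j < length xs"
  proof
    assume a: "xs ! Suc j \<in> nb V w"
    let ?i = "length xs - Suc (Suc j)"
    have "rev xs ! ?i = xs ! Suc j" "rev xs ! Suc ?i = xs ! j" "Suc ?i < length (rev xs)"
      using that by (auto simp: rev_nth Suc_diff_Suc)
    then show False using singles_no_right[OF singles_rev[OF S] assms(2), of ?i] x j a by auto
  qed
  let ?M = "insert x (nb V w)"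
  note nc = singles_nb_nonconsec[OF assms, unfolded nonconsec_nth, rule_format]
  have "nonconsec ?M xs"
    unfolding nonconsec_nth
  proof (intro allI impI notI)
    fix k assume k: "Suc k < length xs" and "xs ! k \<in> ?M \<and> xs ! Suc k \<in> ?M"
    moreover have "xs ! k = x \<longleftrightarrow> k = j" "xs ! Suc k = x \<longleftrightarrow> Suc k = j"
      using k j dist by (auto simp: nth_eq_iff_index_eq)
    ultimately show False using nc[of k] left right by auto
  qed
  moreover have "card ?M = Suc d"
  proof -
    have "finite (nb V w)" using SX by (meson finite_set finite_subset)
    then show ?thesis using x singles_card[OF assms] by simp
  qed
  ultimately show False using singles_marks[OF S p, of ?M w] SX x by auto
qed

end

section \<open>Complete bipartite subgraphs\<close>

fun weave :: "'a list \<Rightarrow> 'a list \<Rightarrow> 'a list" where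
  "weave (s # ss) (r # rs) = s # r # weave ss rs"
| "weave _ _ = []"

lemma set_weave: "length ss = length rs \<Longrightarrow> set (weave ss rs) = set ss \<union> set rs"
  by (induction ss rs rule: weave.induct) auto

lemma length_weave: "length ss = length rs \<Longrightarrow> length (weave ss rs) = 2 * length ss"
  by (induction ss rs rule: weave.induct) auto

lemma hd_weave: "length ss = length rs \<Longrightarrow> ss \<noteq> [] \<Longrightarrow> hd (weave ss rs) = hd ss"
  by (induction ss rs rule: weave.induct) auto

lemma weave_snoc:
  "length ss = length rs \<Longrightarrow> weave (ss @ [s]) (rs @ [r]) = weave ss rs @ [s, r]"
  by (induction ss rs rule: weave.induct) auto

lemma marks_weave:
  "length ss = length rs \<Longrightarrow> set ss \<subseteq> M \<Longrightarrow> set rs \<inter> M = {} \<Longrightarrow> marks M (weave ss rs) = length ss"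
  by (induction ss rs rule: weave.induct) (auto simp: marks_def)

lemma nonconsec_weave:
  "length ss = length rs \<Longrightarrow> set rs \<inter> M = {} \<Longrightarrow> nonconsec M (weave ss rs)"
  by (induction ss rs rule: weave.induct) (auto simp: nonconsec_def successively_Cons)

lemma distinct_list_of_card:
  assumes "finite A" "k \<le> card A"
  obtains xs where "distinct xs" "set xs \<subseteq> A" "length xs = k"
proof -
  obtain B where "B \<subseteq> A" "card B = k" "finite B" using obtain_subset_with_card_n assms(2) by metis
  moreover obtain xs where "set xs = B" "distinct xs" using finite_distinct_list \<open>finite B\<close> by blast
  ultimately show thesis using that[of xs] distinct_card by fastforce
qed

definition admissible :: "nat list \<Rightarrow> bool" where
  "admissible ls \<longleftrightarrow> 2 \<le> length ls \<and> (\<forall>l\<in>set ls. 2 \<le> l \<and> l \<noteq> 3)"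

lemma admissible_div2_lt:
  assumes "admissible ls" "l \<in> set ls"
  shows "l div 2 < (\<Sum>l\<leftarrow>ls. l div 2)"
proof -
  obtain us vs where e: "ls = us @ l # vs" using assms(2) by (meson split_list)
  then have "us @ vs \<noteq> []" using assms(1) by (auto simp: admissible_def)
  then obtain x where x: "x \<in> set (us @ vs)" by (meson last_in_set)
  then have "x div 2 \<le> (\<Sum>l\<leftarrow>us @ vs. l div 2)" by (intro member_le_sum_list) auto
  moreover have "2 \<le> x" using x e assms(1) by (auto simp: admissible_def)
  then have "1 \<le> x div 2" by linarith
  moreover have "(\<Sum>l\<leftarrow>ls. l div 2) = l div 2 + (\<Sum>l\<leftarrow>us @ vs. l div 2)" using e by simp
  ultimately show ?thesis by linarith
qed

context loopless
begin

lemma path_weave: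
  assumes "length ss = length rs" "distinct ss" "distinct rs" "set ss \<subseteq> S" "set rs \<subseteq> R"
    and "S \<subseteq> V" "R \<subseteq> V" "S \<inter> R = {}" "\<And>s r. s \<in> S \<Longrightarrow> r \<in> R \<Longrightarrow> adj s r"
  shows "path V (weave ss rs)"
  using assms(1-5)
proof (induction ss rs rule: weave.induct)
  case (1 s ss r rs)
  have p: "path V (weave ss rs)" using 1 by auto
  have h: "adj r (hd (weave ss rs))" if "weave ss rs \<noteq> []"
  proof -
    have "ss \<noteq> []" using that by (cases ss) auto
    then have "hd (weave ss rs) \<in> S" using 1 by (simp add: hd_weave subset_iff)
    then show ?thesis using assms(9) 1 adj_sym by auto
  qed
  have "set (weave ss rs) = set ss \<union> set rs" using 1 by (simp add: set_weave)
  then have "s \<notin> set (weave ss rs)" "r \<notin> set (weave ss rs)" "s \<noteq> r" using 1 assms(8) by auto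
  then show ?case using p h 1 assms by (auto simp: path_Cons)
qed auto

text \<open>\<open>S\<close> is the dominating set to be compared with the clique of G_F. The size
  \<open>3 * d\<close> of \<open>R\<close> provides \<open>d\<close> vertices for an irregular first
  path, \<open>d\<close> for a path alternating with \<open>S\<close>, and \<open>d\<close> private
  neighbours.\<close>

definition bip :: "'a set \<Rightarrow> 'a set \<Rightarrow> 'a set \<Rightarrow> nat \<Rightarrow> nat list \<Rightarrow> bool" where
  "bip V S R d ls \<longleftrightarrow> finite V \<and> S \<subseteq> V \<and> card S = d \<and> R \<subseteq> V \<and> (\<forall>r\<in>R. nb V r = S) \<and> 3 * d \<le> card R \<and>
     \<not> packs V ls \<and> admissible ls \<and> (\<Sum>l\<leftarrow>ls. l div 2) = Suc d \<and> conn V \<and> (\<forall>v\<in>V. d \<le> card (nb V v))"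

lemma bip_facts:
  assumes "bip V S R d ls"
  shows "finite S" "finite R" "S \<inter> R = {}" "\<And>s r. s \<in> S \<Longrightarrow> r \<in> R \<Longrightarrow> adj s r" "d \<ge> 1" "S \<noteq> {}"
proof -
  have V: "finite V" "S \<subseteq> V" "R \<subseteq> V" "\<forall>r\<in>R. nb V r = S" "card S = d" using assms by (auto simp: bip_def)
  show f: "finite S" "finite R" using V finite_subset by auto
  show "S \<inter> R = {}" using V(4) by (auto simp: nb_iff)
  show "adj s r" if "s \<in> S" "r \<in> R" for s r using V(4) that by (auto simp: nb_iff)
  obtain l where l: "l \<in> set ls" using assms by (cases ls) (auto simp: bip_def admissible_def)
  then have "1 \<le> l div 2" using assms by (auto simp: bip_def admissible_def)
  then show "d \<ge> 1" using admissible_div2_lt[of ls l] l assms by (auto simp: bip_def)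
  then show "S \<noteq> {}" using V(5) by auto
qed

text \<open>A first path that saves one vertex of \<open>S\<close> leaves enough of \<open>S\<close> for all the others.\<close>

lemma bip_saving_path:
  assumes b: "bip V S R d ls" and fs: "path V fs" "length fs \<in> set ls"
    and save: "card (S \<inter> set fs) < length fs div 2" and R: "card (R \<inter> set fs) \<le> d"
  shows False
proof -
  note F = bip_facts[OF b]
  let ?l = "length fs"
  have V: "finite V" "S \<subseteq> V" "R \<subseteq> V" "card S = d" "3 * d \<le> card R" using b by (auto simp: bip_def)
  obtain ss where ss: "set ss = S - set fs" "distinct ss" using F(1) finite_distinct_list by (metis finite_Diff)
  have lss: "length ss = d - card (S \<inter> set fs)"
    using ss V(4) F(1) by (metis card_Diff_subset_Int distinct_card finite_Int)
  have "card (R - set fs) = card R - card (R \<inter> set fs)" by (simp add: F(2) card_Diff_subset_Int)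
  then have cR: "2 * d \<le> card (R - set fs)" using R V(5) by linarith
  obtain rs where rs: "distinct rs" "set rs \<subseteq> R - set fs" "length rs = length ss"
    using distinct_list_of_card[of "R - set fs" "length ss"] F(2) cR lss
    by (metis diff_le_self finite_Diff le_add1 le_trans mult_2)
  have "card (R - set fs - set rs) \<ge> d"
  proof -
    have "card (R - set fs - set rs) = card (R - set fs) - length rs"
      using rs F(2) by (simp add: card_Diff_subset distinct_card)
    then show ?thesis using cR rs lss by linarith
  qed
  then obtain g where g: "inj_on g S" "g ` S \<subseteq> R - set fs - set rs"
    using card_le_inj[of S "R - set fs - set rs"] F(1,2) V(4) by auto
  let ?zs = "weave ss rs"
  have szs: "set ?zs = set ss \<union> set rs" using rs(3) by (simp add: set_weave)
  have pz: "path V ?zs"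
    using rs ss V F by (intro path_weave[of ss rs S R V]) auto
  obtain us vs where ls: "ls = us @ ?l # vs" using fs(2) by (meson split_list)
  have sums: "(\<Sum>l\<leftarrow>us @ vs. l div 2) + ?l div 2 = Suc d" using b ls by (simp add: bip_def)
  have disj: "set rs \<inter> (S - set fs) = {}" using rs(2) F(3) by blast
  \<comment> \<open>The other lengths are cut from a path alternating between the rest of
    \<open>S\<close>, all marked, and \<open>R\<close>. They need \<open>Suc d - ?l div 2\<close>
    marks, no more than are left because \<open>fs\<close> saved one.\<close>
  have "packs (set ?zs \<union> g ` ((S - set fs) \<inter> set ?zs)) (us @ vs)"
  proof (rule packs_marks[OF pz])
    show "nonconsec (S - set fs) ?zs" using rs(3) disj by (intro nonconsec_weave) auto
    show "inj_on g (S - set fs)" using g(1) inj_on_subset by blast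
    have gS: "g ` (S - set fs) \<subseteq> R - set fs - set rs" using g(2) by blast
    show "g ` (S - set fs) \<subseteq> V" using gS V(3) by blast
    show "g ` (S - set fs) \<inter> set ?zs = {}" using gS szs ss(1) F(3) by blast
    show "g ` (S - set fs) \<inter> (S - set fs) = {}" using gS F(3) by blast
    show "\<forall>x\<in>S - set fs. adj (g x) x" using gS F(4) adj_sym by blast
    show "\<forall>l\<in>set (us @ vs). 2 \<le> l \<and> l \<noteq> 3" using b ls by (auto simp: bip_def admissible_def)
    have "marks (S - set fs) ?zs = length ss" using rs(3) ss(1) disj by (intro marks_weave) auto
    then show "(\<Sum>l\<leftarrow>us @ vs. l div 2) \<le> marks (S - set fs) ?zs" using sums save lss by linarith
  qed
  moreover have "packs (set fs) [?l]" using packs_path[OF fs(1), of "[?l]"] by simp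
  moreover have "set fs \<inter> (set ?zs \<union> g ` ((S - set fs) \<inter> set ?zs)) = {}"
  proof -
    have "g ` ((S - set fs) \<inter> set ?zs) \<subseteq> g ` S" by blast
    then show ?thesis using szs ss(1) rs(2) g(2) by blast
  qed
  moreover have "set fs \<subseteq> V" "set ?zs \<union> g ` ((S - set fs) \<inter> set ?zs) \<subseteq> V"
    using path_set[OF fs(1)] path_set[OF pz] g(2) V(3) by auto
  ultimately have "packs V ([?l] @ (us @ vs))" by (intro packs_append[of "set fs" "[?l]" _ "us @ vs"])
  then have "packs V ls" by (rule packs_perm) (simp add: ls)
  then show False using b by (simp add: bip_def)
qed

text \<open>Continued by an alternating path starting at \<open>s\<close>, the head yields a path on
  \<open>l\<close> vertices with only \<open>l div 2 - 1\<close> vertices in \<open>S\<close>. The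
  length condition asks for a head on two vertices if \<open>l\<close> is even and on three if
  \<open>l\<close> is odd.\<close>

lemma bip_head:
  assumes b: "bip V S R d ls" and hs: "path V hs" "hs \<noteq> []" "set hs \<inter> (S \<union> R) = {}"
    and s: "s \<in> S" "adj (last hs) s" and l: "l \<in> set ls" "length hs + 2 * (l div 2 - 1) = l"
  shows False
proof -
  note F = bip_facts[OF b]
  have V: "finite V" "S \<subseteq> V" "R \<subseteq> V" "card S = d" "3 * d \<le> card R" using b by (auto simp: bip_def)
  have a: "l div 2 \<le> d" "1 \<le> l div 2" using admissible_div2_lt[of ls l] b l by (auto simp: bip_def admissible_def)
  obtain ss where ss: "distinct ss" "set ss \<subseteq> S" "length ss = l div 2 - 1" "ss \<noteq> [] \<Longrightarrow> hd ss = s"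
  proof (cases "l div 2 = 1")
    case True
    then show ?thesis using that[of "[]"] by simp
  next
    case False
    have "card (S - {s}) = d - 1" using s(1) V(4) F(1) by simp
    then have "l div 2 - 2 \<le> card (S - {s})" using a by linarith
    then obtain ts where "distinct ts" "set ts \<subseteq> S - {s}" "length ts = l div 2 - 2"
      using distinct_list_of_card[of "S - {s}"] F(1) by blast
    moreover have "Suc (l div 2 - 2) = l div 2 - 1" using a False by linarith
    ultimately show ?thesis using that[of "s # ts"] s(1) by auto
  qed
  have "length ss \<le> card R" using ss(3) a V(5) by linarith
  then obtain rs where rs: "distinct rs" "set rs \<subseteq> R" "length rs = length ss"
    using distinct_list_of_card F(2) by metis
  let ?fs = "hs @ weave ss rs"
  have sw: "set (weave ss rs) = set ss \<union> set rs" using rs(3) by (simp add: set_weave)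
  have "path V (weave ss rs)" using ss rs V F by (intro path_weave[of ss rs S R V]) auto
  moreover have "adj (last hs) (hd (weave ss rs))" if "weave ss rs \<noteq> []"
  proof -
    have "ss \<noteq> []" using that by auto
    then show ?thesis using ss(4) s rs(3) by (simp add: hd_weave)
  qed
  moreover have "set hs \<inter> set (weave ss rs) = {}" using hs(3) sw ss(2) rs(2) by blast
  ultimately have p: "path V ?fs" using hs by (auto simp: path_append)
  have len: "length ?fs = l" using l(2) ss(3) rs(3) by (simp add: length_weave)
  have "S \<inter> set ?fs = set ss" "R \<inter> set ?fs = set rs" using hs(3) sw ss(2) rs(2) F(3) by auto
  then have "card (S \<inter> set ?fs) = l div 2 - 1" "card (R \<inter> set ?fs) = l div 2 - 1"
    using ss rs by (auto simp: distinct_card)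
  moreover have "l div 2 - 1 < l div 2" "l div 2 - 1 \<le> d" using a by linarith+
  ultimately show False using bip_saving_path[OF b p] len l(1) by metis
qed

text \<open>A vertex of \<open>R\<close> has all its neighbours in \<open>S\<close> and so is a
  component of \<open>V - S\<close> on its own; any other component is joined to \<open>S\<close>
  because \<open>V\<close> is connected.\<close>

lemma bip_comp:
  assumes b: "bip V S R d ls" and K: "comp (V - S) K" "2 \<le> card K"
  obtains z s where "K \<inter> (S \<union> R) = {}" "z \<in> K" "s \<in> S" "adj z s" "K \<subseteq> V"
proof -
  note F = bip_facts[OF b]
  have KV: "K \<subseteq> V - S" "K \<noteq> {}" "conn K" using K(1) comp_subset comp_nonempty comp_conn by auto
  have "S \<subseteq> V" using b by (simp add: bip_def)
  then have "K \<noteq> V" using KV F(6) by blast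
  moreover have "conn V" using b by (simp add: bip_def)
  ultimately obtain z v where z: "z \<in> K" "v \<in> V - K" "adj z v"
    using KV unfolding conn_def by (meson Diff_subset subset_trans)
  then have "v \<in> S" using K(1) by (auto simp: comp_def)
  moreover have "K \<inter> R = {}"
  proof (rule ccontr)
    assume "K \<inter> R \<noteq> {}"
    then obtain r where r: "r \<in> K" "r \<in> R" by blast
    have "{r} \<noteq> K" using K(2) by auto
    then obtain u where "u \<in> K - {r}" "adj r u" using KV(3) r(1) unfolding conn_def by (metis empty_not_insert insert_subset empty_subsetI singletonD)
    moreover have "nb V r = S" using b r(2) by (auto simp: bip_def)
    ultimately show False using KV(1) adj_sym[of r u] by (auto simp: nb_def)
  qed
  ultimately show thesis using that z KV by blast
qed

text \<open>In the component of such an edge some vertex \<open>z\<close> has a neighbour in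
  \<open>S\<close>; \<open>z\<close> and a neighbour in the component form a head on two
  vertices.\<close>

lemma bip_even:
  assumes b: "bip V S R d ls" and l: "l \<in> set ls" "even l" and uv: "u \<in> V - S" "v \<in> V - S"
  shows "\<not> adj u v"
proof
  assume a: "adj u v"
  have fin: "finite (V - S)" using b by (simp add: bip_def)
  obtain K where K: "comp (V - S) K" "u \<in> K" using comp_exists[OF fin uv(1)] by blast
  then have "v \<in> K" using a uv(2) by (auto simp: comp_def)
  moreover have "u \<noteq> v" using a by auto
  moreover have "finite K" using K fin comp_subset finite_subset by blast
  ultimately have c: "2 \<le> card K" using K(2) by (metis (no_types, lifting) card_2_iff card_mono empty_subsetI insert_subset)
  obtain z s where z: "K \<inter> (S \<union> R) = {}" "z \<in> K" "s \<in> S" "adj z s" "K \<subseteq> V"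
    using bip_comp[OF b K(1) c] by blast
  have "{z} \<noteq> K" using c by auto
  then obtain y where y: "y \<in> K - {z}" "adj z y"
    using comp_conn[OF K(1)] z(2) unfolding conn_def by (metis empty_not_insert insert_subset empty_subsetI singletonD)
  have "path V [y, z]" using y z adj_sym by (auto simp: path_Cons)
  moreover have "2 \<le> l" using b l(1) by (auto simp: bip_def admissible_def)
  then have "2 + 2 * (l div 2 - 1) = l" using l(2) by presburger
  ultimately show False using bip_head[OF b, of "[y, z]" s l] z y l by auto
qed

text \<open>A component of \<open>V - S\<close> on three vertices would contain a head on three
  vertices, so edges of \<open>V - S\<close> are components. Two of them, used as head and tail of
  one alternating path, again save a vertex of \<open>S\<close>.\<close>

lemma bip_all_odd:
  assumes b: "bip V S R d ls" and odd: "\<forall>l\<in>set ls. odd l"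
  shows "\<exists>e. \<forall>u\<in>V - S. \<forall>v\<in>V - S. adj u v \<longrightarrow> {u, v} = e"
proof (rule ccontr)
  assume neg: "\<not> ?thesis"
  note F = bip_facts[OF b]
  have V: "finite V" "S \<subseteq> V" "R \<subseteq> V" "card S = d" "3 * d \<le> card R" "\<forall>v\<in>V. d \<le> card (nb V v)"
    using b by (auto simp: bip_def)
  obtain l where l: "l \<in> set ls" using b by (cases ls) (auto simp: bip_def admissible_def)
  have l5: "l \<ge> 5" "odd l"
  proof -
    show "odd l" using odd l by blast
    moreover have "2 \<le> l" "l \<noteq> 3" using b l by (auto simp: bip_def admissible_def)
    ultimately show "l \<ge> 5" by presburger
  qed
  define a where "a = l div 2"
  have a: "l = 2 * a + 1" "a \<ge> 2" using l5 by (auto simp: a_def)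
  have ad: "a \<le> d" using admissible_div2_lt[of ls l] b l a by (auto simp: bip_def)
  \<comment> \<open>At least two odd lengths, each at least 5, contribute two halves each, so
    \<open>Suc d \<ge> 4\<close>.\<close>
  have d3: "3 \<le> d"
  proof -
    obtain us vs where e: "ls = us @ l # vs" using l by (meson split_list)
    then have "us @ vs \<noteq> []" using b by (auto simp: bip_def admissible_def)
    then obtain x where x: "x \<in> set (us @ vs)" by (meson last_in_set)
    then have "x div 2 \<le> (\<Sum>l\<leftarrow>us @ vs. l div 2)" by (intro member_le_sum_list) auto
    moreover have "2 \<le> x div 2"
    proof -
      have "odd x" "2 \<le> x" "x \<noteq> 3" using x e odd b by (auto simp: bip_def admissible_def)
      then show ?thesis by presburger
    qed
    moreover have "Suc d = l div 2 + (\<Sum>l\<leftarrow>us @ vs. l div 2)" using e b by (simp add: bip_def)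
    ultimately show ?thesis using a by simp
  qed
  have fin: "finite (V - S)" using V by simp
  have head3: False if "path V [x, y, z]" "{x, y, z} \<inter> (S \<union> R) = {}" "s \<in> S" "adj z s" for x y z s
  proof -
    have "3 + 2 * (l div 2 - 1) = l" using a by simp
    then show False using bip_head[OF b that(1) _ _ that(3), of l] that l by auto
  qed
  have small: "card K \<le> 2" if K: "comp (V - S) K" for K
  proof (rule ccontr)
    assume c: "\<not> card K \<le> 2"
    have cK: "conn K" using K by (rule comp_conn)
    obtain z s where z: "K \<inter> (S \<union> R) = {}" "z \<in> K" "s \<in> S" "adj z s" "K \<subseteq> V"
      using bip_comp[OF b K] c by (metis nat_le_linear)
    have "{z} \<noteq> K" using c by auto
    then obtain y where y: "y \<in> K - {z}" "adj z y"
      using cK z(2) unfolding conn_def by (metis empty_not_insert insert_subset empty_subsetI singletonD)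
    have no3: False if "y' \<in> K" "y'' \<in> K" "y'' \<noteq> z" "y' \<noteq> z" "y'' \<noteq> y'" "adj y'' y'" "adj y' z" for y' y''
      using head3[of y'' y' z s] that z by (auto simp: path_Cons)
    have "card {z, y} \<le> 2" by (simp add: card_insert_if)
    then have "{z, y} \<noteq> K" using c by auto
    moreover have "{z, y} \<subseteq> K" using z y by auto
    ultimately obtain w y' where w: "w \<in> {z, y}" "y' \<in> K - {z, y}" "adj w y'"
      using cK unfolding conn_def by (metis insert_not_empty)
    show False
    proof (cases "w = y")
      case True
      then show False using no3[of y y'] w y adj_sym by auto
    next
      case False
      then have zy': "adj z y'" using w by auto
      show False
      proof (cases "\<exists>s\<in>S. adj y s")
        case True
        then obtain s' where "s' \<in> S" "adj y s'" by blast
        moreover have "path V [y', z, y]" using w y zy' z adj_sym by (auto simp: path_Cons)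
        ultimately show False using head3[of y' z y s'] z w y by auto
      next
        case False
        have "y \<in> V" using y z by auto
        \<comment> \<open>As \<open>y\<close> has no neighbour in \<open>S\<close>, all its
          neighbours lie in \<open>K\<close>; one other than \<open>z\<close> gives a head ending in
          \<open>y\<close>, \<open>z\<close>.\<close>
        then have "3 \<le> card (nb V y)" using V(6) d3 by (meson le_trans)
        moreover have "card {z} = 1" by simp
        ultimately have "\<not> nb V y \<subseteq> {z}" by (metis One_nat_def card_mono finite.emptyI finite.insertI le_trans not_less_eq_eq numeral_3_eq_3 le_SucI order_refl Suc_le_mono zero_le)
        then obtain y'' where "y'' \<in> nb V y" "y'' \<noteq> z" by blast
        then have y'': "y'' \<in> V" "adj y'' y" "y'' \<noteq> z" by (auto simp: nb_iff)
        have "y'' \<notin> S" using False y'' adj_sym by blast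
        then have "y'' \<in> K" using K y y'' adj_sym[of y y''] by (auto simp: comp_def)
        moreover have "y'' \<noteq> y" using y''(2) by auto
        ultimately show False using no3[of y y''] y y'' adj_sym[of y z] by auto
      qed
    qed
  qed
  have edge_comp: "comp (V - S) {u, v}" if uv: "u \<in> V - S" "v \<in> V - S" "adj u v" for u v
  proof -
    obtain K where K: "comp (V - S) K" "u \<in> K" using comp_exists[OF fin uv(1)] by blast
    then have "v \<in> K" using uv by (auto simp: comp_def)
    moreover have "u \<noteq> v" using uv by auto
    moreover have "finite K" using K fin comp_subset finite_subset by blast
    ultimately have "{u, v} = K" using small[OF K(1)] K(2) by (intro card_seteq) auto
    then show ?thesis using K by simp
  qed
  obtain y y' where y: "y \<in> V - S" "y' \<in> V - S" "adj y y'"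
    using neg by blast
  obtain z z' where z: "z \<in> V - S" "z' \<in> V - S" "adj z z'" "{z, z'} \<noteq> {y, y'}"
    using spec[OF neg[unfolded not_ex], of "{y, y'}"] by blast
  have Ky: "comp (V - S) {y, y'}" and Kz: "comp (V - S) {z, z'}" using edge_comp y z by auto
  have disj: "{y, y'} \<inter> {z, z'} = {}" using comp_disjoint[OF Ky Kz] z(4) by blast
  have dist: "distinct [y, y', z, z']" using disj y z by auto
  have c2: "card {y, y'} = 2" "card {z, z'} = 2" using dist by auto
  have notSR: "{y, y'} \<inter> (S \<union> R) = {}" "{z, z'} \<inter> (S \<union> R) = {}"
    using bip_comp[OF b Ky] bip_comp[OF b Kz] c2 by (metis order_refl)+
  have nbS: "d - 1 \<le> card (nb S x)" if "comp (V - S) {x, x'}" "x \<in> V" for x x'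
  proof -
    have "nb V x \<subseteq> nb S x \<union> {x'}"
    proof
      fix u assume u: "u \<in> nb V x"
      then have "u \<noteq> x" by (auto simp: nb_iff)
      then show "u \<in> nb S x \<union> {x'}" using u that(1) adj_sym[of u x] by (auto simp: comp_def nb_iff)
    qed
    then have "card (nb V x) \<le> card (nb S x \<union> {x'})" using F(1) finite_nb by (intro card_mono) auto
    also have "\<dots> \<le> card (nb S x) + 1" using card_Un_le[of "nb S x" "{x'}"] by simp
    finally show ?thesis using V(6) that(2) by (meson diff_le_mono2 le_diff_conv le_trans)
  qed
  have N1: "d - 1 \<le> card (nb S y')" using nbS[of y' y] Ky y by (simp add: insert_commute)
  have N2: "d - 1 \<le> card (nb S z)" using nbS[of z z'] Kz z by simp
  have NS: "nb S y' \<subseteq> S" "nb S z \<subseteq> S" by (auto simp: nb_def)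
  obtain ss where ss: "distinct ss" "set ss \<subseteq> S" "length ss = a - 1" "adj y' (hd ss)" "adj (last ss) z"
  proof (cases "a = 2")
    case True
    \<comment> \<open>Two subsets of \<open>S\<close> with at least \<open>d - 1\<close> elements
      meet because \<open>2 * (d - 1) > d\<close> for \<open>d \<ge> 3\<close>.\<close>
    have "nb S y' \<inter> nb S z \<noteq> {}"
    proof
      assume "nb S y' \<inter> nb S z = {}"
      then have "card (nb S y' \<union> nb S z) = card (nb S y') + card (nb S z)"
        using F(1) finite_nb by (intro card_Un_disjoint) auto
      moreover have "card (nb S y' \<union> nb S z) \<le> d" using NS F(1) V(4) by (metis Un_least card_mono)
      ultimately show False using N1 N2 d3 by linarith
    qed
    then obtain s where "s \<in> S" "adj s y'" "adj s z" by (auto simp: nb_iff)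
    then show thesis using that[of "[s]"] True adj_sym by auto
  next
    case False
    have "nb S y' \<noteq> {}" using N1 d3 by auto
    then obtain s where s: "s \<in> S" "adj s y'" by (auto simp: nb_iff)
    have "\<not> nb S z \<subseteq> {s}"
    proof
      assume "nb S z \<subseteq> {s}"
      then have "card (nb S z) \<le> card {s}" by (intro card_mono) auto
      then show False using N2 d3 by simp
    qed
    then obtain t where "t \<in> nb S z" "t \<noteq> s" by blast
    then have t: "t \<in> S" "adj t z" "t \<noteq> s" by (auto simp: nb_iff)
    have "card (S - {s, t}) = d - 2" using s t V(4) F(1) by (simp add: card_Diff_subset)
    then have "a - 3 \<le> card (S - {s, t})" using ad False a(2) by linarith
    then obtain ts where "distinct ts" "set ts \<subseteq> S - {s, t}" "length ts = a - 3"
      using distinct_list_of_card[of "S - {s, t}"] F(1) by blast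
    moreover have "Suc (Suc (a - 3)) = a - 1" using False a(2) by linarith
    ultimately show thesis using that[of "s # ts @ [t]"] s t adj_sym by auto
  qed
  have "a - 2 \<le> card R" using ad V(5) by linarith
  then obtain rs where rs: "distinct rs" "set rs \<subseteq> R" "length rs = a - 2"
    using distinct_list_of_card F(2) by metis
  have ssne: "ss \<noteq> []" using ss(3) a(2) by auto
  have lb: "length (butlast ss) = length rs" using ss(3) rs(3) by simp
  let ?w = "weave (butlast ss) rs @ [last ss]"
  have sw: "set ?w = set ss \<union> set rs"
  proof -
    have "set ss = set (butlast ss) \<union> {last ss}" using ssne
      by (metis append_butlast_last_id empty_set list.simps(15) set_append)
    then show ?thesis using lb by (auto simp: set_weave)
  qed
  have pw: "path V ?w"
  proof -
    \<comment> \<open>A spare vertex of \<open>R\<close> makes both lists equally long, as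
      \<open>path_weave\<close> requires; it is cut off again at the end.\<close>
    have "R - set rs \<noteq> {}"
    proof
      assume "R - set rs = {}"
      then have "card R \<le> length rs" using rs by (metis Diff_eq_empty_iff card_length card_mono finite_set le_trans)
      then show False using rs(3) ad V(5) F(5) by linarith
    qed
    then obtain r where r: "r \<in> R" "r \<notin> set rs" by blast
    have "path V (weave (butlast ss @ [last ss]) (rs @ [r]))"
      using ss rs r V F lb ssne by (intro path_weave[of _ _ S R V]) auto
    then have "path V ((weave (butlast ss) rs @ [last ss]) @ [r])" using lb by (simp add: weave_snoc)
    then show ?thesis unfolding path_append by simp
  qed
  have hw: "hd ?w = hd ss"
  proof (cases "butlast ss = []")
    case True
    then have "ss = [last ss]" using ssne by (metis append_butlast_last_id append_Nil)
    moreover have "weave (butlast ss) rs = []" using True by simp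
    ultimately show ?thesis by (metis append_Nil)
  next
    case False
    then have "weave (butlast ss) rs \<noteq> []" using lb by (metis length_0_conv length_weave mult_eq_0_iff zero_neq_numeral)
    then have "hd ?w = hd (butlast ss)" using lb False by (simp add: hd_weave)
    also have "\<dots> = hd ss" using False ssne by (metis append_butlast_last_id hd_append2)
    finally show ?thesis .
  qed
  let ?fs = "[y, y'] @ ?w @ [z, z']"
  have "set ?w \<inter> {y, y', z, z'} = {}" using sw ss(2) rs(2) notSR by blast
  then have p: "path V ?fs"
  proof -
    have "path V (?w @ [z, z'])"
      using \<open>set ?w \<inter> {y, y', z, z'} = {}\<close> pw dist z ss(5) by (subst path_append) (auto simp: path_Cons)
    moreover have "hd (?w @ [z, z']) = hd ss" using hw by (cases "weave (butlast ss) rs") auto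
    ultimately show ?thesis
      using \<open>set ?w \<inter> {y, y', z, z'} = {}\<close> dist y ss(4) by (subst path_append) (auto simp: path_Cons)
  qed
  have len: "length ?fs = l" using lb rs(3) a by (simp add: length_weave)
  have "S \<inter> set ?fs = set ss" "R \<inter> set ?fs = set rs" using notSR sw ss(2) rs(2) F(3) by auto
  then have "card (S \<inter> set ?fs) = a - 1" "card (R \<inter> set ?fs) = a - 2"
    using ss rs by (auto simp: distinct_card)
  moreover have "a - 1 < l div 2" "a - 2 \<le> d" using a ad by linarith+
  ultimately show False using bip_saving_path[OF b p] len l by metis
qed

text \<open>Listing \<open>V\<close> with \<open>S\<close> first, followed by the ends of the
  exceptional edge if there is one, turns every edge into an edge of G_F. Replacing vertices by
  their positions \<open>f\<close> then maps cliques injectively to cliques.\<close>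

lemma bip_cliques:
  assumes b: "bip V S R d ls"
  shows "card (cl s V) \<le> num_cliques s {0..<card V} (GF_E ls (card V))"
proof -
  let ?n = "card V"
  note F = bip_facts[OF b]
  have V: "finite V" "S \<subseteq> V" "card S = d" using b by (auto simp: bip_def)
  have dF: "delta_F ls = d" using b by (simp add: delta_F_def bip_def)
  obtain ts where ts: "set ts = S" "distinct ts" using finite_distinct_list F(1) by blast
  have lts: "length ts = d" using ts V(3) distinct_card by metis
  obtain os where os: "set os = V - S" "distinct os"
    and oe: "\<And>i j. i < length os \<Longrightarrow> j < length os \<Longrightarrow> i < j \<Longrightarrow> adj (os ! i) (os ! j) \<Longrightarrow>
        (\<forall>l\<in>set ls. odd l) \<and> i = 0 \<and> j = 1"
  proof (cases "(\<forall>l\<in>set ls. odd l) \<and> (\<exists>y\<in>V - S. \<exists>z\<in>V - S. adj y z)")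
    case True
    then obtain y z where yz: "y \<in> V - S" "z \<in> V - S" "adj y z" by blast
    obtain e where e: "\<forall>u\<in>V - S. \<forall>v\<in>V - S. adj u v \<longrightarrow> {u, v} = e"
      using bip_all_odd[OF b] True by blast
    then have uniq: "{u, v} = {y, z}" if "u \<in> V - S" "v \<in> V - S" "adj u v" for u v
      using that yz by metis
    obtain qs where qs: "set qs = V - S - {y, z}" "distinct qs"
      using finite_distinct_list V(1) by (metis finite_Diff)
    have yzne: "y \<noteq> z" using yz by auto
    let ?os = "y # z # qs"
    have d: "distinct ?os" "set ?os = V - S" using qs yz yzne by auto
    moreover have "(\<forall>l\<in>set ls. odd l) \<and> i = 0 \<and> j = 1"
      if ij: "i < length ?os" "j < length ?os" "i < j" "adj (?os ! i) (?os ! j)" for i j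
    proof -
      have "?os ! i \<in> V - S" "?os ! j \<in> V - S" using ij d(2) nth_mem by blast+
      then have "{?os ! i, ?os ! j} = {?os ! 0, ?os ! 1}" using uniq ij(4) by simp
      then have "?os ! j = ?os ! 0 \<or> ?os ! j = ?os ! 1" "?os ! i = ?os ! 0 \<or> ?os ! i = ?os ! 1" by auto
      moreover have "0 < length ?os" "1 < length ?os" by auto
      ultimately have "j = 0 \<or> j = 1" "i = 0 \<or> i = 1"
        using d(1) ij nth_eq_iff_index_eq by metis+
      then show ?thesis using True ij(3) by auto
    qed
    ultimately show thesis using that[of ?os] by auto
  next
    case False
    then have no: "\<not> adj u v" if "u \<in> V - S" "v \<in> V - S" for u v
      using bip_even[OF b] that by blast
    obtain os where "set os = V - S" "distinct os" using finite_distinct_list V(1) by (metis finite_Diff)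
    then show thesis using that[of os] no nth_mem by metis
  qed
  define vs where "vs = ts @ os"
  have vs: "distinct vs" "set vs = V" using ts os V(2) by (auto simp: vs_def)
  have lvs: "length vs = ?n" using vs distinct_card by metis
  define f where "f = (\<lambda>K. {i. i < ?n \<and> vs ! i \<in> K})"
  have img: "(!) vs ` f K = K" if "K \<subseteq> V" for K
    using that vs(2) lvs by (auto simp: f_def image_iff) (metis in_set_conv_nth subsetD)
  have inj_nth: "inj_on ((!) vs) (f K)" for K
    using vs(1) lvs by (auto simp: f_def inj_on_def nth_eq_iff_index_eq)
  let ?G = "{K. K \<subseteq> {0..<?n} \<and> card K = s \<and> (\<forall>u\<in>K. \<forall>v\<in>K. u \<noteq> v \<longrightarrow> {u, v} \<in> GF_E ls ?n)}"
  have edge: "{i, j} \<in> GF_E ls ?n" if "i < j" "j < ?n" "adj (vs ! i) (vs ! j)" for i j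
  proof (cases "i < d")
    case True
    then show ?thesis using that dF unfolding GF_E_def by blast
  next
    case False
    then have "vs ! i = os ! (i - d)" "vs ! j = os ! (j - d)" "i - d < length os" "j - d < length os" "i - d < j - d"
      using that lts lvs by (auto simp: vs_def nth_append)
    then have o: "\<forall>l\<in>set ls. odd l" and "i - d = 0" "j - d = 1" using oe that(3) by metis+
    then have "i = delta_F ls" "j = Suc (delta_F ls)" using False that(1) dF by linarith+
    with o have "(\<forall>l\<in>set ls. odd l) \<and> i = delta_F ls \<and> j = Suc (delta_F ls)" by blast
    then show ?thesis using that unfolding GF_E_def by blast
  qed
  have "f ` cl s V \<subseteq> ?G"
  proof (clarify, intro conjI ballI impI)
    fix K assume K: "K \<in> cl s V"
    show "f K \<subseteq> {0..<?n}" by (auto simp: f_def)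
    have KV: "K \<subseteq> V" using K by (simp add: cl_def)
    show "card (f K) = s" using card_image[OF inj_nth, of K] img[OF KV] K by (simp add: cl_def)
    fix i j assume ij: "i \<in> f K" "j \<in> f K" "i \<noteq> j"
    then have "vs ! i \<noteq> vs ! j" using inj_nth[of K] by (auto simp: inj_on_def)
    then have a: "adj (vs ! i) (vs ! j)" "adj (vs ! j) (vs ! i)" using K ij by (auto simp: cl_def f_def)
    show "{i, j} \<in> GF_E ls ?n"
    proof (cases "i < j")
      case True
      then show ?thesis using edge a ij by (simp add: f_def)
    next
      case False
      then show ?thesis using edge[of j i] a ij by (simp add: f_def insert_commute)
    qed
  qed
  moreover have "inj_on f (cl s V)"
  proof (rule inj_onI)
    fix K L assume "K \<in> cl s V" "L \<in> cl s V" "f K = f L"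
    then show "K = L" using img by (metis (no_types, lifting) cl_def mem_Collect_eq)
  qed
  moreover have "finite ?G" by (rule finite_subset[of _ "Pow {0..<?n}"]) auto
  ultimately have "card (cl s V) \<le> card ?G" by (intro card_inj_on_le[of f])
  then show ?thesis by (simp add: num_cliques_def)
qed

text \<open>The path vertices are matched into \<open>R\<close> with a surplus; the failing part
  \<open>Z\<close> has at most \<open>card Z \<le> length xs\<close> neighbours in \<open>R\<close>.
  Removing these leaves \<open>R0\<close> with more than \<open>3 * d\<close> vertices, none
  adjacent to \<open>Z\<close>, so the rerouting lemmas apply with
  \<open>X = set xs - Z\<close>.\<close>

lemma many_singles_cliques:
  assumes V: "finite V" "conn V" "\<forall>v\<in>V. d \<le> card (nb V v)" and lp: "longest V xs"
    and np: "\<not> packs V ls" "admissible ls" "(\<Sum>l\<leftarrow>ls. l div 2) = Suc d"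
    and R: "R \<subseteq> V - set xs" "\<forall>w\<in>R. nb V w \<subseteq> set xs" "length xs + 3 * d < card R"
  shows "card (cl s V) \<le> num_cliques s {0..<card V} (GF_E ls (card V))"
proof -
  define N where "N = (\<lambda>x. {w\<in>R. adj w x})"
  have finR: "finite R" using R(1) V(1) finite_subset by blast
  have finN: "finite (N x)" for x using finR by (simp add: N_def)
  obtain Z where Z: "Z \<subseteq> set xs" "card (\<Union> (N ` Z)) \<le> card Z"
    and sdr: "\<And>w. \<exists>r. inj_on r (set xs - Z) \<and> (\<forall>x\<in>set xs - Z. r x \<in> N x - \<Union> (N ` Z) - {w})"
    using surplus_matching[of "set xs" N, OF finite_set finN] by blast
  define X where "X = set xs - Z"
  define R0 where "R0 = R - \<Union> (N ` Z)"
  have "\<exists>r. inj_on r X \<and> (\<forall>x\<in>X. r x \<in> R0 - {w} \<and> adj (r x) x)" for w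
    using sdr[of w] unfolding X_def R0_def N_def by blast
  moreover have nbX: "nb V w \<subseteq> X" if w: "w \<in> R0" for w
  proof
    fix x assume x: "x \<in> nb V w"
    then have "x \<in> set xs" using R(2) w by (auto simp: R0_def)
    moreover have "x \<notin> Z"
    proof
      assume "x \<in> Z"
      moreover have "w \<in> N x" using x w adj_sym[of x w] by (auto simp: N_def R0_def nb_iff)
      ultimately show False using w by (auto simp: R0_def)
    qed
    ultimately show "x \<in> X" by (simp add: X_def)
  qed
  moreover have R0V: "R0 \<subseteq> V - set xs" using R(1) by (auto simp: R0_def)
  ultimately have S: "singles V xs X R0 d ls"
    using lp V(3) np unfolding singles_def admissible_def by (auto simp: X_def)
  have "\<Union> (N ` Z) \<subseteq> R" by (auto simp: N_def)
  then have "card R0 = card R - card (\<Union> (N ` Z))"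
    unfolding R0_def using finR by (meson card_Diff_subset finite_subset)
  moreover have "card Z \<le> length xs" using Z(1) by (metis card_length card_mono finite_set le_trans)
  ultimately have cR0: "3 * d < card R0" using R(3) Z(2) by linarith
  then obtain w where w: "w \<in> R0" by (metis all_not_in_conv card.empty not_less_zero)
  have "card X = d" using singles_card[OF S w] singles_nb_eq[OF S w] by simp
  moreover have "X \<subseteq> V" using nbX singles_nb_eq[OF S w] by (auto simp: nb_def)
  ultimately have "bip V X R0 d ls"
    unfolding bip_def using V np R0V cR0 singles_nb_eq[OF S] by auto
  then show ?thesis by (rule bip_cliques)
qed

end

section \<open>Components off a longest path\<close>

text \<open>The arithmetic of placing F on two disjoint paths with \<open>m\<close> and
  \<open>n\<close> vertices.\<close>

definition fits :: "nat list \<Rightarrow> nat \<Rightarrow> nat \<Rightarrow> bool" where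
  "fits ls m n \<longleftrightarrow> (\<exists>ks js. mset ls = mset ks + mset js \<and> sum_list ks \<le> m \<and> sum_list js \<le> n)"

lemma fits_sym: "fits ls m n \<Longrightarrow> fits ls n m"
  unfolding fits_def by (metis add.commute)

lemma fits_mono: "fits ls m n \<Longrightarrow> m \<le> m' \<Longrightarrow> n \<le> n' \<Longrightarrow> fits ls m' n'"
  unfolding fits_def by (meson le_trans)

text \<open>The sets \<open>{c..c + len c}\<close> are disjoint and lie in \<open>{lo..<hi}\<close>,
  so their sizes can be added.\<close>

lemma sum_intervals_le:
  fixes C :: "nat set"
  assumes "finite C" "\<And>c. c \<in> C \<Longrightarrow> lo \<le> c \<and> c + len c < hi"
    and "\<And>c c'. c \<in> C \<Longrightarrow> c' \<in> C \<Longrightarrow> c < c' \<Longrightarrow> c + len c < c'"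
  shows "(\<Sum>c\<in>C. len c + 1) + lo \<le> hi \<or> C = {}"
proof (cases "C = {}")
  case False
  then obtain c0 where c0: "c0 \<in> C" by blast
  have disj: "{c..c + len c} \<inter> {c'..c' + len c'} = {}" if "c \<in> C" "c' \<in> C" "c \<noteq> c'" for c c'
    using assms(3)[of c c'] assms(3)[of c' c] that by (cases "c < c'") auto
  have "(\<Sum>c\<in>C. len c + 1) = (\<Sum>c\<in>C. card {c..c + len c})" by simp
  also have "\<dots> = card (\<Union>c\<in>C. {c..c + len c})"
    using assms(1) disj by (intro card_UN_disjoint[symmetric]) auto
  also have "\<dots> \<le> card {lo..<hi}" using assms(2) by (intro card_mono) force+
  finally show ?thesis using assms(2)[OF c0] by auto
qed simp

text \<open>\<open>A\<close> and \<open>B\<close> are the positions, on a longest path with \<open>m\<close> vertices, of the neighbours of the two ends of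
  a path on \<open>t\<close> vertices off it.\<close>

lemma attachment_positions:
  fixes A B :: "nat set"
  assumes fin: "finite A" "finite B" and t: "t \<ge> 1"
    and bnd: "\<And>c. c \<in> A \<union> B \<Longrightarrow> t \<le> c \<and> c + t < m"
    and nA: "\<And>c. c \<in> A \<Longrightarrow> Suc c \<notin> A" and nB: "\<And>c. c \<in> B \<Longrightarrow> Suc c \<notin> B"
    and AB: "\<And>a b. a \<in> A \<Longrightarrow> b \<in> B \<Longrightarrow> a \<noteq> b \<Longrightarrow> a + t < b \<or> b + t < a"
    and cA: "k \<le> card A" and cB: "k \<le> card B" and k: "k \<ge> 1"
  shows "(k \<le> card (A \<inter> B) \<and> k * (t + 1) + t \<le> m) \<or>
     (card (A \<inter> B) < k \<and> card (A \<inter> B) * (t + 1) + 3 * t + 4 * k \<le> m + 2 + 4 * card (A \<inter> B))"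
proof (cases "k \<le> card (A \<inter> B)")
  case True
  have "(\<Sum>c\<in>A \<inter> B. t + 1) + t \<le> m \<or> A \<inter> B = {}"
  proof (rule sum_intervals_le)
    show "finite (A \<inter> B)" using fin by simp
    show "t \<le> c \<and> c + t < m" if "c \<in> A \<inter> B" for c using bnd that by blast
    show "c + t < c'" if "c \<in> A \<inter> B" "c' \<in> A \<inter> B" "c < c'" for c c' using AB[of c c'] that by auto
  qed
  moreover have "A \<inter> B \<noteq> {}" using True k by auto
  ultimately have "card (A \<inter> B) * (t + 1) + t \<le> m" by simp
  moreover have "k * (t + 1) \<le> card (A \<inter> B) * (t + 1)" using True by (rule mult_le_mono1)
  ultimately show ?thesis using True by linarith
next
  case False
  let ?X = "A \<inter> B"
  have A1: "A - B \<noteq> {}"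
  proof
    assume "A - B = {}"
    then have "A = ?X" by blast
    then show False using False cA by simp
  qed
  have B1: "B - A \<noteq> {}"
  proof
    assume "B - A = {}"
    then have "B = ?X" by blast
    then show False using False cB by simp
  qed
  define a where "a = Max (A - B)"
  define b where "b = Max (B - A)"
  have a: "a \<in> A - B" "\<And>c. c \<in> A - B \<Longrightarrow> c \<le> a" using A1 fin Max_in[of "A - B"] by (auto simp: a_def)
  have b: "b \<in> B - A" "\<And>c. c \<in> B - A \<Longrightarrow> c \<le> b" using B1 fin Max_in[of "B - A"] by (auto simp: b_def)
  \<comment> \<open>Whatever follows a common element, or the last element \<open>a\<close> of
    \<open>A - B\<close> or \<open>b\<close> of \<open>B - A\<close>, can be reached from it by a
    detour, so the next gap exceeds \<open>t\<close>. Any other element is only known not to be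
    followed by its successor.\<close>
  define len where "len = (\<lambda>c. if c \<in> ?X \<or> c = a \<or> c = b then t else 1)"
  have "(\<Sum>c\<in>A \<union> B. len c + 1) + t \<le> m \<or> A \<union> B = {}"
  proof (rule sum_intervals_le)
    show "finite (A \<union> B)" using fin by simp
    show "t \<le> c \<and> c + len c < m" if "c \<in> A \<union> B" for c
      using bnd[OF that] t by (auto simp: len_def)
    fix c c' assume c: "c \<in> A \<union> B" "c' \<in> A \<union> B" "c < c'"
    have far: "c + t < c'" if "(c \<in> A \<and> c' \<in> B) \<or> (c \<in> B \<and> c' \<in> A)"
      using that AB[of c c'] AB[of c' c] c(3) by auto
    show "c + len c < c'"
    proof (cases "c \<in> ?X \<or> c = a \<or> c = b")
      case True
      have "(c \<in> A \<and> c' \<in> B) \<or> (c \<in> B \<and> c' \<in> A)"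
        using True a b c by (metis DiffD1 DiffI IntE UnE leD)
      then show ?thesis using far t by (auto simp: len_def)
    next
      case False
      show ?thesis
      proof (cases "(c \<in> A \<and> c' \<in> B) \<or> (c \<in> B \<and> c' \<in> A)")
        case True
        then show ?thesis using far t by (auto simp: len_def)
      next
        case nf: False
        then have "Suc c \<noteq> c'" using c nA[of c] nB[of c] by auto
        then show ?thesis using c(3) False by (auto simp: len_def)
      qed
    qed
  qed
  then have S: "(\<Sum>c\<in>A \<union> B. len c + 1) + t \<le> m" using A1 by auto
  have ab: "a \<noteq> b" using a b by auto
  have un: "A \<union> B = ?X \<union> {a, b} \<union> ((A - B) - {a} \<union> ((B - A) - {b}))" using a b by auto
  have "(\<Sum>c\<in>A \<union> B. len c + 1) =
      (\<Sum>c\<in>?X. len c + 1) + (\<Sum>c\<in>{a, b}. len c + 1) + (\<Sum>c\<in>(A - B) - {a} \<union> ((B - A) - {b}). len c + 1)"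
  proof -
    have "(\<Sum>c\<in>?X \<union> {a, b} \<union> ((A - B) - {a} \<union> ((B - A) - {b})). len c + 1)
      = (\<Sum>c\<in>?X \<union> {a, b}. len c + 1) + (\<Sum>c\<in>(A - B) - {a} \<union> ((B - A) - {b}). len c + 1)"
      using fin a b by (intro sum.union_disjoint) auto
    moreover have "(\<Sum>c\<in>?X \<union> {a, b}. len c + 1) = (\<Sum>c\<in>?X. len c + 1) + (\<Sum>c\<in>{a, b}. len c + 1)"
      using fin a b by (intro sum.union_disjoint) auto
    ultimately show ?thesis using un by simp
  qed
  moreover have "(\<Sum>c\<in>?X. len c + 1) = card ?X * (t + 1)" by (simp add: len_def)
  moreover have "(\<Sum>c\<in>{a, b}. len c + 1) = 2 * t + 2" using ab by (simp add: len_def)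
  moreover have "(\<Sum>c\<in>(A - B) - {a} \<union> ((B - A) - {b}). len c + 1) = 2 * card ((A - B) - {a} \<union> ((B - A) - {b}))"
  proof -
    have "(\<Sum>c\<in>(A - B) - {a} \<union> ((B - A) - {b}). len c + 1) = (\<Sum>c\<in>(A - B) - {a} \<union> ((B - A) - {b}). 2)"
      using a b by (intro sum.cong) (auto simp: len_def)
    then show ?thesis by simp
  qed
  moreover have "card ((A - B) - {a} \<union> ((B - A) - {b})) = (card (A - B) - 1) + (card (B - A) - 1)"
    using fin a b by (subst card_Un_disjoint) auto
  moreover have "card (A - B) = card A - card ?X" using fin by (simp add: card_Diff_subset_Int)
  moreover have "card (B - A) = card B - card ?X" using fin by (simp add: card_Diff_subset_Int Int_commute)
  ultimately have "card ?X * (t + 1) + (2 * t + 2) + 2 * ((card A - card ?X - 1) + (card B - card ?X - 1)) + t \<le> m"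
    using S by simp
  moreover have "k \<le> (card A - card ?X - 1) + card ?X + 1" "k \<le> (card B - card ?X - 1) + card ?X + 1"
    using cA cB False by linarith+
  ultimately have "card ?X * (t + 1) + 3 * t + 4 * k \<le> m + 2 + 4 * card ?X"
    unfolding add_mult_distrib2 by linarith
  then show ?thesis using False by auto
qed

section \<open>Routing a longest path through a component off it\<close>

context loopless
begin

lemma packs_fits:
  assumes "path V xs" "path V ys" "set xs \<inter> set ys = {}" "fits ls (length xs) (length ys)"
  shows "packs V ls"
  using assms packs_two_paths unfolding fits_def by metis

text \<open>Cutting \<open>xs\<close> in front of position \<open>a\<close> frees the first
  \<open>a\<close> vertices, while \<open>ys\<close> is put before the rest.\<close>

lemma window_left:
  assumes "path V xs" "path V ys" "set xs \<inter> set ys = {}" "a < length xs" "ys \<noteq> []" "adj (hd ys) (xs ! a)"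
    and "fits ls a (length xs - a + length ys)"
  shows "packs V ls"
proof -
  have h: "hd (drop a xs) = xs ! a" using assms(4) by (rule hd_drop_conv_nth)
  have td: "set (take a xs) \<inter> set (drop a xs) = {}"
    using path_distinct[OF assms(1)] by (metis append_take_drop_id distinct_append)
  have "set (rev ys) \<inter> set (drop a xs) = {}" using assms(3) set_drop_subset[of a xs] by auto
  then have "path V (rev ys @ drop a xs)"
    unfolding path_append path_rev last_rev h using assms(1,2,6) path_drop by blast
  moreover have "set (take a xs) \<inter> set (rev ys @ drop a xs) = {}"
    using td assms(3) by (auto dest: in_set_takeD)
  ultimately show ?thesis
    using packs_fits[OF path_take[OF assms(1), of a], of "rev ys @ drop a xs" ls] assms(4,7)
    by (simp add: add.commute min_def)
qed

lemma window_right: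
  assumes "path V xs" "path V ys" "set xs \<inter> set ys = {}" "a < length xs" "ys \<noteq> []" "adj (hd ys) (xs ! a)"
    and "fits ls (length xs - a - 1) (a + 1 + length ys)"
  shows "packs V ls"
proof -
  let ?b = "length xs - Suc a"
  have e: "rev xs ! ?b = xs ! a" using assms(4) by (simp add: rev_nth)
  have "length (rev xs) - ?b + length ys = a + 1 + length ys" "?b = length xs - a - 1" using assms(4) by auto
  then have f: "fits ls ?b (length (rev xs) - ?b + length ys)" using assms(7) by (simp only:)
  show ?thesis
  proof (rule window_left[OF _ assms(2) _ _ assms(5) _ f])
    show "path V (rev xs)" "set (rev xs) \<inter> set ys = {}" using assms(1,3) by (simp_all add: path_rev)
    show "?b < length (rev xs)" "adj (hd ys) (rev xs ! ?b)" using assms(4,6) e by simp_all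
  qed
qed

text \<open>Otherwise \<open>ys\<close> could replace the part of \<open>xs\<close> before, or
  behind, position \<open>a\<close> and give a longer path.\<close>

lemma longest_attach_bounds:
  assumes "longest V xs" "path V ys" "set xs \<inter> set ys = {}" "a < length xs" "ys \<noteq> []" "adj (hd ys) (xs ! a)"
  shows "length ys \<le> a" "a + length ys < length xs"
proof -
  have p: "path V xs" using assms(1) by (simp add: longest_def)
  have "path V (rev ys @ drop a xs)"
    using assms p path_drop by (auto simp: path_append path_rev last_rev hd_drop_conv_nth dest: in_set_dropD)
  then have "length (rev ys @ drop a xs) \<le> length xs" using assms(1) unfolding longest_def by blast
  then show "length ys \<le> a" using assms(4) by simp
  have "last (take (Suc a) xs) = xs ! a" using assms(4) by (simp add: take_Suc_conv_app_nth)
  then have "path V (take (Suc a) xs @ ys)"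
    using assms p path_take adj_sym by (auto simp: path_append dest: in_set_takeD)
  then have "length (take (Suc a) xs @ ys) \<le> length xs" using assms(1) unfolding longest_def by blast
  then show "a + length ys < length xs" using assms(4) by simp
qed

lemma longest_detour:
  assumes "longest V xs" "path V ys" "set xs \<inter> set ys = {}" "a < b" "b < length xs" "ys \<noteq> []"
    and "adj (hd ys) (xs ! a)" "adj (last ys) (xs ! b)"
  shows "a + length ys < b"
proof -
  have p: "path V xs" using assms(1) by (simp add: longest_def)
  have "last (take (Suc a) xs) = xs ! a" using assms(4,5) by (simp add: take_Suc_conv_app_nth)
  moreover have "hd (drop b xs) = xs ! b" using assms(5) by (rule hd_drop_conv_nth)
  moreover have "set (take (Suc a) xs) \<inter> set (drop b xs) = {}"
    using path_distinct[OF p] assms(4) by (intro set_take_disj_set_drop_if_distinct) auto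
  ultimately have "path V (take (Suc a) xs @ ys @ drop b xs)"
    using assms p path_take path_drop adj_sym by (auto simp: path_append dest: in_set_takeD in_set_dropD)
  then have "length (take (Suc a) xs @ ys @ drop b xs) \<le> length xs" using assms(1) unfolding longest_def by blast
  then show ?thesis using assms(4,5) by simp
qed

definition positions :: "'a list \<Rightarrow> 'a \<Rightarrow> nat set" where
  "positions xs y = {a. a < length xs \<and> adj y (xs ! a)}"

lemma finite_positions: "finite (positions xs y)"
  by (rule finite_subset[of _ "{..<length xs}"]) (auto simp: positions_def)

lemma card_positions:
  assumes "path V xs"
  shows "card (positions xs y) = card (nb (set xs) y)"
proof -
  have "nb (set xs) y = (!) xs ` positions xs y"
    by (auto simp: nb_def positions_def adj_sym in_set_conv_nth)
  moreover have "inj_on ((!) xs) (positions xs y)"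
    using path_distinct[OF assms] by (auto simp: inj_on_def positions_def nth_eq_iff_index_eq)
  ultimately show ?thesis by (simp add: card_image)
qed

lemma off_path_nb:
  assumes "comp (V - set xs) D" "y \<in> D"
  shows "nb V y \<subseteq> nb D y \<union> nb (set xs) y"
  using assms adj_sym unfolding comp_def nb_def by blast

lemma off_path_degree:
  assumes "finite V" "comp (V - set xs) D" "y \<in> D"
  shows "card (nb V y) \<le> card (nb D y) + card (nb (set xs) y)"
proof -
  have "finite D" using assms(1) comp_subset[OF assms(2)] by (meson finite_Diff finite_subset)
  then have "card (nb V y) \<le> card (nb D y \<union> nb (set xs) y)"
    using off_path_nb[OF assms(2,3)] by (intro card_mono) (auto simp: nb_def)
  then show ?thesis using card_Un_le le_trans by blast
qed

lemma longest_end_degree: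
  assumes "longest D ys" "ys \<noteq> []"
  shows "card (nb D (hd ys)) + 1 \<le> length ys"
proof -
  have "nb D (hd ys) \<subseteq> set ys - {hd ys}" using longest_hd_nb[OF assms] by (auto simp: nb_iff)
  then have "card (nb D (hd ys)) \<le> card (set ys - {hd ys})" by (intro card_mono) auto
  also have "\<dots> = length ys - 1"
    using assms path_distinct[of D ys] by (simp add: distinct_card longest_def)
  finally show ?thesis using assms(2) by (cases ys) auto
qed

text \<open>If every end of a longest path of \<open>D\<close> has few neighbours on \<open>xs\<close>, then \<open>D\<close> has a spanning cycle.\<close>

lemma comp_closes_up:
  assumes V: "finite V" "\<forall>v\<in>V. d \<le> card (nb V v)" and D: "comp (V - set xs) D"
    and lD: "longest D ys" and c: "\<And>zs. longest D zs \<Longrightarrow> card (nb (set xs) (hd zs)) \<le> c"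
    and t: "length ys + 2 * c \<le> 2 * d"
  shows "card D = length ys" "\<And>y. y \<in> D \<Longrightarrow> \<exists>zs. longest D zs \<and> hd zs = y"
proof -
  have cD: "conn D" using D by (rule comp_conn)
  have DV: "D \<subseteq> V" using comp_subset[OF D] by blast
  have ne: "ys \<noteq> []" using longest_nonempty[OF lD] comp_nonempty[OF D] by blast
  have p: "path D ys" using lD by (simp add: longest_def)
  have deg: "d \<le> card (nb D (hd zs)) + c" if zs: "longest D zs" for zs
  proof -
    have "zs \<noteq> []" using longest_nonempty[OF zs] comp_nonempty[OF D] by blast
    then have h: "hd zs \<in> D" using zs by (meson hd_in_set longest_def path_set subsetD)
    then have "d \<le> card (nb V (hd zs))" using V(2) DV by blast
    also have "\<dots> \<le> card (nb D (hd zs)) + card (nb (set xs) (hd zs))" using off_path_degree[OF V(1) D h] .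
    finally show ?thesis using c[OF zs] by linarith
  qed
  \<comment> \<open>Each end keeps at least \<open>d - c\<close> neighbours inside \<open>D\<close>,
    and \<open>t\<close> makes this enough for crossing chords. The resulting cycle spans
    \<open>D\<close>, so every vertex of \<open>D\<close> starts a longest path.\<close>
  have "length ys \<le> card (nb D (hd ys)) + card (nb D (last ys))"
    using deg[OF lD] deg[of "rev ys"] lD ne t by (simp add: longest_rev hd_rev)
  then obtain zs where zs: "path D zs" "set zs = set ys" "length zs = length ys" "adj (last zs) (hd zs)"
    using path_crossing_degree[OF p ne] longest_hd_nb[OF lD ne] longest_last_nb[OF lD ne] by metis
  have lz: "longest D zs" using zs lD by (simp add: longest_def)
  have sD: "set zs = D" using longest_cycle_spanning[OF cD lz zs(4)] .
  then show "card D = length ys" using zs path_distinct distinct_card by metis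
  fix y assume "y \<in> D"
  then obtain i where i: "i < length zs" "y = zs ! i" using sD by (metis in_set_conv_nth)
  have "path D (rotate i zs)" using path_rotate zs by blast
  then have "longest D (rotate i zs)" using lz by (simp add: longest_def)
  moreover have "hd (rotate i zs) = y" using i by (subst hd_rotate_conv_nth) auto
  ultimately show "\<exists>zs. longest D zs \<and> hd zs = y" by blast
qed

end

subsection \<open>Splitting a list of path lengths\<close>

lemma sum_list_halves: "sum_list ls = 2 * (\<Sum>l\<leftarrow>ls. l div 2) + (\<Sum>l\<leftarrow>ls. l mod 2 :: nat)"
  by (induction ls) auto

text \<open>Without 3 an odd length is at least 5 and contributes two halves.\<close>

lemma odd_count_le:
  "\<forall>l\<in>set ls. 2 \<le> l \<and> l \<noteq> (3::nat) \<Longrightarrow> 2 * (\<Sum>l\<leftarrow>ls. l mod 2) \<le> (\<Sum>l\<leftarrow>ls. l div 2)"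
proof (induction ls)
  case (Cons l ls)
  have "2 \<le> l" "l \<noteq> 3" using Cons.prems by auto
  then have "2 * (l mod 2) \<le> l div 2" by presburger
  then show ?case using Cons by simp
qed simp

lemma odd_count_sum_le:
  "\<forall>l\<in>set ls. 2 \<le> l \<and> l \<noteq> (3::nat) \<Longrightarrow> 5 * (\<Sum>l\<leftarrow>ls. l mod 2) \<le> sum_list ls"
proof (induction ls)
  case (Cons l ls)
  have "2 \<le> l" "l \<noteq> 3" using Cons.prems by auto
  then have "5 * (l mod 2) \<le> l" by presburger
  then show ?case using Cons by simp
qed simp

lemma prefix_sum_crossing:
  fixes ks :: "nat list"
  assumes "1 \<le> K" "K \<le> sum_list ks"
  shows "\<exists>us y vs. ks = us @ y # vs \<and> sum_list us < K \<and> K \<le> sum_list us + y"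
  using assms
proof (induction ks arbitrary: K)
  case (Cons x ks)
  show ?case
  proof (cases "K \<le> x")
    case True
    then show ?thesis using Cons.prems by (intro exI[of _ "[]"] exI[of _ x] exI[of _ ks]) simp
  next
    case False
    then have "1 \<le> K - x" "K - x \<le> sum_list ks" using Cons.prems by auto
    then obtain us y vs where "ks = us @ y # vs" "sum_list us < K - x" "K - x \<le> sum_list us + y"
      using Cons.IH by blast
    then show ?thesis using False by (intro exI[of _ "x # us"] exI[of _ y] exI[of _ vs]) auto
  qed
qed simp

lemma fits_single:
  assumes "x \<in> set ls" "x \<le> n" "sum_list ls \<le> m + x"
  shows "fits ls m n"
proof -
  obtain us vs where "ls = us @ x # vs" using assms(1) by (meson split_list)
  then show ?thesis unfolding fits_def using assms by (intro exI[of _ "us @ vs"] exI[of _ "[x]"]) auto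
qed

lemma fits_pair: "(x \<le> m \<and> y \<le> n) \<or> (y \<le> m \<and> x \<le> n) \<Longrightarrow> fits [x, y] m n"
proof (elim disjE)
  assume "x \<le> m \<and> y \<le> n"
  then show ?thesis unfolding fits_def by (intro exI[of _ "[x]"] exI[of _ "[y]"]) simp
next
  assume "y \<le> m \<and> x \<le> n"
  then show ?thesis unfolding fits_def by (intro exI[of _ "[y]"] exI[of _ "[x]"]) simp
qed

lemma fits_triple: "(x \<le> m \<and> 2 * x \<le> n) \<or> (2 * x \<le> m \<and> x \<le> n) \<Longrightarrow> fits [x, x, x] m n"
proof (elim disjE)
  assume "x \<le> m \<and> 2 * x \<le> n"
  then show ?thesis unfolding fits_def by (intro exI[of _ "[x]"] exI[of _ "[x, x]"]) simp
next
  assume "2 * x \<le> m \<and> x \<le> n"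
  then show ?thesis unfolding fits_def by (intro exI[of _ "[x, x]"] exI[of _ "[x]"]) simp
qed

text \<open>Here \<open>h\<close> will be \<open>d + 1\<close>, and \<open>q\<close> counts the odd
  lengths; it is the excess of |F| over \<open>2 * h\<close>.\<close>

locale forest =
  fixes ls :: "nat list" and l1 l2 :: nat and rs :: "nat list" and h q :: nat
  assumes ls: "ls = l1 # l2 # rs" and l21: "l2 \<le> l1" and rs: "\<forall>r\<in>set rs. r \<le> l2"
    and ge: "\<forall>l\<in>set ls. 2 \<le> l \<and> l \<noteq> 3"
    and h_def: "h = (\<Sum>l\<leftarrow>ls. l div 2)" and q_def: "q = (\<Sum>l\<leftarrow>ls. l mod 2)"
begin

lemma sum_ls: "sum_list ls = 2 * h + q"
  unfolding h_def q_def by (rule sum_list_halves)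

lemma q_le: "2 * q \<le> h"
  unfolding h_def q_def using ge by (rule odd_count_le)

lemma h_eq: "h = l1 div 2 + l2 div 2 + (\<Sum>l\<leftarrow>rs. l div 2)"
  by (simp add: h_def ls)

lemma l_ge: "2 \<le> l1" "2 \<le> l2" "l1 \<noteq> 3" "l2 \<noteq> 3"
  using ge ls by auto

lemma h_ge: "2 \<le> h"
proof -
  have "1 \<le> l1 div 2" "1 \<le> l2 div 2" using l_ge(1,2) by linarith+
  then show ?thesis using h_eq by linarith
qed

lemma admissible_ls: "admissible ls"
  using ge by (simp add: admissible_def ls)

lemma rest_sum: "5 * q \<le> sum_list (l2 # rs) + 5"
proof -
  have "5 * (\<Sum>l\<leftarrow>l2 # rs. l mod 2) \<le> sum_list (l2 # rs)" using ge ls by (intro odd_count_sum_le) auto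
  moreover have "q = l1 mod 2 + (\<Sum>l\<leftarrow>l2 # rs. l mod 2)" by (simp add: q_def ls)
  ultimately show ?thesis by linarith
qed

lemma crossing:
  assumes "l2 < K" "1 \<le> K" "K \<le> sum_list (l2 # rs)"
  obtains us y vs where "l2 # rs = us @ y # vs" "sum_list us < K" "K \<le> sum_list us + y" "y \<le> l2"
proof -
  obtain us y vs where e: "l2 # rs = us @ y # vs" "sum_list us < K" "K \<le> sum_list us + y"
    using prefix_sum_crossing assms(2,3) by metis
  have "y \<in> set (l2 # rs)" unfolding e(1) by simp
  then have "y \<le> l2" using rs by auto
  then show thesis using that e by blast
qed

text \<open>If \<open>l2\<close> exceeded \<open>h\<close>, then already l1 div 2 + l2 div 2 \<le> h
  < l2 \<le> l1, which forces two equal odd lengths and no further path.\<close>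

lemma l2_cases:
  assumes "\<not> (rs = [] \<and> l1 = l2 \<and> odd l1)"
  shows "l2 \<le> h"
proof (rule ccontr)
  assume n: "\<not> l2 \<le> h"
  then have a: "l1 div 2 + l2 div 2 \<le> h" "h < l2" "l2 \<le> l1" using h_eq l21 by linarith+
  have "2 * (l1 div 2) + l1 mod 2 = l1" "2 * (l2 div 2) + l2 mod 2 = l2" "l1 mod 2 < 2" "l2 mod 2 < 2" by auto
  then have b: "h = l1 div 2 + l2 div 2" "l1 = l2" "l1 mod 2 = 1" using a by linarith+
  then have eq: "h = l1 div 2 + l2 div 2" "l1 = l2" "odd l1" by (simp_all add: odd_iff_mod_2_eq_one)
  then have "(\<Sum>l\<leftarrow>rs. l div 2) = 0" using h_eq by linarith
  then have "rs = []" using ge ls by (cases rs) auto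
  then show False using assms eq by blast
qed

text \<open>The short path must absorb \<open>q + 1\<close> vertices. If \<open>l2\<close> is not
  enough, then \<open>l2 \<le> q\<close>, and lengths are collected from \<open>l2 # rs\<close>
  until their sum reaches \<open>q + 1\<close>; the sum overshoots to at most
  \<open>2 * q \<le> h\<close>.\<close>

lemma fits_half:
  assumes "\<not> (rs = [] \<and> l1 = l2 \<and> odd l1)"
  shows "fits ls (2 * h - 1) h"
proof (cases "q < l2")
  case True
  then show ?thesis using l2_cases[OF assms] sum_ls h_ge ls by (intro fits_single[of l2]) auto
next
  case False
  then have "q + 1 \<le> sum_list (l2 # rs)" using rest_sum l_ge by linarith
  then obtain us y vs where e: "l2 # rs = us @ y # vs" "sum_list us < q + 1" "q + 1 \<le> sum_list us + y" "y \<le> l2"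
    using crossing[of "q + 1"] False by auto
  have "sum_list (us @ [y]) \<le> h" using e False q_le by simp
  moreover have "sum_list (l1 # vs) \<le> 2 * h - 1"
  proof -
    have "sum_list ls = l1 + sum_list (us @ y # vs)" using e(1) ls by simp
    then show ?thesis using sum_ls e(3) by simp
  qed
  moreover have "mset ls = mset (l1 # vs) + mset (us @ [y])" using e(1) ls by simp
  ultimately show ?thesis unfolding fits_def by blast
qed

text \<open>As in \<open>fits_half\<close>, with only \<open>q - 1\<close> vertices to be
  absorbed.\<close>

lemma fits_more:
  assumes "l2 < h"
  shows "fits ls (2 * h + 1) (h - 1)"
proof (cases "q \<le> l2 + 1")
  case True
  then show ?thesis using assms sum_ls ls by (intro fits_single[of l2]) auto
next
  case False
  then have "q - 1 \<le> sum_list (l2 # rs)" "1 \<le> q - 1" using rest_sum by linarith+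
  then obtain us y vs where e: "l2 # rs = us @ y # vs" "sum_list us < q - 1" "q - 1 \<le> sum_list us + y" "y \<le> l2"
    using crossing[of "q - 1"] False by (metis less_diff_conv not_le)
  have "sum_list (us @ [y]) \<le> h - 1" using e False q_le by simp
  moreover have "sum_list (l1 # vs) \<le> 2 * h + 1"
  proof -
    have "sum_list ls = l1 + sum_list (us @ y # vs)" using e(1) ls by simp
    then show ?thesis using sum_ls e(3) by simp
  qed
  moreover have "mset ls = mset (l1 # vs) + mset (us @ [y])" using e(1) ls by simp
  ultimately show ?thesis unfolding fits_def by blast
qed

text \<open>The collection of \<open>fits_half\<close> is split before its last entry, so that
  neither part exceeds \<open>h - 1\<close>.\<close>

lemma fits_three:
  assumes "l2 < h"
  obtains ks us ys where "mset ls = mset ks + mset us + mset ys"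
    "sum_list ks \<le> 2 * h - 1" "sum_list us \<le> h - 1" "sum_list ys \<le> h - 1"
proof (cases "q < l2")
  case True
  have "sum_list ls = l1 + l2 + sum_list rs" using ls by simp
  then have "sum_list (l1 # rs) \<le> 2 * h - 1" using sum_ls True by simp
  then show thesis using that[of "l1 # rs" "[l2]" "[]"] assms ls by simp
next
  case False
  then have "q + 1 \<le> sum_list (l2 # rs)" using rest_sum l_ge by linarith
  then obtain us y vs where e: "l2 # rs = us @ y # vs" "sum_list us < q + 1" "q + 1 \<le> sum_list us + y" "y \<le> l2"
    using crossing[of "q + 1"] False by auto
  have "sum_list ls = l1 + sum_list (us @ y # vs)" using e(1) ls by simp
  then have "sum_list (l1 # vs) \<le> 2 * h - 1" using sum_ls e(3) by simp
  moreover have "mset ls = mset (l1 # vs) + mset us + mset [y]" using e(1) ls by simp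
  moreover have "sum_list us \<le> h - 1" "sum_list [y] \<le> h - 1" using e False q_le h_ge l_ge by auto
  ultimately show thesis using that by blast
qed

text \<open>The lower bound on \<open>m\<close> is nearly quadratic, whereas |F| = 2h + q \<le>
  5h/2, so only a few small forests survive; these are listed.\<close>

lemma small_cases:
  assumes t: "2 \<le> t" "t + 2 \<le> h" and m: "(h - t) * (t + 1) + t \<le> m" "m < sum_list ls" and nf: "\<not> fits ls m t"
  shows "(ls = [5, 4] \<and> t = 2 \<and> m = 8) \<or> (ls = [7, 5] \<and> (t = 2 \<or> t = 3) \<and> m = 11) \<or>
    (ls = [5, 5, 5] \<and> (t = 2 \<or> t = 4) \<and> m = 14) \<or> (ls = [5, 5] \<and> t = 2 \<and> 8 \<le> m)"
proof -
  obtain \<alpha> where \<alpha>: "t = 2 + \<alpha>" using t(1) le_Suc_ex by blast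
  obtain \<beta> where \<beta>: "h = t + 2 + \<beta>" using t(2) le_Suc_ex by blast
  \<comment> \<open>In \<open>\<alpha> + \<beta>\<close> the lower bound on \<open>m\<close> grows
    at rate at least 3, the upper bound at rate at most 5/2.\<close>
  have "(h - t) * (t + 1) + t = 8 + 3 * \<alpha> + 3 * \<beta> + \<alpha> * \<beta>" using \<alpha> \<beta> by (simp add: algebra_simps)
  then have m1: "8 + 3 * \<alpha> + 3 * \<beta> + \<alpha> * \<beta> \<le> m" using m(1) by simp
  have m2: "m + 1 \<le> 8 + 2 * \<alpha> + 2 * \<beta> + q" using m(2) sum_ls \<alpha> \<beta> by simp
  have q2: "2 * q \<le> 4 + \<alpha> + \<beta>" using q_le \<alpha> \<beta> by simp
  have ab: "\<alpha> + \<beta> + 2 * (\<alpha> * \<beta>) \<le> 2" using m1 m2 q2 by linarith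
  have "\<alpha> * \<beta> = 0"
  proof (rule ccontr)
    assume "\<alpha> * \<beta> \<noteq> 0"
    then have "1 \<le> \<alpha>" "1 \<le> \<beta>" "1 \<le> \<alpha> * \<beta>" by (auto simp: Suc_leI)
    then show False using ab by linarith
  qed
  then have ab2: "\<alpha> + \<beta> \<le> 2" "\<alpha> = 0 \<or> \<beta> = 0" using ab by auto
  \<comment> \<open>A length \<open>x \<le> t\<close> could go to the piece on \<open>t\<close>
    vertices while the other lengths fit on \<open>m\<close>; so every length exceeds
    \<open>t \<ge> 2\<close>, and 3 is excluded.\<close>
  have big: "4 \<le> x" if x: "x \<in> set ls" for x
  proof -
    have x2: "2 \<le> x" "x \<noteq> 3" using ge x by auto
    have "sum_list ls \<le> m + x"
    proof (cases "\<alpha> + \<beta> = 0")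
      case True
      then have "q \<le> 2" "8 \<le> m" "h = 4" using m1 q2 \<alpha> \<beta> by auto
      then show ?thesis using sum_ls x2 by linarith
    next
      case False
      have "2 * q \<le> 4 + (\<alpha> + \<beta>)" "8 + 3 * (\<alpha> + \<beta>) \<le> m" "h = 4 + (\<alpha> + \<beta>)" using q2 m1 \<alpha> \<beta> by auto
      moreover have "q \<le> 1 + (\<alpha> + \<beta>)" using calculation(1) ab2(1) False by linarith
      ultimately show ?thesis using sum_ls x2(1) by simp
    qed
    then have "t < x" using fits_single[OF x, of t m] nf not_le by blast
    then show ?thesis using t x2 by linarith
  qed
  have L: "4 \<le> l1" "4 \<le> l2" "\<forall>r\<in>set rs. 4 \<le> r" using big ls by auto
  have hh: "h = 4 + (\<alpha> + \<beta>)" using \<alpha> \<beta> by simp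
  have qq: "1 + (\<alpha> + \<beta>) \<le> q" using m1 m2 by linarith
  show ?thesis
  proof (cases rs)
    case Nil
    then have h2: "h = l1 div 2 + l2 div 2" "q = l1 mod 2 + l2 mod 2" using h_eq by (auto simp: q_def ls)
    have "q \<le> 2" using h2 by (simp add: add_mono)
    then have "\<alpha> + \<beta> \<le> 1" using qq by linarith
    then consider "\<alpha> + \<beta> = 0" | "\<alpha> + \<beta> = 1" by linarith
    then show ?thesis
    proof cases
      case 1
      then have "l1 div 2 = 2" "l2 div 2 = 2" using h2 hh L by linarith+
      then have "l1 \<in> {4, 5}" "l2 \<in> {4, 5}" by auto
      then show ?thesis using h2 qq l21 Nil ls 1 \<alpha> m1 m2 by auto
    next
      case 2
      then have "q = 2" using qq \<open>q \<le> 2\<close> by linarith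
      then have "odd l1" "odd l2" using h2 by presburger+
      moreover have "l1 div 2 = 3" "l2 div 2 = 2" using h2 hh L l21 2 by linarith+
      ultimately have "l1 = 7" "l2 = 5" by presburger+
      moreover have "m = 11" using m1 m2 2 \<open>q = 2\<close> \<open>\<alpha> * \<beta> = 0\<close> by linarith
      moreover have "t = 2 \<or> t = 3" using \<alpha> 2 by linarith
      ultimately show ?thesis using Nil ls by auto
    qed
  next
    case (Cons r rs')
    have "(\<Sum>l\<leftarrow>rs'. l div 2) = 0"
    proof -
      have "h = l1 div 2 + l2 div 2 + r div 2 + (\<Sum>l\<leftarrow>rs'. l div 2)" using h_eq Cons by simp
      moreover have "4 \<le> r" using L Cons by auto
      then have "2 \<le> r div 2" "2 \<le> l1 div 2" "2 \<le> l2 div 2" using L(1,2) by linarith+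
      ultimately have "6 + (\<Sum>l\<leftarrow>rs'. l div 2) \<le> h" by linarith
      then show ?thesis using hh ab2 by linarith
    qed
    then have "rs' = []" using L Cons by (cases rs') auto
    then have hq: "h = l1 div 2 + l2 div 2 + r div 2" "q = l1 mod 2 + l2 mod 2 + r mod 2" "4 \<le> r"
      using h_eq Cons L by (auto simp: q_def ls)
    moreover have "2 \<le> r div 2" "2 \<le> l1 div 2" "2 \<le> l2 div 2" using L(1,2) hq(3) by linarith+
    ultimately have "\<alpha> + \<beta> = 2" "l1 div 2 = 2" "l2 div 2 = 2" "r div 2 = 2" using hh ab2(1) by linarith+
    moreover have "q = 3" using q2 qq \<open>\<alpha> + \<beta> = 2\<close> by linarith
    ultimately have "l1 = 5" "l2 = 5" "r = 5" using hq by presburger+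
    moreover have "m = 14" using m1 m2 \<open>\<alpha> + \<beta> = 2\<close> \<open>q = 3\<close> \<open>\<alpha> * \<beta> = 0\<close> by linarith
    moreover have "t = 2 \<or> t = 4" using \<alpha> ab2 \<open>\<alpha> + \<beta> = 2\<close> by auto
    ultimately show ?thesis using ls Cons \<open>rs' = []\<close> by auto
  qed
qed

end

context loopless
begin

subsection \<open>The shape of large components off a longest path\<close>

definition host :: "'a set \<Rightarrow> 'a list \<Rightarrow> nat \<Rightarrow> nat list \<Rightarrow> bool" where
  "host V xs d ls \<longleftrightarrow> finite V \<and> conn V \<and> (\<forall>v\<in>V. d \<le> card (nb V v)) \<and> longest V xs \<and> \<not> packs V ls \<and>
     2 * d + 1 \<le> length xs"

lemma host_length: "host V xs d ls \<Longrightarrow> length xs < sum_list ls"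
  using packs_path[of V xs ls] packs_mono[of "set xs" ls V] path_set[of V xs]
  by (fastforce simp: host_def longest_def not_less)

text \<open>For the first bound, the neighbours of \<open>hd ys\<close> in \<open>D\<close> all lie
  on the longest path \<open>ys\<close>, so at most \<open>length ys - 1\<close> neighbours are off
  \<open>xs\<close>. The rest collects what maximality of \<open>xs\<close> and the absence of F
  forbid at an attachment.\<close>

lemma off_path_end:
  assumes H: "host V xs d ls" and D: "comp (V - set xs) D" and ys: "longest D ys"
  shows "Suc d \<le> card (positions xs (hd ys)) + length ys"
    and "\<And>a. a \<in> positions xs (hd ys) \<Longrightarrow> length ys \<le> a \<and> a + length ys < length xs"
    and "\<And>a. a \<in> positions xs (hd ys) \<Longrightarrow> Suc a \<notin> positions xs (hd ys)"
    and "\<not> fits ls (length xs) (length ys)"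
    and "\<And>a. a \<in> positions xs (hd ys) \<Longrightarrow> \<not> fits ls a (length xs - a + length ys)"
    and "\<And>a. a \<in> positions xs (hd ys) \<Longrightarrow> \<not> fits ls (length xs - a - 1) (a + 1 + length ys)"
    and "\<And>a b. a \<in> positions xs (hd ys) \<Longrightarrow> b \<in> positions xs (last ys) \<Longrightarrow> a < b \<Longrightarrow> a + length ys < b"
proof -
  have V: "finite V" "\<forall>v\<in>V. d \<le> card (nb V v)" and lx: "longest V xs" and np: "\<not> packs V ls"
    using H by (auto simp: host_def)
  have px: "path V xs" using lx by (simp add: longest_def)
  have ne: "ys \<noteq> []" using longest_nonempty[OF ys] comp_nonempty[OF D] by blast
  have DV: "D \<subseteq> V - set xs" using comp_subset[OF D] .
  have pD: "path D ys" using ys by (simp add: longest_def)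
  then have py: "path V ys" using DV path_mono by blast
  have dj: "set xs \<inter> set ys = {}" using path_set[OF pD] DV by blast
  have hD: "hd ys \<in> D" using path_set[OF pD] ne by auto
  have "d \<le> card (nb V (hd ys))" using V(2) hD DV by blast
  then show "Suc d \<le> card (positions xs (hd ys)) + length ys"
    using off_path_degree[OF V(1) D hD] longest_end_degree[OF ys ne] card_positions[OF px, of "hd ys"] by linarith
  show "\<not> fits ls (length xs) (length ys)" using packs_fits[OF px py dj] np by blast
  {
    fix a assume a: "a \<in> positions xs (hd ys)"
    then have a': "a < length xs" "adj (hd ys) (xs ! a)" by (auto simp: positions_def)
    show "length ys \<le> a \<and> a + length ys < length xs"
      using longest_attach_bounds[OF lx py dj a'(1) ne a'(2)] by simp
    show "Suc a \<notin> positions xs (hd ys)"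
    proof
      assume b: "Suc a \<in> positions xs (hd ys)"
      have "hd ys \<in> V - set xs" using hD DV by blast
      then show False using longest_insert[OF lx, of a "hd ys"] a' b adj_sym by (auto simp: positions_def)
    qed
    show "\<not> fits ls a (length xs - a + length ys)" using window_left[OF px py dj a'(1) ne a'(2)] np by blast
    show "\<not> fits ls (length xs - a - 1) (a + 1 + length ys)" using window_right[OF px py dj a'(1) ne a'(2)] np by blast
    show "a + length ys < b" if "b \<in> positions xs (last ys)" "a < b" for b
      using longest_detour[OF lx py dj that(2) _ ne a'(2)] that by (auto simp: positions_def)
  }
qed

text \<open>Both ends of \<open>ys\<close> have at least \<open>?k\<close> neighbours on
  \<open>xs\<close>. If they have \<open>?k\<close> in common, the gaps of more than
  \<open>length ys\<close> between these give the bound; having fewer in common makes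
  \<open>xs\<close> even longer.\<close>

lemma off_path_long:
  assumes H: "host V xs d ls" and D: "comp (V - set xs) D" and ys: "longest D ys"
    and t: "2 \<le> length ys" "length ys \<le> d" and q: "sum_list ls = 2 * Suc d + q" "2 * q \<le> Suc d"
  shows "(Suc d - length ys) * (length ys + 1) + length ys \<le> length xs"
proof -
  let ?t = "length ys" and ?m = "length xs" and ?k = "Suc d - length ys"
  let ?A = "positions xs (hd ys)" and ?B = "positions xs (last ys)"
  have ne: "ys \<noteq> []" using t(1) by auto
  have ys': "longest D (rev ys)" using ys by (simp add: longest_rev)
  note e = off_path_end[OF H D ys]
  note e' = off_path_end[OF H D ys', unfolded hd_rev last_rev length_rev]
  have m: "?m < sum_list ls" using host_length[OF H] .
  have "(?k \<le> card (?A \<inter> ?B) \<and> ?k * (?t + 1) + ?t \<le> ?m) \<or>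
     (card (?A \<inter> ?B) < ?k \<and> card (?A \<inter> ?B) * (?t + 1) + 3 * ?t + 4 * ?k \<le> ?m + 2 + 4 * card (?A \<inter> ?B))"
  proof (rule attachment_positions)
    show "finite ?A" "finite ?B" by (rule finite_positions)+
    show "1 \<le> ?t" "1 \<le> ?k" using t by auto
    show "?t \<le> c \<and> c + ?t < ?m" if "c \<in> ?A \<union> ?B" for c using e(2) e'(2) that by blast
    show "Suc c \<notin> ?A" if "c \<in> ?A" for c using e(3) that by blast
    show "Suc c \<notin> ?B" if "c \<in> ?B" for c using e'(3) that by blast
    show "a + ?t < b \<or> b + ?t < a" if "a \<in> ?A" "b \<in> ?B" "a \<noteq> b" for a b
      using e(7)[of a b] e'(7)[of b a] that by linarith
    show "?k \<le> card ?A" "?k \<le> card ?B" using e(1) e'(1) by linarith+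
  qed
  then show ?thesis
  proof (elim disjE conjE)
    let ?x = "card (?A \<inter> ?B)"
    assume x: "?x < ?k" "?x * (?t + 1) + 3 * ?t + 4 * ?k \<le> ?m + 2 + 4 * ?x"
    show ?thesis
    \<comment> \<open>For \<open>?t = 2\<close> the second alternative yields at least
      \<open>3 * d + 2\<close> vertices. For larger \<open>?t\<close> it would do so as well, but
      this contradicts \<open>length xs < sum_list ls\<close>; the shorter derivation by
      contradiction suffices.\<close>
    proof (cases "?t = 2")
      case True
      then show ?thesis using x m q by simp
    next
      case False
      then have "?x * 4 \<le> ?x * (?t + 1)" using t(1) by (intro mult_le_mono2) linarith
      then have "3 * ?t + 4 * ?k \<le> ?m + 2" using x(2) by linarith
      moreover obtain e where "d = ?t + e" using t(2) le_Suc_ex by blast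
      ultimately have False using m q by simp
      then show ?thesis ..
    qed
  qed
qed

text \<open>\<open>t\<close> is both the order of \<open>D\<close> and the length of the paths, so
  \<open>D\<close> has a Hamiltonian path from each of its vertices.\<close>

definition attached :: "'a set \<Rightarrow> 'a set \<Rightarrow> 'a set \<Rightarrow> nat \<Rightarrow> bool" where
  "attached V D Z t \<longleftrightarrow> card D = t \<and> (\<forall>y\<in>D. nb V y \<subseteq> D \<union> Z \<and> (\<exists>ys. path D ys \<and> length ys = t \<and> hd ys = y))"

lemma attached_positionsI:
  assumes D: "comp (V - set xs) D" and ys: "longest D ys"
    and cu: "card D = length ys" "\<And>y. y \<in> D \<Longrightarrow> \<exists>zs. longest D zs \<and> hd zs = y"
    and I: "\<And>y. y \<in> D \<Longrightarrow> positions xs y \<subseteq> I"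
  shows "attached V D ((!) xs ` I) (length ys)"
proof -
  have "nb V y \<subseteq> D \<union> (!) xs ` I \<and> (\<exists>ys'. path D ys' \<and> length ys' = length ys \<and> hd ys' = y)" if y: "y \<in> D" for y
  proof
    obtain zs where zs: "longest D zs" "hd zs = y" using cu(2)[OF y] by blast
    show "nb V y \<subseteq> D \<union> (!) xs ` I"
    proof
      fix u assume "u \<in> nb V y"
      then consider "u \<in> D" | "u \<in> set xs" "adj u y" using off_path_nb[OF D y] by (auto simp: nb_iff)
      then show "u \<in> D \<union> (!) xs ` I"
      proof cases
        case 2
        then obtain a where a: "a < length xs" "u = xs ! a" by (metis in_set_conv_nth)
        then have "a \<in> positions xs y" using 2 adj_sym by (auto simp: positions_def)
        then show ?thesis using I[OF y] a by auto
      qed simp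
    qed
    have "length zs = length ys" using zs ys by (meson le_antisym longest_def)
    then show "\<exists>ys'. path D ys' \<and> length ys' = length ys \<and> hd ys' = y" using zs by (auto simp: longest_def)
  qed
  then show ?thesis using cu(1) by (auto simp: attached_def)
qed

lemma attachedI:
  assumes H: "host V xs d ls" and D: "comp (V - set xs) D" and ys: "longest D ys"
    and I: "\<And>zs. longest D zs \<Longrightarrow> positions xs (hd zs) \<subseteq> I" "finite I" "length ys + 2 * card I \<le> 2 * d"
  shows "attached V D ((!) xs ` I) (length ys)"
proof -
  have V: "finite V" "\<forall>v\<in>V. d \<le> card (nb V v)" and px: "path V xs"
    using H by (auto simp: host_def longest_def)
  have c: "card (nb (set xs) (hd zs)) \<le> card I" if "longest D zs" for zs
    using card_mono[OF I(2) I(1)[OF that]] card_positions[OF px] by simp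
  have cu1: "card D = length ys" by (rule comp_closes_up(1)[OF V D ys _ I(3)]) (rule c)
  have cu2: "\<exists>zs. longest D zs \<and> hd zs = y" if "y \<in> D" for y
    by (rule comp_closes_up(2)[OF V D ys _ I(3) that]) (rule c)
  show ?thesis using attached_positionsI[OF D ys cu1 cu2] I(1) cu2 by metis
qed

lemma longest_ge_2:
  assumes "finite V" "comp V D" "2 \<le> card D" "longest D ys"
  shows "2 \<le> length ys"
proof -
  obtain x where x: "x \<in> D" using comp_nonempty[OF assms(2)] by blast
  have "{x} \<noteq> D" using assms(3) by auto
  then obtain y where "y \<in> D - {x}" "adj x y"
    using comp_conn[OF assms(2)] x unfolding conn_def by (metis empty_not_insert insert_subset empty_subsetI singletonD)
  then have "path D [x, y]" using x by (auto simp: path_Cons)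
  then have "length [x, y] \<le> length ys" using assms(4) unfolding longest_def by blast
  then show ?thesis by simp
qed

text \<open>A longest path of \<open>D\<close> on fewer than \<open>d\<close> vertices falls under
  \<open>small_cases\<close>, and cutting \<open>xs\<close> at an attachment refutes all of these
  except three paths on five vertices. On \<open>d\<close> vertices, the outcome depends on whether
  \<open>l2\<close> is below its maximum \<open>d + 1\<close>.\<close>

lemma nonsingle_shape:
  assumes H: "host V xs d ls" and f: "forest ls l1 l2 rs (Suc d) q" and ns: "\<not> (rs = [] \<and> l1 = l2 \<and> odd l1)"
    and D: "comp (V - set xs) D" "2 \<le> card D"
  shows "(l2 < Suc d \<and> ls \<noteq> [5, 5, 5] \<and> card D = d \<and> (\<exists>ys. path D ys \<and> length ys = d)) \<or>
    (l2 = Suc d \<and> attached V D {xs ! d} d \<and> length xs = 2 * d + 1) \<or>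
    (ls = [5, 5, 5] \<and> attached V D {xs ! 4, xs ! 9} 4)"
proof -
  interpret forest ls l1 l2 rs "Suc d" q by (rule f)
  have V: "finite V" "2 * d + 1 \<le> length xs" and px: "path V xs" using H by (auto simp: host_def longest_def)
  have fD: "finite D" using comp_subset[OF D(1)] V(1) by (meson finite_Diff finite_subset)
  obtain ys where ys: "longest D ys" using longest_exists[OF fD] by blast
  let ?t = "length ys" and ?m = "length xs"
  have t2: "2 \<le> ?t" using longest_ge_2[OF _ D ys] V(1) by simp
  note e = off_path_end[OF H D(1) ys]
  have m: "?m < sum_list ls" using host_length[OF H] .
  have td: "?t \<le> d"
  proof (rule ccontr)
    assume "\<not> ?t \<le> d"
    then have "fits ls ?m ?t" using fits_mono[OF fits_half[OF ns], of ?m ?t] V(2) by simp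
    then show False using e(4) by blast
  qed
  have len: "length zs = ?t" if "longest D zs" for zs using that ys by (meson le_antisym longest_def)
  have ne: "positions xs (hd ys) \<noteq> {}" using e(1) td by auto
  have long: "(Suc d - ?t) * (?t + 1) + ?t \<le> ?m" using off_path_long[OF H D(1) ys t2 td sum_ls q_le] .
  show ?thesis
  proof (cases "?t = d")
    case False
    then have "?t + 2 \<le> Suc d" using td by linarith
    then have "(ls = [5, 4] \<and> ?t = 2 \<and> ?m = 8) \<or> (ls = [7, 5] \<and> (?t = 2 \<or> ?t = 3) \<and> ?m = 11) \<or>
      (ls = [5, 5, 5] \<and> (?t = 2 \<or> ?t = 4) \<and> ?m = 14) \<or> (ls = [5, 5] \<and> ?t = 2 \<and> 8 \<le> ?m)"
      using small_cases[OF t2 _ long m e(4)] by blast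
    then consider "ls = [5, 4]" "?t = 2" "?m = 8" | "ls = [7, 5]" "?t = 2 \<or> ?t = 3" "?m = 11"
      | "ls = [5, 5, 5]" "?t = 2" "?m = 14" | "ls = [5, 5, 5]" "?t = 4" "?m = 14"
      using ns ls by auto
    then show ?thesis
    proof cases
      case 1
      obtain a where a: "a \<in> positions xs (hd ys)" using ne by blast
      have "2 \<le> a" "a < 6" using e(2)[OF a] 1 by auto
      then have "fits [5, 4] a (8 - a + 2) \<or> fits [5, 4] (8 - a - 1) (a + 1 + 2)"
        using fits_pair[of 5 a 4 "8 - a + 2"] fits_pair[of 5 "8 - a - 1" 4 "a + 1 + 2"] by linarith
      then show ?thesis using e(5)[OF a] e(6)[OF a] 1 by simp
    next
      case 2
      obtain a where a: "a \<in> positions xs (hd ys)" using ne by blast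
      have "?t \<le> a" "a + ?t < 11" using e(2)[OF a] 2 by auto
      then have "fits [7, 5] a (11 - a + ?t) \<or> fits [7, 5] (11 - a - 1) (a + 1 + ?t)"
        using fits_pair[of 7 a 5 "11 - a + ?t"] fits_pair[of 7 "11 - a - 1" 5 "a + 1 + ?t"] 2(2) by linarith
      then show ?thesis using e(5)[OF a] e(6)[OF a] 2 by simp
    next
      case 3
      \<comment> \<open>At any other position of a path on 14 vertices one of the two cuts leaves
        parts for 5 and 10 vertices. The degree, however, demands \<open>6 - 2 = 4\<close>
        attachments.\<close>
      have "positions xs (hd ys) \<subseteq> {4, 9}"
      proof
        fix a assume a: "a \<in> positions xs (hd ys)"
        have "2 \<le> a" "a < 12" using e(2)[OF a] 3 by auto
        moreover have "\<not> fits [5, 5, 5] a (14 - a + 2)" "\<not> fits [5, 5, 5] (14 - a - 1) (a + 1 + 2)"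
          using e(5)[OF a] e(6)[OF a] 3 by auto
        ultimately have "a = 4 \<or> a = 9"
          using fits_triple[of 5 a "14 - a + 2"] fits_triple[of 5 "14 - a - 1" "a + 1 + 2"] by linarith
        then show "a \<in> {4, 9}" by simp
      qed
      then have "card (positions xs (hd ys)) \<le> card {4, 9::nat}" by (intro card_mono) auto
      then have "card (positions xs (hd ys)) \<le> 2" by simp
      moreover have "Suc d = 6" using h_def 3(1) by simp
      ultimately show ?thesis using e(1) 3(2) by simp
    next
      case 4
      have "positions xs (hd zs) \<subseteq> {4, 9}" if zs: "longest D zs" for zs
      proof
        note ez = off_path_end[OF H D(1) zs]
        fix a assume a: "a \<in> positions xs (hd zs)"
        have "4 \<le> a" "a < 10" using ez(2)[OF a] 4 len[OF zs] by auto
        moreover have "\<not> fits [5, 5, 5] (14 - a - 1) (a + 1 + 4)"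
          using ez(6)[OF a] 4 len[OF zs] by auto
        ultimately have "a = 4 \<or> a = 9"
          using fits_triple[of 5 "14 - a - 1" "a + 1 + 4"] by linarith
        then show "a \<in> {4, 9}" by simp
      qed
      moreover have "Suc d = 6" using h_def 4(1) by simp
      ultimately have "attached V D ((!) xs ` {4, 9}) ?t"
        using 4(2) by (intro attachedI[OF H D(1) ys]) auto
      then show ?thesis using 4 by simp
    qed
  next
    case t: True
    then have d2: "2 \<le> d" using t2 by simp
    show ?thesis
    proof (cases "l2 < Suc d")
      case True
      \<comment> \<open>Two attachments are at least two apart and leave \<open>d\<close> vertices
        on either outer side, so \<open>xs\<close> would have at least \<open>2 * d + 3\<close>
        vertices, enough for \<open>fits_more\<close>.\<close>
      have "card (positions xs (hd zs)) \<le> 1" if zs: "longest D zs" for zs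
      proof (rule ccontr)
        note ez = off_path_end[OF H D(1) zs]
        assume "\<not> card (positions xs (hd zs)) \<le> 1"
        then have "1 < card (positions xs (hd zs))" by simp
        then obtain a b where ab: "a \<in> positions xs (hd zs)" "b \<in> positions xs (hd zs)" "a \<noteq> b"
          using card_le_Suc0_iff_eq[OF finite_positions, of xs "hd zs"] by (metis One_nat_def not_le)
        then obtain a b where ab: "a \<in> positions xs (hd zs)" "b \<in> positions xs (hd zs)" "a < b"
          by (metis linorder_neqE_nat)
        then have "Suc a \<noteq> b" using ez(3)[of a] by blast
        then have "a + 2 \<le> b" using ab(3) by linarith
        then have "2 * Suc d + 1 \<le> ?m" using ez(2)[OF ab(1)] ez(2)[OF ab(2)] ab(3) len[OF zs] t by simp
        then have "fits ls ?m ?t" using fits_mono[OF fits_more[OF True], of ?m ?t] t by simp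
        then show False using e(4) by blast
      qed
      then have "card (nb (set xs) (hd zs)) \<le> 1" if "longest D zs" for zs
        using that card_positions[OF px] by simp
      then have "card D = ?t"
        using comp_closes_up(1)[of V d xs D ys 1] H D(1) ys t d2 by (auto simp: host_def)
      moreover have "ls \<noteq> [5, 5, 5]"
      proof
        assume l: "ls = [5, 5, 5]"
        then have "Suc d = 6" using h_def by simp
        then have "fits [5, 5, 5] ?m ?t" using V(2) t by (intro fits_triple) auto
        then show False using e(4) l by simp
      qed
      ultimately show ?thesis using True t ys by (auto simp: longest_def)
    next
      case False
      then have l2: "l2 = Suc d" using l2_cases[OF ns] by simp
      have pl: "sum_list ls \<le> 2 * d + 1 + l2" 
      proof -
        have "q \<le> d" using q_le d2 by linarith
        then show ?thesis using sum_ls l2 by simp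
      qed
      \<comment> \<open>Neither side of the attachment may hold \<open>l2 = d + 1\<close>, since the
        remaining lengths, at most \<open>2 * d + 1\<close> in total, would fit on the other part
        extended by \<open>D\<close>. So both sides have exactly \<open>d\<close> vertices.\<close>
      have pos: "a = d \<and> ?m = 2 * d + 1" if zs: "longest D zs" and a: "a \<in> positions xs (hd zs)" for zs a
      proof -
        note ez = off_path_end[OF H D(1) zs]
        have b: "d \<le> a" "a + d < ?m" using ez(2)[OF a] len[OF zs] t by auto
        have "\<not> l2 \<le> ?m - a - 1"
        proof
          assume "l2 \<le> ?m - a - 1"
          then have "fits ls (a + 1 + d) (?m - a - 1)" using pl b ls by (intro fits_single[of l2]) auto
          then show False using ez(6)[OF a] fits_sym len[OF zs] t by metis
        qed
        moreover have "\<not> l2 \<le> a"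
        proof
          assume "l2 \<le> a"
          then have "fits ls (?m - a + d) a" using pl b ls by (intro fits_single[of l2]) auto
          then show False using ez(5)[OF a] fits_sym len[OF zs] t by metis
        qed
        ultimately show ?thesis using b l2 V(2) by linarith
      qed
      have "attached V D ((!) xs ` {d}) ?t"
        using pos t d2 by (intro attachedI[OF H D(1) ys]) auto
      moreover have "?m = 2 * d + 1" using pos[OF ys] ne by blast
      ultimately show ?thesis using t l2 by simp
    qed
  qed
qed

end

section \<open>Connected graphs\<close>

context loopless
begin

text \<open>Cutting \<open>xs\<close> at an attachment leaves room for two paths on \<open>l\<close>
  vertices unless the attachment is at \<open>l - 2\<close> or \<open>l - 1\<close>. These positions
  are consecutive, so all attachments of \<open>D\<close> must agree.\<close>

lemma special_shape:
  assumes H: "host V xs d [l, l]" and l: "odd l" "5 \<le> l" "l = d + 2"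
    and D: "comp (V - set xs) D" "2 \<le> card D"
  obtains a t where "a = l - 2 \<or> a = l - 1" "t = l - 2 \<or> t = l - 1" "a + t < length xs" "attached V D {xs ! a} t"
    "\<exists>y\<in>D. adj y (xs ! a)"
proof -
  have hl: "l div 2 + l div 2 = Suc d" using l by presburger
  interpret forest "[l, l]" l l "[]" "Suc d" 2
    using l hl by unfold_locales (auto simp: odd_iff_mod_2_eq_one)
  have V: "finite V" "\<forall>v\<in>V. d \<le> card (nb V v)" "2 * d + 1 \<le> length xs" "conn V"
    and lx: "longest V xs" using H by (auto simp: host_def)
  have px: "path V xs" using lx by (simp add: longest_def)
  have DV: "D \<subseteq> V - set xs" using comp_subset[OF D(1)] .
  have fD: "finite D" using DV V(1) by (meson finite_Diff finite_subset)
  obtain ys where ys: "longest D ys" using longest_exists[OF fD] by blast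
  let ?t = "length ys" and ?m = "length xs"
  have t2: "2 \<le> ?t" using longest_ge_2[OF _ D ys] V(1) by simp
  note e = off_path_end[OF H D(1) ys]
  have m: "?m < 2 * l" using host_length[OF H] by simp
  have tl: "?t < l"
  proof (rule ccontr)
    assume "\<not> ?t < l"
    then have "fits [l, l] ?m ?t" using V(3) l by (intro fits_pair) auto
    then show False using e(4) by blast
  qed
  have len: "length zs = ?t" if "longest D zs" for zs using that ys by (meson le_antisym longest_def)
  have mid: "l \<le> ?m - a + ?t \<longrightarrow> a < l" "l \<le> a + 1 + ?t \<longrightarrow> ?m \<le> a + l"
    if zs: "longest D zs" "a \<in> positions xs (hd zs)" for zs a
  proof -
    note ez = off_path_end[OF H D(1) zs(1)]
    show "l \<le> ?m - a + ?t \<longrightarrow> a < l"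
    proof (rule ccontr)
      assume "\<not> (l \<le> ?m - a + ?t \<longrightarrow> a < l)"
      then have "fits [l, l] a (?m - a + ?t)" by (intro fits_pair) auto
      then show False using ez(5)[OF zs(2)] len[OF zs(1)] by simp
    qed
    show "l \<le> a + 1 + ?t \<longrightarrow> ?m \<le> a + l"
    proof (rule ccontr)
      assume "\<not> (l \<le> a + 1 + ?t \<longrightarrow> ?m \<le> a + l)"
      then have "fits [l, l] (?m - a - 1) (a + 1 + ?t)" by (intro fits_pair) auto
      then show False using ez(6)[OF zs(2)] len[OF zs(1)] by simp
    qed
  qed
  have td: "d \<le> ?t"
  proof (rule ccontr)
    assume n: "\<not> d \<le> ?t"
    have "(Suc d - ?t) * (?t + 1) + ?t \<le> ?m"
      using n by (intro off_path_long[OF H D(1) ys t2 _ sum_ls q_le]) simp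
    then have "l = 5" "?t = 2" "8 \<le> ?m"
      using small_cases[OF t2 _ _ _ e(4)] n host_length[OF H] by auto
    then have d3: "d = 3" using l by simp
    have sub: "positions xs (hd ys) \<subseteq> {3, 4}"
    proof
      fix a assume a: "a \<in> positions xs (hd ys)"
      have "2 \<le> a" "a + 2 < ?m" using e(2)[OF a] \<open>?t = 2\<close> by auto
      then have "a < 5" "?m \<le> a + 5" using mid[OF ys a] \<open>l = 5\<close> \<open>?t = 2\<close> by auto
      then show "a \<in> {3, 4}" using \<open>8 \<le> ?m\<close> by auto
    qed
    have c2: "2 \<le> card (positions xs (hd ys))" using e(1) d3 \<open>?t = 2\<close> by simp
    have "\<not> (3 \<in> positions xs (hd ys) \<and> 4 \<in> positions xs (hd ys))" using e(3)[of 3] by simp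
    then have "positions xs (hd ys) \<subseteq> {3} \<or> positions xs (hd ys) \<subseteq> {4}" using sub by blast
    then have "card (positions xs (hd ys)) \<le> 1" by (metis card_mono finite.emptyI finite_insert is_singletonI is_singleton_altdef)
    then show False using c2 by simp
  qed
  then have t: "?t = l - 2 \<or> ?t = l - 1" using tl l by linarith
  have pos: "a = l - 2 \<or> a = l - 1" if zs: "longest D zs" "a \<in> positions xs (hd zs)" for zs a
  proof -
    have b: "?t \<le> a" "a + ?t < ?m" using off_path_end(2)[OF H D(1) zs] len[OF zs(1)] by auto
    have "l \<le> ?m - a + ?t" "l \<le> a + 1 + ?t" using b t l(2) by linarith+
    then have "a < l" using mid[OF zs] by blast
    then show ?thesis using b t by linarith
  qed
  have c: "card (nb (set xs) (hd zs)) \<le> 1" if zs: "longest D zs" for zs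
  proof -
    have "\<not> (l - 2 \<in> positions xs (hd zs) \<and> Suc (l - 2) \<in> positions xs (hd zs))"
      using off_path_end(3)[OF H D(1) zs] by blast
    moreover have "Suc (l - 2) = l - 1" using l by simp
    ultimately have "positions xs (hd zs) \<subseteq> {l - 2} \<or> positions xs (hd zs) \<subseteq> {l - 1}"
      using pos[OF zs] by (metis insertI1 subsetI)
    then have "card (positions xs (hd zs)) \<le> 1" by (metis card_mono finite.emptyI finite_insert is_singletonI is_singleton_altdef)
    then show ?thesis using card_positions[OF px] by simp
  qed
  have t1: "?t + 2 * 1 \<le> 2 * d" using t l by linarith
  have cu1: "card D = ?t" by (rule comp_closes_up(1)[OF V(1,2) D(1) ys _ t1]) (rule c)
  have cu2: "\<exists>zs. longest D zs \<and> hd zs = y" if "y \<in> D" for y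
    by (rule comp_closes_up(2)[OF V(1,2) D(1) ys _ t1 that]) (rule c)
  have pos': "a = l - 2 \<or> a = l - 1" if "y \<in> D" "a \<in> positions xs y" for y a
    using cu2[OF that(1)] pos that(2) by blast
  \<comment> \<open>A path inside \<open>D\<close> from \<open>y\<close> to \<open>y'\<close> would
    be a detour between consecutive vertices of \<open>xs\<close>.\<close>
  have link: False if y: "y \<in> D" "l - 2 \<in> positions xs y" and y': "y' \<in> D" "l - 1 \<in> positions xs y'" for y y'
  proof -
    obtain zs where zs: "longest D zs" "hd zs = y" using cu2[OF y(1)] by blast
    have pz: "path D zs" using zs(1) by (simp add: longest_def)
    have "card (set zs) = card D" using pz len[OF zs(1)] cu1 path_distinct distinct_card by metis
    then have "set zs = D" using path_set[OF pz] fD card_subset_eq by blast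
    then obtain i where i: "i < length zs" "y' = zs ! i" using y'(1) by (metis in_set_conv_nth)
    let ?us = "take (Suc i) zs"
    have us: "path D ?us" "?us \<noteq> []" "hd ?us = y" "last ?us = y'"
    proof -
      show "path D ?us" using pz by (rule path_take)
      show "?us \<noteq> []" using i by auto
      show "hd ?us = y" using zs(2) by (simp add: hd_take)
      show "last ?us = y'" using i by (simp add: take_Suc_conv_app_nth)
    qed
    have "D \<subseteq> V" using DV by blast
    then have "path V ?us" by (rule path_mono[OF us(1)])
    moreover have "set xs \<inter> set ?us = {}" using DV path_set[OF us(1)] by blast
    moreover have "l - 2 < l - 1" using l by simp
    moreover have "l - 1 < length xs" "adj y (xs ! (l - 2))" "adj y' (xs ! (l - 1))"
      using y y' by (auto simp: positions_def)
    ultimately have "(l - 2) + length ?us < l - 1"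
      using longest_detour[OF lx, of ?us "l - 2" "l - 1"] us by simp
    moreover have "length ?us \<ge> 1" using us(2) by (simp add: Suc_leI)
    ultimately show False by linarith
  qed
  define a where "a = (if \<exists>y\<in>D. l - 2 \<in> positions xs y then l - 2 else l - 1)"
  have I: "positions xs y \<subseteq> {a}" if y: "y \<in> D" for y
    using pos'[OF y] link y unfolding a_def by (auto split: if_splits)
  have att: "attached V D {xs ! a} ?t" using attached_positionsI[OF D(1) ys cu1 cu2 I] by simp
  have "D \<noteq> V"
  proof
    assume "D = V"
    then have "set xs \<inter> set xs = {}" using DV path_set[OF px] by blast
    then show False using V(3) by simp
  qed
  then obtain y v where yv: "y \<in> D" "v \<in> V - D" "adj y v"
    using V(4) DV comp_nonempty[OF D(1)] unfolding conn_def by (meson Diff_subset subset_trans)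
  then have "v \<in> nb V y" using adj_sym by (auto simp: nb_iff)
  then have "v = xs ! a" using att yv by (auto simp: attached_def)
  moreover have "v \<in> set xs" using D(1) yv by (auto simp: comp_def)
  ultimately have "positions xs y \<noteq> {}" using yv by (auto simp: positions_def in_set_conv_nth)
  then have ap: "a \<in> positions xs y" using I[OF yv(1)] by blast
  obtain zs where zs: "longest D zs" "hd zs = y" using cu2[OF yv(1)] by blast
  have "a + ?t < ?m" using off_path_end(2)[OF H D(1) zs(1)] ap zs(2) len[OF zs(1)] by auto
  moreover have "a = l - 2 \<or> a = l - 1" by (simp add: a_def)
  ultimately show thesis using that[of a ?t] att t yv \<open>v = xs ! a\<close> by blast
qed

text \<open>A vertex with a neighbour off the path lies in a component on at least two vertices, and
  one such component is too small to contain all of them.\<close>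

lemma two_nonsingle_comps:
  assumes "finite V" and b: "\<And>D. comp (V - set xs) D \<Longrightarrow> 2 \<le> card D \<Longrightarrow> card D \<le> b"
    and U: "b < card {v \<in> V - set xs. \<not> nb V v \<subseteq> set xs}"
  obtains D1 D2 where "comp (V - set xs) D1" "comp (V - set xs) D2" "D1 \<noteq> D2" "2 \<le> card D1" "2 \<le> card D2"
proof -
  let ?U = "{v \<in> V - set xs. \<not> nb V v \<subseteq> set xs}"
  have fin: "finite (V - set xs)" using assms(1) by simp
  have big: "\<exists>D. comp (V - set xs) D \<and> v \<in> D \<and> 2 \<le> card D" if v: "v \<in> ?U" for v
  proof -
    obtain D where D: "comp (V - set xs) D" "v \<in> D" using comp_exists[OF fin] v by blast
    obtain u where u: "u \<in> V - set xs" "adj u v" using v unfolding nb_def by blast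
    then have "u \<in> D" using D adj_sym[of u v] by (auto simp: comp_def)
    moreover have "u \<noteq> v" using u by auto
    moreover have "finite D" using comp_subset[OF D(1)] fin finite_subset by blast
    ultimately have "2 \<le> card D" using D(2) by (metis (no_types, lifting) card_2_iff card_mono empty_subsetI insert_subset)
    then show ?thesis using D by blast
  qed
  have "?U \<noteq> {}" using U by (metis card.empty not_less_zero)
  then obtain v where "v \<in> ?U" by blast
  then obtain D1 where D1: "comp (V - set xs) D1" "2 \<le> card D1" using big by blast
  have "\<not> ?U \<subseteq> D1"
  proof
    assume "?U \<subseteq> D1"
    moreover have "finite D1" using comp_subset[OF D1(1)] fin finite_subset by blast
    ultimately have "card ?U \<le> card D1" using card_mono by blast
    then show False using b[OF D1] U by linarith
  qed
  then obtain w where w: "w \<in> ?U" "w \<notin> D1" by blast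
  then obtain D2 where "comp (V - set xs) D2" "w \<in> D2" "2 \<le> card D2" using big by blast
  then show thesis using that[OF D1(1) _ _ D1(2)] w by blast
qed

section \<open>Small components around one or two cut vertices\<close>

lemma attached_comp:
  assumes "comp (V - set xs) D" "attached V D Z t" "Z \<subseteq> set xs"
  shows "comp (V - Z) D"
proof -
  have D: "conn D" "D \<subseteq> V - set xs" using assms(1) by (auto simp: comp_def)
  have "\<not> adj u v" if "u \<in> D" "v \<in> V - Z - D" for u v
  proof
    assume "adj u v"
    then have "v \<in> nb V u" using that adj_sym by (auto simp: nb_iff)
    then show False using assms(2) that by (auto simp: attached_def)
  qed
  then show ?thesis using D assms(3) by (auto simp: comp_def)
qed

text \<open>Outside \<open>Z\<close> the minimum degree is still \<open>d - card Z\<close>, which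
  bounds a component from below and gives it a path on \<open>2 * (d - card Z) + 1 \<ge> l\<close>
  vertices unless the component is smaller.\<close>

lemma comps_without_long_path:
  assumes V: "finite V" "\<forall>v\<in>V. d \<le> card (nb V v)" and Z: "Z \<subseteq> V"
    and np: "\<And>ys. path (V - Z) ys \<Longrightarrow> length ys \<noteq> l" and l: "l + 2 * card Z \<le> 2 * d + 1"
    and C: "comp (V - Z) C"
  shows "card C < l" "Suc d \<le> card C + card Z"
proof -
  have fZ: "finite Z" using Z V(1) finite_subset by blast
  have CV: "C \<subseteq> V - Z" using comp_subset[OF C] .
  have fC: "finite C" using CV V(1) by (meson finite_Diff finite_subset)
  have deg: "d \<le> card (nb (V - Z) v) + card Z" if "v \<in> V" for v
  proof -
    have "nb V v \<subseteq> nb (V - Z) v \<union> Z" by (auto simp: nb_def)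
    then have "card (nb V v) \<le> card (nb (V - Z) v \<union> Z)" using V(1) fZ finite_nb by (intro card_mono) auto
    also have "\<dots> \<le> card (nb (V - Z) v) + card Z" by (rule card_Un_le)
    finally show ?thesis using V(2) that by fastforce
  qed
  then have "\<forall>v\<in>V - Z. d - card Z \<le> card (nb (V - Z) v)" by (simp add: le_diff_conv)
  then obtain ys where ys: "path C ys" "min (card C) (2 * (d - card Z) + 1) \<le> length ys"
    using comp_card_le_path[OF _ C] V(1) by blast
  have "length ys < l"
  proof (rule ccontr)
    assume "\<not> length ys < l"
    then have "length (take l ys) = l" by simp
    moreover have "path (V - Z) (take l ys)" using ys(1) CV path_take path_mono by blast
    ultimately show False using np by blast
  qed
  then show "card C < l" using ys(2) l by linarith
  obtain v where v: "v \<in> C" using comp_nonempty[OF C] by blast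
  have "nb C v \<subseteq> C - {v}" by (auto simp: nb_def)
  then have "card (nb C v) \<le> card (C - {v})" using fC by (intro card_mono) auto
  then have "card (nb (V - Z) v) + 1 \<le> card C"
    using comp_nb[OF C v] v fC by (metis One_nat_def Suc_eq_plus1 Suc_le_mono card_Suc_Diff1)
  then show "Suc d \<le> card C + card Z" using deg[of v] v CV by fastforce
qed

lemma attached_avoids:
  assumes V: "finite V" and D: "comp (V - set xs) D" and a: "attached V D Z t" and Z: "Z \<subseteq> set xs"
    and ys: "path (V - Z) ys" "t < length ys"
  shows "set ys \<inter> D = {}"
proof (rule ccontr)
  assume "set ys \<inter> D \<noteq> {}"
  then have p: "path D ys" using path_in_comp[OF ys(1) attached_comp[OF D a Z]] by blast
  have "finite D" using comp_subset[OF D] V by (meson finite_Diff finite_subset)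
  then have "length ys \<le> card D" by (rule path_length_le[OF p])
  then show False using a ys(2) by (simp add: attached_def)
qed

lemma attached_adj:
  assumes "conn V" "path V xs" "xs \<noteq> []" "comp (V - set xs) D" "attached V D Z t"
  shows "\<exists>y\<in>D. \<exists>z\<in>Z. adj y z"
proof -
  have D: "D \<subseteq> V - set xs" "D \<noteq> {}" using comp_subset comp_nonempty assms(4) by auto
  have "D \<noteq> V"
  proof
    assume "D = V"
    then have "set xs \<inter> set xs = {}" using D(1) path_set[OF assms(2)] by blast
    then show False using assms(3) by simp
  qed
  then obtain y v where yv: "y \<in> D" "v \<in> V - D" "adj y v"
    using assms(1) D unfolding conn_def by (meson Diff_subset subset_trans)
  then have "v \<in> nb V y" using adj_sym by (auto simp: nb_iff)
  then have "v \<in> Z" using assms(5) yv by (auto simp: attached_def)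
  then show ?thesis using yv by blast
qed

lemma attached_path:
  assumes "attached V D Z t" "y \<in> D"
  obtains ys where "path D ys" "length ys = t" "hd ys = y"
  using assms by (auto simp: attached_def)

text \<open>Spanning paths of \<open>D1\<close> and \<open>D2\<close> joined at \<open>z\<close>
  hold all lengths except \<open>l\<close>. A path on \<open>l\<close> vertices avoiding
  \<open>z\<close> cannot enter the smaller sets \<open>D1\<close> and \<open>D2\<close>, so it
  would complete F.\<close>

lemma one_center:
  assumes V: "finite V" "\<not> packs V ls" "path V xs"
    and D: "comp (V - set xs) D1" "comp (V - set xs) D2" "D1 \<noteq> D2"
    and a: "attached V D1 {z} t1" "attached V D2 {z} t2" "z \<in> set xs"
    and y: "y1 \<in> D1" "adj y1 z" "y2 \<in> D2" "adj y2 z"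
    and l: "mset ls = add_mset l (mset ks)" "sum_list ks \<le> t1 + 1 + t2" "t1 < l" "t2 < l" "1 \<le> t1" "1 \<le> t2"
    and w: "path (V - {z}) ws"
  shows "length ws \<noteq> l"
proof
  assume lw: "length ws = l"
  have DV: "D1 \<subseteq> V - set xs" "D2 \<subseteq> V - set xs" using comp_subset D by auto
  have dj: "D1 \<inter> D2 = {}" using comp_disjoint D by blast
  have w1: "set ws \<inter> D1 = {}" using attached_avoids[OF V(1) D(1) a(1) _ w] a(3) l lw by auto
  have w2: "set ws \<inter> D2 = {}" using attached_avoids[OF V(1) D(2) a(2) _ w] a(3) l lw by auto
  obtain u1 where u1: "path D1 u1" "length u1 = t1" "hd u1 = y1" using attached_path[OF a(1) y(1)] by blast
  obtain u2 where u2: "path D2 u2" "length u2 = t2" "hd u2 = y2" using attached_path[OF a(2) y(3)] by blast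
  have ne: "u1 \<noteq> []" "u2 \<noteq> []" using u1 u2 l by auto
  have s1: "set u1 \<subseteq> D1" "set u2 \<subseteq> D2" using path_set u1 u2 by auto
  have zV: "z \<in> V" using a(3) path_set[OF V(3)] by blast
  have pu: "path V u1" "path V u2" using u1 u2 DV path_mono by (meson Diff_subset subset_trans)+
  let ?p = "rev u1 @ z # u2"
  have "path V (z # u2)" using pu(2) u2(3) y(4) zV s1(2) DV a(3) adj_sym by (auto simp: path_Cons)
  then have "path V ?p"
    using pu(1) u1(3) y(2) ne s1 DV a(3) dj by (subst path_append) (auto simp: path_rev last_rev)
  moreover have "path V ws" using w path_mono by blast
  moreover have "set ?p \<inter> set ws = {}" using s1 w1 w2 path_set[OF w] by auto
  moreover have "sum_list ks \<le> length ?p" "sum_list [l] \<le> length ws" using u1 u2 l lw by auto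
  moreover have "mset ls = mset ks + mset [l]" using l(1) by simp
  ultimately have "packs V ls" by (intro packs_two_paths[of V ?p ws ls ks "[l]"])
  then show False using V(2) by blast
qed

text \<open>Each vertex of \<open>D1\<close> and \<open>D2\<close> needs degree 5 but has only three
  neighbours in its component, hence is adjacent to both centres. So \<open>z1\<close> with
  \<open>D1\<close>, \<open>z2\<close> with \<open>D2\<close>, and \<open>ws\<close> would be three
  disjoint paths on five vertices.\<close>

lemma two_centers:
  assumes V: "finite V" "\<not> packs V [5, 5, 5]" "path V xs" "\<forall>v\<in>V. 5 \<le> card (nb V v)"
    and D: "comp (V - set xs) D1" "comp (V - set xs) D2" "D1 \<noteq> D2"
    and a: "attached V D1 {z1, z2} 4" "attached V D2 {z1, z2} 4" "z1 \<in> set xs" "z2 \<in> set xs" "z1 \<noteq> z2"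
    and w: "path (V - {z1, z2}) ws"
  shows "length ws \<noteq> 5"
proof
  assume lw: "length ws = 5"
  have DV: "D1 \<subseteq> V - set xs" "D2 \<subseteq> V - set xs" using comp_subset D by auto
  have dj: "D1 \<inter> D2 = {}" using comp_disjoint D by blast
  have w1: "set ws \<inter> D1 = {}" using attached_avoids[OF V(1) D(1) a(1) _ w] a lw by auto
  have w2: "set ws \<inter> D2 = {}" using attached_avoids[OF V(1) D(2) a(2) _ w] a lw by auto
  have zV: "z1 \<in> V" "z2 \<in> V" using a path_set[OF V(3)] by auto
  have piece: "\<exists>us. path (insert z D) us \<and> length us = 5"
    if D: "comp (V - set xs) D" "attached V D {z1, z2} 4" "z = z1 \<or> z = z2" for D z
  proof -
    obtain y where y: "y \<in> D" using comp_nonempty[OF D(1)] by blast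
    have fD: "finite D" using comp_subset[OF D(1)] V(1) by (meson finite_Diff finite_subset)
    have cD: "card D = 4" "nb V y \<subseteq> D \<union> {z1, z2}" using D(2) y by (auto simp: attached_def)
    have "adj y z"
    proof (rule ccontr)
      assume n: "\<not> adj y z"
      obtain z' where "{z1, z2} = {z, z'}" using D(3) by blast
      then have "nb V y \<subseteq> insert z' (D - {y})" using cD(2) n adj_sym[of y] by (auto simp: nb_iff)
      then have "card (nb V y) \<le> card (insert z' (D - {y}))" using fD by (intro card_mono) auto
      also have "\<dots> \<le> 4" using cD(1) y fD by (simp add: card_insert_if)
      finally show False using V(4) y comp_subset[OF D(1)] by fastforce
    qed
    obtain us where us: "path D us" "length us = 4" "hd us = y" using attached_path[OF D(2) y] by blast
    have "z \<notin> D" using D(1,3) a(3,4) comp_subset by blast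
    then have "path (insert z D) (z # us)"
      using us \<open>adj y z\<close> adj_sym path_set[OF us(1)] path_mono[OF us(1), of "insert z D"] by (auto simp: path_Cons)
    then show ?thesis using us(2) by (intro exI[of _ "z # us"]) simp
  qed
  have p1: "packs (insert z1 D1) [5]" using piece[OF D(1) a(1)] by (simp add: packs_single)
  have p2: "packs (insert z2 D2) [5]" using piece[OF D(2) a(2)] by (simp add: packs_single)
  have p3: "packs (set ws) [5]" using packs_path[OF w, of "[5]"] lw by simp
  have "packs (insert z1 D1 \<union> insert z2 D2) ([5] @ [5])"
    using dj a DV by (intro packs_append[OF p1 p2]) auto
  then have "packs V (([5] @ [5]) @ [5])"
  proof (rule packs_append[OF _ p3])
    show "(insert z1 D1 \<union> insert z2 D2) \<inter> set ws = {}" using w1 w2 path_set[OF w] by blast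
    show "insert z1 D1 \<union> insert z2 D2 \<subseteq> V" "set ws \<subseteq> V" using path_set[OF w] DV zV by auto
  qed
  then show False using V(2) by simp
qed

lemma connected_host:
  assumes V: "finite V" "conn V" "\<forall>v\<in>V. d \<le> card (nb V v)" and np: "\<not> packs V ls" and c: "2 * d + 1 \<le> card V"
  obtains xs where "host V xs d ls" "longest V xs" "path V xs" "xs \<noteq> []"
proof -
  obtain xs where xs: "longest V xs" using longest_exists[OF V(1)] by blast
  have "2 * d + 1 \<le> length xs" using longest_length_ge[OF V(2,1) xs V(3)] c by simp
  moreover have "xs \<noteq> []" using calculation by auto
  ultimately show thesis using that[of xs] xs V np by (auto simp: host_def longest_def)
qed

text \<open>Off the path and outside the exceptional set there remain more than 4(p - 1) - (p - 1) -
  (d + 1) vertices, p = |F|. Since p \<ge> 2d + 2 this exceeds \<open>length xs + 3 * d\<close>;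
  hence the constant 4.\<close>

lemma few_nonsingles:
  assumes H: "host V xs d ls" and ls: "admissible ls" "(\<Sum>l\<leftarrow>ls. l div 2) = Suc d"
    and U: "card {v \<in> V - set xs. \<not> nb V v \<subseteq> set xs} \<le> d + 1" and n: "4 * (sum_list ls - 1) < card V"
  shows "card (cl s V) \<le> num_cliques s {0..<card V} (GF_E ls (card V))"
proof -
  let ?U = "{v \<in> V - set xs. \<not> nb V v \<subseteq> set xs}"
  let ?R = "V - set xs - ?U"
  have V: "finite V" "conn V" "\<forall>v\<in>V. d \<le> card (nb V v)" "longest V xs" "\<not> packs V ls"
    using H by (auto simp: host_def)
  have m: "length xs < sum_list ls" using host_length[OF H] .
  have "2 * Suc d \<le> sum_list ls" using sum_list_halves[of ls] ls(2) by simp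
  moreover have "card ?R = card V - card (set xs) - card ?U"
  proof -
    have "set xs \<subseteq> V" using V(4) path_set by (auto simp: longest_def)
    then have "card (V - set xs) = card V - card (set xs)" by (simp add: card_Diff_subset)
    moreover have "card ?R = card (V - set xs) - card ?U"
      using V(1) by (intro card_Diff_subset) auto
    ultimately show ?thesis by simp
  qed
  moreover have "card (set xs) \<le> length xs" by (rule card_length)
  ultimately have "length xs + 3 * d < card ?R" using U n m by simp
  then show ?thesis using many_singles_cliques[OF V(1-4) V(5) ls, of ?R s] by blast
qed

text \<open>The second alternative covers the graphs with small components around one or two
  centres: at most 5/6 of \<open>d choose (s - 1)\<close> cliques per vertex, a margin that later
  absorbs all lower-order terms.\<close>

lemma connected_nonspecial:
  assumes V: "finite V" "conn V" "\<forall>v\<in>V. d \<le> card (nb V v)" "\<not> packs V ls"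
    and f: "forest ls l1 l2 rs (Suc d) q" and ns: "\<not> (rs = [] \<and> l1 = l2 \<and> odd l1)"
    and n: "4 * (sum_list ls - 1) < card V" and s: "2 \<le> s"
  shows "card (cl s V) \<le> num_cliques s {0..<card V} (GF_E ls (card V)) \<or>
    6 * card (cl s V) \<le> 5 * (d choose (s - 1)) * card V + 6"
proof -
  interpret forest ls l1 l2 rs "Suc d" q by (rule f)
  have "2 * d + 1 \<le> card V" using n sum_ls by simp
  then obtain xs where H: "host V xs d ls" and xs: "longest V xs" "path V xs" "xs \<noteq> []"
    using connected_host[OF V(1-4)] by blast
  let ?U = "{v \<in> V - set xs. \<not> nb V v \<subseteq> set xs}"
  show ?thesis
  proof (cases "card ?U \<le> d")
    case True
    then show ?thesis using few_nonsingles[OF H admissible_ls _ _ n] h_def by simp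
  next
    case False
    have d5: "d = 5" if "ls = [5, 5, 5]" using h_def that by simp
    have small: "card D \<le> d" if "comp (V - set xs) D" "2 \<le> card D" for D
      using nonsingle_shape[OF H f ns that] d5 by (auto simp: attached_def)
    have big: "d < card ?U" using False by simp
    obtain D1 D2 where D: "comp (V - set xs) D1" "comp (V - set xs) D2" "D1 \<noteq> D2" "2 \<le> card D1" "2 \<le> card D2"
      by (rule two_nonsingle_comps[OF V(1) small big])
    note s1 = nonsingle_shape[OF H f ns D(1,4)] and s2 = nonsingle_shape[OF H f ns D(2,5)]
    have sub: "D1 \<subseteq> V - set xs" "D2 \<subseteq> V - set xs" using comp_subset D by auto
    have dj: "D1 \<inter> D2 = {}" using comp_disjoint D by blast
    consider "l2 < Suc d" "ls \<noteq> [5, 5, 5]" | "l2 = Suc d" | "ls = [5, 5, 5]"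
      using l2_cases[OF ns] by linarith
    then show ?thesis
    proof cases
      case 1
      \<comment> \<open>The path \<open>xs\<close> and the spanning paths of two components have at
        least \<open>2 * d + 1\<close>, \<open>d\<close> and \<open>d\<close> vertices, and three
        such paths hold F.\<close>
      obtain u1 u2 where u: "path D1 u1" "length u1 = d" "path D2 u2" "length u2 = d" using s1 s2 1 by auto
      obtain ks us ys where k: "mset ls = mset ks + mset us + mset ys" "sum_list ks \<le> 2 * Suc d - 1"
        "sum_list us \<le> Suc d - 1" "sum_list ys \<le> Suc d - 1" using fits_three[OF 1(1)] by blast
      have "packs (set xs) ks" using packs_path[OF xs(2), of ks] k(2) H by (simp add: host_def)
      moreover have "packs (set u1) us" using packs_path[OF u(1), of us] k(3) u(2) by simp
      moreover have "set u1 \<subseteq> D1" "set u2 \<subseteq> D2" using u path_set by auto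
      ultimately have "packs (set xs \<union> set u1) (ks @ us)" using sub by (intro packs_append) auto
      moreover have "packs (set u2) ys" using packs_path[OF u(3), of ys] k(4) u(4) by simp
      ultimately have "packs V ((ks @ us) @ ys)"
        using sub dj path_set[OF xs(2)] \<open>set u1 \<subseteq> D1\<close> \<open>set u2 \<subseteq> D2\<close>
        by (intro packs_append[of "set xs \<union> set u1" "ks @ us" "set u2" ys]) auto
      then have "packs V ls" by (rule packs_perm) (simp add: k(1))
      then show ?thesis using V(4) by blast
    next
      case 2
      then have ne: "ls \<noteq> [5, 5, 5]" using d5 ls by auto
      then have a: "attached V D1 {xs ! d} d" "attached V D2 {xs ! d} d" "length xs = 2 * d + 1"
        using s1 s2 2 by auto
      have z: "xs ! d \<in> set xs" using a(3) by simp
      obtain y1 y2 where y: "y1 \<in> D1" "adj y1 (xs ! d)" "y2 \<in> D2" "adj y2 (xs ! d)"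
        using attached_adj[OF V(2) xs(2,3) D(1) a(1)] attached_adj[OF V(2) xs(2,3) D(2) a(2)] by auto
      have d3: "3 \<le> d" "1 \<le> d"
      proof -
        have "2 \<le> card D1" using D by simp
        then have "2 \<le> d" using a(1) by (simp add: attached_def)
        moreover have "d \<noteq> 2" using 2 l_ge by auto
        ultimately show "3 \<le> d" "1 \<le> d" by auto
      qed
      have "sum_list (l1 # rs) \<le> d + 1 + d"
      proof -
        have "sum_list ls = l2 + sum_list (l1 # rs)" using ls by simp
        then show ?thesis using sum_ls q_le 2 d3 by simp
      qed
      moreover have "mset ls = add_mset l2 (mset (l1 # rs))" using ls by simp
      ultimately have no: "length ws \<noteq> l2" if "path (V - {xs ! d}) ws" for ws
        using one_center[OF V(1,4) xs(2) D(1-3) a(1,2) z y, of l2 "l1 # rs" ws] that 2 d3 by simp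
      have Z: "{xs ! d} \<subseteq> V" using z path_set[OF xs(2)] by blast
      \<comment> \<open>All components have exactly \<open>d\<close> vertices and touch at most
        \<open>(d + 1) choose s\<close> cliques. This equals (d + 1)/s times
        \<open>d choose (s - 1)\<close>, hence at most (d + 1)/(2d) \<le> 2/3 of it per
        vertex.\<close>
      have "6 * ((card C + card {xs ! d}) choose s) \<le> (5 * (d choose (s - 1))) * card C"
        if C: "comp (V - {xs ! d}) C" for C
      proof -
        have "card C < Suc d" "Suc d \<le> card C + 1"
          using comps_without_long_path[OF V(1,3) Z no _ C] 2 d3 by auto
        then have cC: "card C = d" by simp
        have "s * (Suc d choose s) = Suc d * (d choose (s - 1))"
          using times_binomial_minus1_eq[of s "Suc d"] s by simp
        then have "s * (6 * (Suc d choose s)) = (6 * Suc d) * (d choose (s - 1))" by (simp add: algebra_simps)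
        also have "6 * Suc d \<le> s * (5 * d)"
        proof -
          have "2 * (5 * d) \<le> s * (5 * d)" using s by (rule mult_le_mono1)
          moreover have "6 * Suc d \<le> 2 * (5 * d)" using d3 by simp
          ultimately show ?thesis by (rule le_trans[rotated])
        qed
        then have "(6 * Suc d) * (d choose (s - 1)) \<le> (s * (5 * d)) * (d choose (s - 1))" by (rule mult_le_mono1)
        also have "\<dots> = s * ((5 * (d choose (s - 1))) * d)" by (simp add: algebra_simps)
        finally have "6 * (Suc d choose s) \<le> (5 * (d choose (s - 1))) * d" using s by simp
        then show ?thesis using cC by simp
      qed
      then have "6 * card (cl s V) \<le> (5 * (d choose (s - 1))) * card (V - {xs ! d}) + 6 * (card {xs ! d} choose s)"
        using cliques_small_comps[OF V(1) Z] by blast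
      moreover have "card {xs ! d} choose s = 0" using s by (simp add: binomial_eq_0)
      moreover have "card (V - {xs ! d}) \<le> card V" using V(1) by (intro card_mono) auto
      then have "(5 * (d choose (s - 1))) * card (V - {xs ! d}) \<le> (5 * (d choose (s - 1))) * card V" by simp
      ultimately show ?thesis by linarith
    next
      case 3
      then have d: "d = 5" and l2: "l2 = 5" using d5 ls by auto
      then have a: "attached V D1 {xs ! 4, xs ! 9} 4" "attached V D2 {xs ! 4, xs ! 9} 4" using s1 s2 3 by auto
      have lx: "11 \<le> length xs" using H d by (simp add: host_def)
      have z: "xs ! 4 \<in> set xs" "xs ! 9 \<in> set xs" "xs ! 4 \<noteq> xs ! 9"
        using lx path_distinct[OF xs(2)] by (auto simp: nth_eq_iff_index_eq)
      have no: "length ws \<noteq> 5" if "path (V - {xs ! 4, xs ! 9}) ws" for ws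
        using two_centers[OF V(1) _ xs(2) _ D(1-3) a z that] V(3,4) 3 d by simp
      have Z: "{xs ! 4, xs ! 9} \<subseteq> V" using z path_set[OF xs(2)] by blast
      have cZ: "card {xs ! 4, xs ! 9} = 2" using z by simp
      have "6 * ((card C + card {xs ! 4, xs ! 9}) choose s) \<le> (5 * (d choose (s - 1))) * card C"
        if C: "comp (V - {xs ! 4, xs ! 9}) C" for C
      proof -
        have "card C < 5" "Suc d \<le> card C + 2"
          using comps_without_long_path[OF V(1,3) Z no _ C] cZ d by auto
        then have cC: "card C = 4" using d by simp
        \<comment> \<open>Four vertices and two centres: 6/s times \<open>5 choose (s - 1)\<close>
          cliques, at most 3/4 of it per vertex.\<close>
        have "s * (6 choose s) = 6 * (5 choose (s - 1))"
          using times_binomial_minus1_eq[of s 6] s by simp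
        then have "s * (6 * (6 choose s)) = 36 * (5 choose (s - 1))" by (simp add: algebra_simps)
        also have "36 \<le> s * 20" using s by simp
        then have "36 * (5 choose (s - 1)) \<le> (s * 20) * (5 choose (s - 1))" by (rule mult_le_mono1)
        also have "\<dots> = s * ((5 * (5 choose (s - 1))) * 4)" by (simp add: algebra_simps)
        finally have "6 * (6 choose s) \<le> (5 * (5 choose (s - 1))) * 4" using s by simp
        then show ?thesis using cC cZ d by simp
      qed
      then have "6 * card (cl s V) \<le> (5 * (d choose (s - 1))) * card (V - {xs ! 4, xs ! 9}) + 6 * (card {xs ! 4, xs ! 9} choose s)"
        using cliques_small_comps[OF V(1) Z] by blast
      moreover have "card {xs ! 4, xs ! 9} choose s \<le> 1"
        unfolding cZ using s by (cases "s = 2") (auto simp: binomial_eq_0)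
      moreover have "card (V - {xs ! 4, xs ! 9}) \<le> card V" using V(1) by (intro card_mono) auto
      then have "(5 * (d choose (s - 1))) * card (V - {xs ! 4, xs ! 9}) \<le> (5 * (d choose (s - 1))) * card V" by simp
      ultimately show ?thesis by linarith
    qed
  qed
qed

text \<open>The second alternative only describes the components, because its cliques are counted
  differently for s \<le> d and for s = d + 1.\<close>

lemma connected_special:
  assumes V: "finite V" "conn V" "\<forall>v\<in>V. d \<le> card (nb V v)" "\<not> packs V [l, l]"
    and l: "odd l" "5 \<le> l" "l = d + 2" and n: "4 * (2 * l - 1) < card V"
  shows "(\<forall>s. card (cl s V) \<le> num_cliques s {0..<card V} (GF_E [l, l] (card V))) \<or>
    (\<exists>z\<in>V. \<forall>C. comp (V - {z}) C \<longrightarrow> card C < l \<and> d \<le> card C)"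
proof -
  have hl: "l div 2 + l div 2 = Suc d" using l by presburger
  have "2 * d + 1 \<le> card V" using n l by simp
  then obtain xs where H: "host V xs d [l, l]" and xs: "longest V xs" "path V xs" "xs \<noteq> []"
    using connected_host[OF V(1-4)] by blast
  let ?U = "{v \<in> V - set xs. \<not> nb V v \<subseteq> set xs}"
  show ?thesis
  proof (cases "card ?U \<le> d + 1")
    case True
    have "admissible [l, l]" using l by (simp add: admissible_def)
    then show ?thesis using few_nonsingles[OF H _ _ True] hl n by simp
  next
    case False
    have small: "card D \<le> d + 1" if D: "comp (V - set xs) D" "2 \<le> card D" for D
    proof -
      obtain a t where "t = l - 2 \<or> t = l - 1" "attached V D {xs ! a} t" by (rule special_shape[OF H l D])
      then show ?thesis using l(3) by (auto simp: attached_def)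
    qed
    have big: "d + 1 < card ?U" using False by simp
    obtain D1 D2 where D: "comp (V - set xs) D1" "comp (V - set xs) D2" "D1 \<noteq> D2" "2 \<le> card D1" "2 \<le> card D2"
      by (rule two_nonsingle_comps[OF V(1) small big])
    obtain a1 t1 where s1: "a1 = l - 2 \<or> a1 = l - 1" "t1 = l - 2 \<or> t1 = l - 1" "a1 + t1 < length xs"
      "attached V D1 {xs ! a1} t1" "\<exists>y\<in>D1. adj y (xs ! a1)" by (rule special_shape[OF H l D(1,4)])
    obtain a2 t2 where s2: "a2 = l - 2 \<or> a2 = l - 1" "t2 = l - 2 \<or> t2 = l - 1" "a2 + t2 < length xs"
      "attached V D2 {xs ! a2} t2" "\<exists>y\<in>D2. adj y (xs ! a2)" by (rule special_shape[OF H l D(2,5)])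
    have sub: "D1 \<subseteq> V - set xs" "D2 \<subseteq> V - set xs" using comp_subset D by auto
    have dj: "D1 \<inter> D2 = {}" using comp_disjoint D by blast
    \<comment> \<open>If the two components were attached at the neighbouring positions
      \<open>l - 2\<close> and \<open>l - 1\<close>, cutting \<open>xs\<close> between them and
      extending each half into its component would give two paths on \<open>l\<close>
      vertices.\<close>
    have cross: False if B: "B1 \<subseteq> V - set xs" "B2 \<subseteq> V - set xs" "B1 \<inter> B2 = {}"
      and t: "l - 2 \<le> r1" "l - 2 \<le> r2" "l - 1 + r2 < length xs"
      and at: "attached V B1 {xs ! (l - 2)} r1" "attached V B2 {xs ! (l - 1)} r2"
      and ad: "y1 \<in> B1" "adj y1 (xs ! (l - 2))" "y2 \<in> B2" "adj y2 (xs ! (l - 1))" for B1 B2 r1 r2 y1 y2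
    proof -
      obtain u1 where u1: "path B1 u1" "length u1 = r1" "hd u1 = y1" using attached_path[OF at(1) ad(1)] by blast
      obtain u2 where u2: "path B2 u2" "length u2 = r2" "hd u2 = y2" using attached_path[OF at(2) ad(3)] by blast
      have su: "set u1 \<subseteq> B1" "set u2 \<subseteq> B2" using path_set u1 u2 by auto
      have pu: "path V u1" "path V u2" using u1 u2 B path_mono by (meson Diff_subset subset_trans)+
      have ne: "u1 \<noteq> []" "u2 \<noteq> []" using u1 u2 t l by auto
      have td: "set (take (l - 1) xs) \<inter> set (drop (l - 1) xs) = {}"
        using path_distinct[OF xs(2)] by (metis append_take_drop_id distinct_append)
      have la: "last (take (l - 1) xs) = xs ! (l - 2)"
      proof -
        have "l - 1 = Suc (l - 2)" using l by simp
        then show ?thesis using t(3) by (simp add: take_Suc_conv_app_nth)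
      qed
      have hd: "hd (drop (l - 1) xs) = xs ! (l - 1)" using t(3) by (simp add: hd_drop_conv_nth)
      let ?p = "take (l - 1) xs @ u1" and ?q = "rev u2 @ drop (l - 1) xs"
      have "set (take (l - 1) xs) \<inter> set u1 = {}" using su B(1) set_take_subset[of "l - 1" xs] by blast
      moreover have "adj (last (take (l - 1) xs)) (hd u1)" using la u1(3) ad(2) adj_sym by simp
      ultimately have "path V ?p" unfolding path_append using path_take[OF xs(2)] pu(1) by blast
      moreover have "set (rev u2) \<inter> set (drop (l - 1) xs) = {}" using su B(2) set_drop_subset[of "l - 1" xs] by auto
      then have "path V ?q" unfolding path_append path_rev last_rev hd using path_drop[OF xs(2)] pu(2) u2(3) ad(4) by blast
      moreover have "set ?p \<inter> set ?q = {}"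
        using td su B set_take_subset[of "l - 1" xs] set_drop_subset[of "l - 1" xs] by auto
      moreover have "fits [l, l] (length ?p) (length ?q)"
        using u1(2) u2(2) t l by (intro fits_pair) (auto simp: min_def)
      ultimately have "packs V [l, l]" by (rule packs_fits)
      then show False using V(4) by blast
    qed
    have eq: "a1 = a2"
    proof (rule ccontr)
      assume "a1 \<noteq> a2"
      then consider "a1 = l - 2" "a2 = l - 1" | "a1 = l - 1" "a2 = l - 2" using s1(1) s2(1) by auto
      then show False
      proof cases
        case 1
        then show False using cross[of D1 D2 t1 t2] sub dj s1 s2 by (metis diff_le_mono2 le_refl one_le_numeral)
      next
        case 2
        then show False using cross[of D2 D1 t2 t1] sub dj s1 s2 by (metis Int_commute diff_le_mono2 le_refl one_le_numeral)
      qed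
    qed
    have z: "xs ! a1 \<in> set xs" using s1(3) by simp
    obtain y1 y2 where y: "y1 \<in> D1" "adj y1 (xs ! a1)" "y2 \<in> D2" "adj y2 (xs ! a1)" using s1(5) s2(5) eq by blast
    have at2: "attached V D2 {xs ! a1} t2" using s2(4) eq by simp
    have no: "length ws \<noteq> l" if w: "path (V - {xs ! a1}) ws" for ws
      using s1(2) s2(2) l
      by (intro one_center[OF V(1,4) xs(2) D(1-3) s1(4) at2 z y, of l "[l]" ws] w) auto
    have Z: "{xs ! a1} \<subseteq> V" using z path_set[OF xs(2)] by blast
    have "card C < l \<and> d \<le> card C" if C: "comp (V - {xs ! a1}) C" for C
      using comps_without_long_path[OF V(1,3) Z no _ C] l by auto
    then show ?thesis using Z by blast
  qed
qed

end

section \<open>Numerical estimates\<close>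

text \<open>\<open>p\<close> is |F|, \<open>A\<close> the number of cliques of a complete graph on
  \<open>p - 1\<close> vertices, \<open>c\<close> the number gained per vertex of G_F,
  \<open>k\<close> the deletion threshold, and \<open>c'\<close> the saving per deleted
  vertex.\<close>

locale budget =
  fixes d s p n A c c' k :: nat
  assumes d1: "1 \<le> d" and s2: "2 \<le> s" and sd: "s \<le> d + 1" and p: "2 * d + 2 \<le> p" and dn: "d \<le> n"
    and A_def: "A = (p - 1) choose s" and c_def: "c = d choose (s - 1)"
    and c'_def: "c' = (d - 1) choose (s - 2)" and k_def: "k = (d - 1) choose (s - 1)"
    and n_large: "5 * A ^ 2 \<le> (n - d) * ((p - 1) * c)"
begin

lemma c_split: "c = k + c'"
proof -
  obtain d' where d': "d = Suc d'" using d1 by (cases d) auto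
  obtain s' where s': "s = Suc (Suc s')" using s2 by (metis Suc_le_D numeral_2_eq_2 Suc_le_mono)
  show ?thesis by (simp add: c_def k_def c'_def d' s')
qed

lemma c_pos: "1 \<le> c"
  using sd by (simp add: c_def Suc_le_eq zero_less_binomial_iff)

lemma absorb_A: "s * A = (p - 1) * ((p - 2) choose (s - 1))"
  using times_binomial_minus1_eq[of s "p - 1"] s2 by (simp add: A_def numeral_2_eq_2)

lemma absorb_c: "(s - 1) * c = d * c'"
  using times_binomial_minus1_eq[of "s - 1" d] s2 by (simp add: c_def c'_def numeral_2_eq_2)

text \<open>Since 2d \<le> p - 2, halving the upper index absorbs the factor \<open>s\<close> in the
  absorption identity for \<open>A\<close>.\<close>

lemma A_ge: "(p - 1) * c \<le> A"
proof -
  have "s * c \<le> (2 * d) choose (s - 1)" unfolding c_def using s2 by (intro mult_binomial_le) simp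
  also have "\<dots> \<le> (p - 2) choose (s - 1)" using p by (intro binomial_right_mono) simp
  finally have "(p - 1) * (s * c) \<le> s * A" unfolding absorb_A by (rule mult_le_mono2)
  then have "s * ((p - 1) * c) \<le> s * A" by (simp only: mult.left_commute)
  then show ?thesis using s2 by simp
qed

lemma cd_le: "c * d \<le> A"
proof -
  have "d \<le> p - 1" using p by linarith
  then have "d * c \<le> (p - 1) * c" by (rule mult_le_mono1)
  then have "c * d \<le> (p - 1) * c" by (simp only: mult.commute)
  then show ?thesis using A_ge by linarith
qed

text \<open>The hypothesis on \<open>n\<close> speaks of \<open>c\<close>, the savings of
  \<open>c'\<close>; the identity \<open>(s - 1) * c = d * c'\<close> translates one into the
  other.\<close>

lemma scaled:
  assumes "x * (d * (p - 1)) \<le> 5 * (A * (s - 1))"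
  shows "x * A \<le> c' * (n - d)"
proof -
  have "(x * A) * (d * (p - 1)) = A * (x * (d * (p - 1)))" by (simp only: mult.assoc mult.left_commute mult.commute)
  also have "\<dots> \<le> A * (5 * (A * (s - 1)))" using assms by (rule mult_le_mono2)
  also have "\<dots> = (5 * A ^ 2) * (s - 1)" by (simp add: power2_eq_square)
  also have "\<dots> \<le> ((n - d) * ((p - 1) * c)) * (s - 1)" using n_large by (rule mult_le_mono1)
  also have "\<dots> = (n - d) * (p - 1) * ((s - 1) * c)" by (simp only: mult.assoc mult.left_commute mult.commute)
  also have "\<dots> = (c' * (n - d)) * (d * (p - 1))" unfolding absorb_c by (simp only: mult.assoc mult.left_commute mult.commute)
  finally show ?thesis using d1 p by simp
qed

text \<open>Four of the \<open>A\<close> pay for a remainder on few vertices, the fifth for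
  \<open>c * d\<close>.\<close>

lemma five: "5 * A \<le> c' * (n - d)"
proof (rule scaled)
  have "(p - 2) choose 1 \<le> (p - 2) choose (s - 1)"
    using s2 sd p by (intro binomial_mono) auto
  then have b: "2 * d \<le> (p - 2) choose (s - 1)" using p by simp
  have "s * (d * (p - 1)) \<le> (2 * (s - 1)) * (d * (p - 1))" using s2 by (intro mult_le_mono1) simp
  also have "\<dots> = (s - 1) * ((p - 1) * (2 * d))" by (simp only: mult.assoc mult.left_commute mult.commute)
  also have "\<dots> \<le> (s - 1) * ((p - 1) * ((p - 2) choose (s - 1)))" using b by (intro mult_le_mono2)
  also have "\<dots> = s * (A * (s - 1))" unfolding absorb_A[symmetric] by (simp only: mult.assoc mult.left_commute mult.commute)
  finally have "d * (p - 1) \<le> A * (s - 1)" using s2 by simp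
  then show "5 * (d * (p - 1)) \<le> 5 * (A * (s - 1))" by (rule mult_le_mono2)
qed

text \<open>Meant for a disconnected remainder with up to \<open>p\<close> components of at most
  \<open>A\<close> cliques each, and \<open>c * d\<close>. For s \<ge> 3 the coefficient
  \<open>(p - 2) choose (s - 1)\<close> is at least quadratic in \<open>p\<close>, which makes this
  affordable.\<close>

lemma many:
  assumes "3 \<le> s"
  shows "(p + 1) * A \<le> c' * (n - d)"
proof (rule scaled)
  have d2: "2 \<le> d" using assms sd by simp
  have "(p - 2) choose 2 \<le> (p - 2) choose (s - 1)"
    using assms sd p by (intro binomial_mono) auto
  then have "2 * ((p - 2) choose 2) \<le> 2 * ((p - 2) choose (s - 1))" by simp
  moreover have "2 * ((p - 2) choose 2) = (p - 2) * (p - 3)"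
    using times_binomial_minus1_eq[of 2 "p - 2"] by simp
  ultimately have b: "(p - 2) * (p - 3) \<le> 2 * ((p - 2) choose (s - 1))" by simp
  have "(2 * d) * (p - 3) \<le> (p - 2) * (p - 3)" using p by (intro mult_le_mono1) simp
  then have "2 * (d * (p - 3)) \<le> 2 * ((p - 2) choose (s - 1))" using b mult.assoc[of 2 d "p - 3"] by linarith
  then have b2: "d * (p - 3) \<le> (p - 2) choose (s - 1)" by linarith
  have "3 * (p + 1) \<le> 10 * (p - 3)" using p d2 by simp
  then have "3 * (s * ((p + 1) * (d * (p - 1)))) \<le> s * (10 * (p - 3) * (d * (p - 1)))"
  proof -
    assume "3 * (p + 1) \<le> 10 * (p - 3)"
    then have "s * (3 * (p + 1) * (d * (p - 1))) \<le> s * (10 * (p - 3) * (d * (p - 1)))"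
      by (intro mult_le_mono2 mult_le_mono1)
    then show ?thesis by (simp only: mult.assoc mult.left_commute mult.commute)
  qed
  also have "\<dots> = (2 * s) * (5 * ((p - 1) * (d * (p - 3))))" by (simp add: algebra_simps)
  also have "\<dots> \<le> (3 * (s - 1)) * (5 * ((p - 1) * (d * (p - 3))))" using assms by (intro mult_le_mono1) simp
  also have "\<dots> \<le> (3 * (s - 1)) * (5 * ((p - 1) * ((p - 2) choose (s - 1))))" using b2 by (intro mult_le_mono2)
  also have "\<dots> = 3 * (s * (5 * (A * (s - 1))))" unfolding absorb_A[symmetric] by (simp only: mult.assoc mult.left_commute mult.commute)
  finally have "s * ((p + 1) * (d * (p - 1))) \<le> s * (5 * (A * (s - 1)))" by (rule mult_left_le_imp_le) simp
  then show "(p + 1) * (d * (p - 1)) \<le> 5 * (A * (s - 1))" using s2 by simp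
qed

text \<open>\<open>N\<close> is the total, \<open>N'\<close> the count in a remainder on
  \<open>n'\<close> vertices; with \<open>c = k + c'\<close> the third premise is what is needed
  after adding \<open>k\<close> for each deleted vertex.\<close>

lemma small_remainder:
  assumes "N \<le> N' + k * (n - n')" "n' \<le> n" "N' + c * d \<le> c' * n + k * n'"
  shows "N \<le> c * (n - d)"
proof -
  have "N + c * d \<le> N' + c * d + k * (n - n')" using assms(1) by simp
  also have "\<dots> \<le> c' * n + k * n' + k * (n - n')" using assms(3) by simp
  also have "k * n' + k * (n - n') = k * n" using assms(2) by (simp flip: add_mult_distrib2)
  then have "c' * n + k * n' + k * (n - n') = c * n" using c_split by (simp add: algebra_simps)
  finally have "N + c * d \<le> c * n" by simp
  then show ?thesis by (simp add: diff_mult_distrib2)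
qed

lemma remainder_four:
  assumes "N \<le> N' + k * (n - n')" "n' \<le> n" "N' \<le> 4 * A"
  shows "N \<le> c * (n - d)"
proof (rule small_remainder[OF assms(1,2)])
  have "N' + c * d \<le> 5 * A" using assms(3) cd_le by simp
  also have "\<dots> \<le> c' * n" using five by (meson diff_le_self le_trans mult_le_mono2)
  finally show "N' + c * d \<le> c' * n + k * n'" by simp
qed

text \<open>The missing sixth of \<open>c * n'\<close> covers \<open>c * d\<close> and the additive
  constant once \<open>n' > 8 * d + 4\<close>.\<close>

lemma remainder_sparse:
  assumes "N \<le> N' + k * (n - n')" "n' \<le> n" "6 * N' \<le> 5 * c * n' + 6" "8 * d + 4 < n'"
  shows "N \<le> c * (n - d)"
proof (rule small_remainder[OF assms(1,2)])
  have "6 * d + 6 \<le> n'" using assms(4) d1 by simp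
  then have "c * (6 * d + 6) \<le> c * n'" by (rule mult_le_mono2)
  then have "6 * (c * d) + 6 * c \<le> c * n'" by (simp add: algebra_simps)
  moreover have "6 * N' \<le> 5 * (c * n') + 6" using assms(3) by (simp only: mult.assoc)
  ultimately have "6 * (N' + c * d) \<le> 6 * (c * n')" using c_pos by simp
  then have "N' + c * d \<le> c * n'" by simp
  also have "\<dots> = c' * n' + k * n'" by (simp add: c_split algebra_simps)
  also have "\<dots> \<le> c' * n + k * n'" using assms(2) by simp
  finally show "N' + c * d \<le> c' * n + k * n'" .
qed

end

section \<open>Cliques of \<open>G\<^sub>F(n)\<close>\<close>

lemma finite_clique_family:
  "finite {K. K \<subseteq> {0..<n::nat} \<and> card K = s \<and> (\<forall>u\<in>K. \<forall>v\<in>K. u \<noteq> v \<longrightarrow> {u, v} \<in> E)}"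
  by (rule finite_subset[of _ "Pow {0..<n}"]) auto

lemma GF_edge_iff:
  assumes "u < v"
  shows "{u, v} \<in> GF_E ls n \<longleftrightarrow> v < n \<and>
     (u < delta_F ls \<or> ((\<forall>l\<in>set ls. odd l) \<and> u = delta_F ls \<and> v = Suc (delta_F ls)))"
proof
  assume "{u, v} \<in> GF_E ls n"
  then obtain a b where ab: "{u, v} = {a, b}" "a < b" "b < n"
    "a < delta_F ls \<or> ((\<forall>l\<in>set ls. odd l) \<and> a = delta_F ls \<and> b = Suc (delta_F ls))"
    unfolding GF_E_def by blast
  have "u = a" "v = b" using ab(1,2) assms by (metis doubleton_eq_iff less_asym)+
  then show "v < n \<and> (u < delta_F ls \<or> ((\<forall>l\<in>set ls. odd l) \<and> u = delta_F ls \<and> v = Suc (delta_F ls)))"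
    using ab by blast
qed (use assms in \<open>unfold GF_E_def, blast\<close>)

lemma GF_no_loop: "{v} \<notin> GF_E ls n"
proof
  assume "{v} \<in> GF_E ls n"
  then obtain a b where "{v} = {a, b}" "a < b" unfolding GF_E_def by blast
  then show False by (metis insertI1 insert_commute less_irrefl singletonD)
qed

text \<open>Each new vertex forms a clique with any \<open>s - 1\<close> vertices of the dominating
  clique.\<close>

lemma GF_cliques_step:
  assumes "delta_F ls \<le> m" "m \<le> n" "1 \<le> s"
  shows "num_cliques s {0..<m} (GF_E ls m) + (delta_F ls choose (s - 1)) * (n - m)
    \<le> num_cliques s {0..<n} (GF_E ls n)"
proof -
  let ?d = "delta_F ls"
  define Q where "Q = (\<lambda>n. {K. K \<subseteq> {0..<n} \<and> card K = s \<and> (\<forall>u\<in>K. \<forall>v\<in>K. u \<noteq> v \<longrightarrow> {u, v} \<in> GF_E ls n)})"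
  define J where "J = {J. J \<subseteq> {0..<?d} \<and> card J = s - 1}"
  define P where "P = (\<lambda>(v, J). insert v J) ` ({m..<n} \<times> J)"
  have "Q m \<subseteq> Q n"
  proof
    fix K assume K: "K \<in> Q m"
    have "GF_E ls m \<subseteq> GF_E ls n" using assms(2) unfolding GF_E_def by fastforce
    then show "K \<in> Q n" using K assms(2) by (fastforce simp: Q_def)
  qed
  moreover have "P \<subseteq> Q n"
  proof
    fix K assume "K \<in> P"
    then obtain v L where K: "K = insert v L" "m \<le> v" "v < n" "L \<subseteq> {0..<?d}" "card L = s - 1"
      by (auto simp: P_def J_def)
    have vL: "v \<notin> L" using K assms(1) by auto
    have fL: "finite L" using K finite_subset by blast
    have "{a, b} \<in> GF_E ls n" if "a \<in> K" "b \<in> K" "a < b" for a b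
    proof -
      have "\<forall>x\<in>L. x < ?d" using K(4) by auto
      then have "a < ?d" "b < n" using that K(1-3) assms(1,2) by fastforce+
      then show ?thesis by (simp add: GF_edge_iff[OF that(3)])
    qed
    then have "{a, b} \<in> GF_E ls n" if "a \<in> K" "b \<in> K" "a \<noteq> b" for a b
      using that by (metis insert_commute linorder_neqE_nat)
    moreover have "card K = s" using K vL fL assms(3) by simp
    moreover have "K \<subseteq> {0..<n}" using K assms by auto
    ultimately show "K \<in> Q n" by (simp add: Q_def)
  qed
  moreover have "Q m \<inter> P = {}" by (auto simp: Q_def P_def)
  moreover have finQ: "finite (Q n)" for n unfolding Q_def by (rule finite_clique_family)
  ultimately have "card (Q m) + card P \<le> card (Q n)"
    by (metis card_Un_disjoint card_mono finite_subset le_sup_iff)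
  moreover have "card P = (?d choose (s - 1)) * (n - m)"
  proof -
    have "inj_on (\<lambda>(v, J). insert v J) ({m..<n} \<times> J)"
    proof (rule inj_onI, clarsimp)
      fix v L v' L' assume a: "m \<le> v" "m \<le> v'" "L \<in> J" "L' \<in> J" "insert v L = insert v' L'"
      have n: "\<forall>x\<in>L. x < m" "\<forall>x\<in>L'. x < m" using a assms(1) by (auto simp: J_def)
      have "v = v'" using a n by (metis insert_iff not_le)
      moreover have "v \<notin> L" "v \<notin> L'" using n a calculation by auto
      ultimately show "v = v' \<and> L = L'" using a(5) by (metis insert_ident)
    qed
    then have "card P = card ({m..<n} \<times> J)" unfolding P_def by (rule card_image)
    moreover have "card J = ?d choose (s - 1)" unfolding J_def using n_subsets[of "{0..<?d}" "s - 1"] by simp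
    ultimately show ?thesis by (simp add: card_cartesian_product mult.commute)
  qed
  ultimately show ?thesis by (simp add: num_cliques_def Q_def)
qed

lemma GF_cliques_ge:
  assumes "delta_F ls \<le> n" "1 \<le> s"
  shows "(delta_F ls choose (s - 1)) * (n - delta_F ls) \<le> num_cliques s {0..<n} (GF_E ls n)"
  using GF_cliques_step[OF order_refl assms] by linarith

text \<open>The first \<open>d + 2\<close> vertices have at most \<open>d + 2\<close> subsets of
  size \<open>d + 1\<close>; every later vertex has at most \<open>d\<close> neighbours before it
  and adds at most one clique.\<close>

lemma GF_top_cliques_le:
  assumes "delta_F ls + 2 \<le> n"
  shows "num_cliques (delta_F ls + 1) {0..<n} (GF_E ls n) \<le> n"
proof -
  let ?d = "delta_F ls"
  interpret loopless "GF_E ls n" by unfold_locales (rule GF_no_loop)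
  have "card (cl (?d + 1) {0..<m}) \<le> m" if "?d + 2 \<le> m" "m \<le> n" for m
    using that
  proof (induction m rule: dec_induct)
    case base
    have "card (cl (?d + 1) {0..<?d + 2}) \<le> card {0..<?d + 2} choose (?d + 1)"
      by (rule card_cl_le_binomial) simp
    also have "\<dots> = Suc (Suc ?d) choose Suc ?d" by simp
    also have "\<dots> = ?d + 2" by (subst binomial_symmetric) auto
    finally show ?case .
  next
    case (step m)
    have "nb {0..<Suc m} m \<subseteq> {0..<?d}"
    proof
      fix u assume u: "u \<in> nb {0..<Suc m} m"
      then have "u < m" by (cases "u = m") (auto simp: nb_iff)
      then show "u \<in> {0..<?d}" using u step GF_edge_iff[of u m ls n] by (auto simp: nb_iff adj_def)
    qed
    then have "card (nb {0..<Suc m} m) \<le> ?d" by (metis card_atLeastLessThan card_mono diff_zero finite_atLeastLessThan)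
    then have "card (nb {0..<Suc m} m) choose (?d + 1 - 1) \<le> ?d choose (?d + 1 - 1)" by (rule binomial_right_mono)
    then have "card (touching (?d + 1) {0..<Suc m} {m}) \<le> 1"
      using card_touching_vertex[of "{0..<Suc m}" "?d + 1" m] by simp
    moreover have "{0..<Suc m} - {m} = {0..<m}" by auto
    ultimately show ?case
      using card_cl_le_Diff[of "{0..<Suc m}" "?d + 1" "{m}"] step by simp
  qed
  then show ?thesis using assms by (simp add: num_cliques_eq)
qed

section \<open>Upper bounds\<close>

context loopless
begin

lemma deletion_degree:
  assumes W: "finite W" "\<And>X. X \<subseteq> W \<Longrightarrow> X \<noteq> {} \<Longrightarrow> k * card X < card (touching s W X)"
    and k: "k = (d - 1) choose (s - 1)" and s: "1 \<le> s" and v: "v \<in> W"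
  shows "d \<le> card (nb W v)"
proof (rule ccontr)
  assume "\<not> d \<le> card (nb W v)"
  then have "card (nb W v) \<le> d - 1" by simp
  then have "card (nb W v) choose (s - 1) \<le> k" unfolding k by (rule binomial_right_mono)
  then have "card (touching s W {v}) \<le> k" using card_touching_vertex[OF W(1) s, of v] by linarith
  then show False using W(2)[of "{v}"] v by simp
qed

lemma comp_card_ge:
  assumes "finite W" "\<forall>v\<in>W. d \<le> card (nb W v)" "comp W C"
  shows "Suc d \<le> card C"
proof -
  obtain v where v: "v \<in> C" using comp_nonempty[OF assms(3)] by blast
  have fC: "finite C" using comp_subset[OF assms(3)] assms(1) finite_subset by blast
  have "nb C v \<subseteq> C - {v}" by (auto simp: nb_def)
  then have "card (nb C v) \<le> card (C - {v})" using fC by (intro card_mono) auto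
  moreover have "d \<le> card (nb C v)" using bspec[OF assms(2), of v] comp_nb[OF assms(3) v] comp_subset[OF assms(3)] v by auto
  moreover have "Suc (card (C - {v})) = card C" using fC v by (rule card_Suc_Diff1)
  ultimately show ?thesis by linarith
qed

lemma packs_distinct_comps:
  assumes "distinct Cs" "length Cs = length ks" "\<forall>C\<in>set Cs. comp W C" "\<forall>C\<in>set Cs. \<forall>k\<in>set ks. packs C [k]"
  shows "packs (\<Union> (set Cs)) ks"
  using assms
proof (induction Cs ks rule: list_induct2')
  case (4 C Cs k ks)
  have "packs (\<Union> (set Cs)) ks" using 4 by auto
  moreover have "packs C [k]" using 4 by simp
  moreover have "C \<inter> \<Union> (set Cs) = {}"
  proof (rule ccontr)
    assume "C \<inter> \<Union> (set Cs) \<noteq> {}"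
    then obtain C' where "C' \<in> set Cs" "C \<inter> C' \<noteq> {}" by blast
    then show False using 4 comp_eq by auto
  qed
  ultimately have "packs (\<Union> (set (C # Cs))) ([k] @ ks)" by (intro packs_append) auto
  then show ?case by simp
qed auto

text \<open>A path on \<open>l1\<close> vertices meets at most \<open>l1\<close> components;
  \<open>length ks\<close> further components would each host one of the remaining paths.\<close>

lemma few_comps:
  assumes V: "\<not> packs V (l1 # ks)" "W \<subseteq> V" "finite V"
    and ws: "path V ws" "length ws = l1"
    and C: "\<And>C k. comp W C \<Longrightarrow> k \<in> set ks \<Longrightarrow> packs C [k]"
  shows "card {C. comp W C} < l1 + length ks"
proof (rule ccontr)
  assume n: "\<not> card {C. comp W C} < l1 + length ks"
  have fW: "finite W" using V(2,3) finite_subset by blast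
  have fin: "finite {C. comp W C}" using finite_comps[OF fW] .
  define H where "H = {C. comp W C \<and> C \<inter> set ws \<noteq> {}}"
  have HC: "H \<subseteq> {C. comp W C}" by (auto simp: H_def)
  have fH: "finite H" using HC fin finite_subset by blast
  define f where "f = (\<lambda>C. SOME x. x \<in> C \<inter> set ws)"
  have f: "f C \<in> C \<inter> set ws" if "C \<in> H" for C
    unfolding f_def using that by (metis (mono_tags, lifting) H_def all_not_in_conv mem_Collect_eq someI_ex)
  have "inj_on f H"
  proof (rule inj_onI)
    fix C C' assume CC: "C \<in> H" "C' \<in> H" "f C = f C'"
    then have "C \<inter> C' \<noteq> {}" using f by (metis IntD1 IntI empty_iff)
    then show "C = C'" using CC comp_eq by (auto simp: H_def)
  qed
  moreover have "f ` H \<subseteq> set ws" using f by blast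
  ultimately have "card H \<le> card (set ws)" by (simp add: card_inj_on_le)
  then have "card H \<le> l1" using card_length[of ws] ws(2) by linarith
  then have "length ks \<le> card ({C. comp W C} - H)"
    using n HC fH by (simp add: card_Diff_subset)
  then obtain Cs where Cs: "distinct Cs" "set Cs \<subseteq> {C. comp W C} - H" "length Cs = length ks"
    using distinct_list_of_card[of "{C. comp W C} - H"] fin by blast
  have "packs (\<Union> (set Cs)) ks"
    using Cs C by (intro packs_distinct_comps[where W = W]) auto
  moreover have "packs (set ws) [l1]" using packs_path[OF ws(1), of "[l1]"] ws(2) by simp
  moreover have "\<Union> (set Cs) \<inter> set ws = {}" using Cs(2) by (auto simp: H_def)
  moreover have "\<Union> (set Cs) \<subseteq> V"
  proof -
    have "C \<subseteq> V" if "C \<in> set Cs" for C using that Cs(2) comp_subset[of W C] V(2) by auto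
    then show ?thesis by blast
  qed
  ultimately have "packs V ([l1] @ ks)"
    using path_set[OF ws(1)] by (intro packs_append[of "set ws" _ "\<Union> (set Cs)"]) auto
  then show False using V(1) by simp
qed

text \<open>For \<open>s = 2\<close> the slope \<open>d - 1\<close> is the deletion threshold: on at
  most \<open>2 * d\<close> vertices a component exceeds the threshold rate by at most
  \<open>d\<close> edges. For general \<open>s\<close> the cruder second bound suffices.\<close>

lemma many_small_comps:
  assumes W: "finite W" "\<And>C. comp W C \<Longrightarrow> card C \<le> 2 * d" and M: "card {C. comp W C} \<le> M" and d: "1 \<le> d"
  shows "card (cl 2 W) \<le> (d - 1) * card W + M * d"
    and "1 \<le> s \<Longrightarrow> card (cl s W) \<le> M * ((2 * d) choose s)"
proof -
  have fC: "finite C" if "comp W C" for C using comp_subset[OF that] W(1) finite_subset by blast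
  have "card (cl 2 W) \<le> (\<Sum>C | comp W C. card (cl 2 C))" using card_cl_le_sum_comps[OF W(1)] by simp
  also have "\<dots> \<le> (\<Sum>C | comp W C. (d - 1) * card C + d)"
  proof (rule sum_mono)
    fix C assume "C \<in> {C. comp W C}"
    then have C: "comp W C" by simp
    obtain e where e: "d = Suc e" using d by (cases d) auto
    let ?h = "card C"
    have "2 * (?h choose 2) = ?h * (?h - 1)" using times_binomial_minus1_eq[of 2 ?h] by simp
    moreover have "?h * (?h - 1) \<le> ?h * (2 * e + 1)" using W(2)[OF C] e by (intro mult_le_mono2) simp
    moreover have "?h * (2 * e + 1) = 2 * (e * ?h) + ?h" by (simp add: algebra_simps)
    ultimately have "2 * (?h choose 2) \<le> 2 * (e * ?h) + ?h" by metis
    then have "2 * (?h choose 2) \<le> 2 * (e * ?h + d)" using W(2)[OF C] by simp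
    then have "?h choose 2 \<le> e * ?h + d" by simp
    then show "card (cl 2 C) \<le> (d - 1) * ?h + d"
      using card_cl_le_binomial[OF fC[OF C], of 2] e by simp
  qed
  also have "\<dots> = (d - 1) * (\<Sum>C | comp W C. card C) + card {C. comp W C} * d"
    by (simp add: sum.distrib sum_distrib_left)
  also have "(\<Sum>C | comp W C. card C) = card W"
  proof -
    have "card (\<Union> {C. comp W C}) = (\<Sum>C | comp W C. card C)"
      using fC comp_disjoint by (intro card_Union_disjoint) (auto simp: pairwise_def disjnt_def)
    then show ?thesis using Union_comps[OF W(1)] by simp
  qed
  also have "(d - 1) * card W + card {C. comp W C} * d \<le> (d - 1) * card W + M * d" using M by simp
  finally show "card (cl 2 W) \<le> (d - 1) * card W + M * d" .
  assume "1 \<le> s"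
  then have "card (cl s W) \<le> (\<Sum>C | comp W C. card (cl s C))" using card_cl_le_sum_comps[OF W(1)] by simp
  also have "\<dots> \<le> (\<Sum>C | comp W C. (2 * d) choose s)"
  proof (rule sum_mono)
    fix C assume "C \<in> {C. comp W C}"
    then have C: "comp W C" by simp
    have "card (cl s C) \<le> card C choose s" using card_cl_le_binomial[OF fC[OF C]] .
    also have "\<dots> \<le> (2 * d) choose s" using W(2)[OF C] by (rule binomial_right_mono)
    finally show "card (cl s C) \<le> (2 * d) choose s" .
  qed
  also have "\<dots> = card {C. comp W C} * ((2 * d) choose s)" by simp
  also have "\<dots> \<le> M * ((2 * d) choose s)" using M by (rule mult_le_mono1)
  finally show "card (cl s W) \<le> M * ((2 * d) choose s)" .
qed

lemma small_graph_cliques: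
  assumes W: "finite W" "\<not> packs W ls" "card W \<le> 4 * (sum_list ls - 1)" and s: "1 \<le> s" and p: "2 \<le> sum_list ls"
  shows "card (cl s W) \<le> 4 * ((sum_list ls - 1) choose s)"
proof -
  have "\<forall>xs. path W xs \<longrightarrow> length xs < sum_list ls"
    using packs_path packs_mono path_set W(2) by (meson not_less)
  then have "(sum_list ls - 1) * card (cl s W) \<le> card W * ((sum_list ls - 1) choose s)"
    by (intro path_free_cliques[OF W(1) s p])
  also have "\<dots> \<le> 4 * (sum_list ls - 1) * ((sum_list ls - 1) choose s)" using W(3) by (rule mult_le_mono1)
  also have "\<dots> = (sum_list ls - 1) * (4 * ((sum_list ls - 1) choose s))" by simp
  finally have "(sum_list ls - 1) * card (cl s W) \<le> (sum_list ls - 1) * (4 * ((sum_list ls - 1) choose s))" .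
  moreover have "0 < sum_list ls - 1" using p by simp
  ultimately show ?thesis by (rule mult_left_le_imp_le)
qed

lemma upper_nonspecial:
  assumes V: "finite V" "card V = n" "\<not> packs V ls"
    and f: "forest ls l1 l2 rs (Suc d) q" and ns: "\<not> (rs = [] \<and> l1 = l2 \<and> odd l1)"
    and b: "budget d s (sum_list ls) n A c c' k"
  shows "card (cl s V) \<le> num_cliques s {0..<n} (GF_E ls n) \<or> (\<forall>xs. path V xs \<longrightarrow> length xs \<noteq> l1)"
proof (rule disjCI)
  assume "\<not> (\<forall>xs. path V xs \<longrightarrow> length xs \<noteq> l1)"
  then obtain ws where ws: "path V ws" "length ws = l1" by blast
  interpret forest ls l1 l2 rs "Suc d" q by (rule f)
  interpret budget d s "sum_list ls" n A c c' k by (rule b)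
  let ?p = "sum_list ls"
  have s1: "1 \<le> s" using s2 by simp
  have dF: "delta_F ls = d" using h_def by (simp add: delta_F_def)
  obtain W where W: "W \<subseteq> V" "card (cl s V) \<le> card (cl s W) + k * card (V - W)"
    "\<And>X. X \<subseteq> W \<Longrightarrow> X \<noteq> {} \<Longrightarrow> k * card X < card (touching s W X)"
    using deletion[OF V(1)] by blast
  have fW: "finite W" using W(1) V(1) finite_subset by blast
  let ?n = "card W"
  have nn: "?n \<le> n" using W(1) V card_mono by blast
  have "card (V - W) = n - ?n" using V(2) W(1) fW card_Diff_subset by blast
  then have N: "card (cl s V) \<le> card (cl s W) + k * (n - ?n)" using W(2) by simp
  have deg: "\<forall>v\<in>W. d \<le> card (nb W v)" using deletion_degree[OF fW W(3) k_def s1] by blast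
  have np: "\<not> packs W ls" using V(3) W(1) packs_mono by blast
  have GF: "c * (n - d) \<le> num_cliques s {0..<n} (GF_E ls n)"
    using GF_cliques_ge[of ls n s] dF dn s1 by (simp add: c_def)
  show "card (cl s V) \<le> num_cliques s {0..<n} (GF_E ls n)"
  proof (cases "?n \<le> 4 * (?p - 1)")
    case True
    have "card (cl s W) \<le> 4 * A"
      unfolding A_def using small_graph_cliques[OF fW np True s1] p by simp
    then show ?thesis using remainder_four[OF N nn] GF by linarith
  next
    case False
    then have big: "4 * (?p - 1) < ?n" by simp
    have n8: "8 * d + 4 < ?n" using big p by simp
    show ?thesis
    proof (cases "conn W")
      case True
      show ?thesis
        using connected_nonspecial[OF fW True deg np f ns big s2]
      proof
        assume a: "card (cl s W) \<le> num_cliques s {0..<?n} (GF_E ls ?n)"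
        have "num_cliques s {0..<?n} (GF_E ls ?n) + c * (n - ?n) \<le> num_cliques s {0..<n} (GF_E ls n)"
          using GF_cliques_step[of ls ?n n s] dF n8 nn s1 by (simp add: c_def)
        moreover have "k * (n - ?n) \<le> c * (n - ?n)" using c_split by (intro mult_le_mono1) simp
        ultimately show ?thesis using a N by linarith
      next
        assume "6 * card (cl s W) \<le> 5 * (d choose (s - 1)) * ?n + 6"
        then show ?thesis using remainder_sparse[OF N nn _ n8] GF by (simp add: c_def)
      qed
    next
      case nc: False
      have cge: "Suc d \<le> card C" if "comp W C" for C using comp_card_ge[OF fW deg that] .
      have l2d: "l2 \<le> Suc d" using l2_cases[OF ns] .
      \<comment> \<open>A larger component has a path on \<open>2 * d + 1\<close> vertices and any
        other component one on \<open>d + 1\<close>; by \<open>fits_half\<close> these two hold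
        F.\<close>
      have small: "card C \<le> 2 * d" if C: "comp W C" for C
      proof (rule ccontr)
        assume n: "\<not> card C \<le> 2 * d"
        obtain xs where xs: "path C xs" "min (card C) (2 * d + 1) \<le> length xs"
          using comp_card_le_path[OF fW C deg] by blast
        have "C \<noteq> W" using nc C comp_conn by blast
        then obtain v where v: "v \<in> W" "v \<notin> C" using comp_subset[OF C] by blast
        obtain C' where C': "comp W C'" "v \<in> C'" using comp_exists[OF fW v(1)] by blast
        obtain ys where ys: "path C' ys" "min (card C') (2 * d + 1) \<le> length ys"
          using comp_card_le_path[OF fW C'(1) deg] by blast
        have "C \<inter> C' = {}" using comp_disjoint[OF C C'(1)] v C' by blast
        then have "set xs \<inter> set ys = {}" using path_set[OF xs(1)] path_set[OF ys(1)] by blast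
        moreover have "path W xs" "path W ys"
          using xs ys path_mono comp_subset C C'(1) by blast+
        moreover have "2 * Suc d - 1 \<le> length xs" "Suc d \<le> length ys"
          using xs(2) ys(2) n cge[OF C'(1)] d1 by auto
        then have "fits ls (length xs) (length ys)" using fits_mono[OF fits_half[OF ns]] by blast
        ultimately show False using packs_fits np by blast
      qed
      \<comment> \<open>Every length but the first is at most \<open>l2 \<le> d + 1\<close>, and
        each component has a path with that many vertices.\<close>
      have "packs C [x]" if C: "comp W C" and x: "x \<in> set (l2 # rs)" for C x
      proof -
        obtain xs where xs: "path C xs" "min (card C) (2 * d + 1) \<le> length xs"
          using comp_card_le_path[OF fW C deg] by blast
        have "x \<le> l2" using x rs by auto
        then have "x \<le> length xs" using xs(2) cge[OF C] l2d d1 by auto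
        then have "packs (set xs) [x]" using packs_path[OF xs(1), of "[x]"] by simp
        then show ?thesis using path_set[OF xs(1)] packs_mono by blast
      qed
      then have "card {C. comp W C} < l1 + length (l2 # rs)"
        using V(3) ls by (intro few_comps[OF _ W(1) V(1) ws]) auto
      moreover have "length (l2 # rs) \<le> sum_list (l2 # rs)"
      proof -
        have "length xs \<le> sum_list xs" if "\<forall>x\<in>set xs. 1 \<le> x" for xs :: "nat list"
          using that by (induction xs) auto
        moreover have "\<forall>x\<in>set (l2 # rs). 1 \<le> x" using ge ls by auto
        ultimately show ?thesis by blast
      qed
      moreover have "?p = l1 + sum_list (l2 # rs)" using ls by simp
      ultimately have M: "card {C. comp W C} \<le> ?p" by linarith
      have ms1: "card (cl 2 W) \<le> (d - 1) * ?n + ?p * d"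
        by (rule many_small_comps(1)[OF fW _ M d1]) (rule small)
      have ms2: "card (cl s W) \<le> ?p * ((2 * d) choose s)"
        by (rule many_small_comps(2)[OF fW _ M d1 s1]) (rule small)
      have "card (cl s W) + c * d \<le> c' * n + k * ?n"
      \<comment> \<open>For \<open>s = 2\<close> the saving \<open>c'\<close> is only 1, too little
        for \<open>many\<close>, but there the components exceed the threshold rate only
        slightly.\<close>
      proof (cases "s = 2")
        case True
        have c1: "c = d" "c' = 1" "k = d - 1" using True by (auto simp: c_def c'_def k_def)
        have "(?p - 1) * d \<le> A" using A_ge c1 by simp
        moreover have "5 * A \<le> n - d" using five c1(2) by simp
        ultimately have "5 * ((?p - 1) * d) \<le> n" by linarith
        moreover have "?p * d + d * d \<le> 5 * ((?p - 1) * d)"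
        proof -
          have "?p + d \<le> 5 * (?p - 1)" using p d1 by simp
          then have "(?p + d) * d \<le> (5 * (?p - 1)) * d" by (rule mult_le_mono1)
          then show ?thesis by (simp only: add_mult_distrib mult.assoc)
        qed
        ultimately show ?thesis using ms1 True c1 by simp
      next
        case False
        then have "(?p + 1) * A \<le> c' * (n - d)" using s2 by (intro many) simp
        moreover have "c' * (n - d) \<le> c' * n" by simp
        moreover have "(2 * d) choose s \<le> A" unfolding A_def using p by (intro binomial_right_mono) simp
        then have "?p * ((2 * d) choose s) \<le> ?p * A" by (rule mult_le_mono2)
        then have "card (cl s W) \<le> ?p * A" using ms2 by linarith
        moreover have "(?p + 1) * A = ?p * A + A" by simp
        ultimately show ?thesis using cd_le by linarith
      qed
      then show ?thesis using small_remainder[OF N nn] GF by linarith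
    qed
  qed
qed

text \<open>A component on \<open>d + 1\<close> vertices is within the deletion threshold. After
  absorption this reduces to d \<le> (d - s + 1)s, true for s \<le> d.\<close>

lemma binomial_clique_comp_le:
  assumes "2 \<le> s" "s \<le> d"
  shows "(d + 1) choose s \<le> ((d - 1) choose (s - 1)) * (d + 1)"
proof -
  have e1: "s * ((d + 1) choose s) = (d + 1) * (d choose (s - 1))"
    using times_binomial_minus1_eq[of s "d + 1"] assms by simp
  have e2: "(d - (s - 1)) * (d choose (s - 1)) = d * ((d - 1) choose (s - 1))"
    by (rule binomial_absorb_comp)
  obtain u where u: "d = s + u" using assms(2) le_Suc_ex by blast
  have d: "d \<le> (d - (s - 1)) * s"
  proof -
    have "d - (s - 1) = u + 1" using u assms by simp
    moreover have "u \<le> u * s" using assms(1) by simp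
    ultimately show ?thesis using u by simp
  qed
  have "(d - (s - 1)) * (s * ((d + 1) choose s)) = (d + 1) * (d * ((d - 1) choose (s - 1)))"
    unfolding e1 e2[symmetric] by (simp only: mult.assoc mult.left_commute mult.commute)
  also have "\<dots> = d * (((d - 1) choose (s - 1)) * (d + 1))" by (simp only: mult.assoc mult.left_commute mult.commute)
  also have "\<dots> \<le> ((d - (s - 1)) * s) * (((d - 1) choose (s - 1)) * (d + 1))" using d by (rule mult_le_mono1)
  finally have "((d - (s - 1)) * s) * ((d + 1) choose s) \<le> ((d - (s - 1)) * s) * (((d - 1) choose (s - 1)) * (d + 1))"
    by (simp only: mult.assoc)
  moreover have "0 < (d - (s - 1)) * s" using assms by simp
  ultimately show ?thesis by (rule mult_left_le_imp_le)
qed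

text \<open>A component on \<open>h\<close> vertices together with its centre stays below 5/6 of the
  rate \<open>d choose (s - 1)\<close>; for \<open>h = d + 1\<close> this needs 2d \<le> (d - s +
  2)s.\<close>

lemma binomial_sparse_le:
  assumes "2 \<le> s" "s \<le> d" "3 \<le> d" "h = d \<or> h = d + 1"
  shows "6 * ((h + 1) choose s) \<le> 5 * (d choose (s - 1)) * h"
  using assms(4)
proof
  assume h: "h = d"
  have "s * (6 * ((d + 1) choose s)) = (6 * (d + 1)) * (d choose (s - 1))"
    using times_binomial_minus1_eq[of s "d + 1"] assms by (simp add: algebra_simps)
  also have "6 * (d + 1) \<le> s * (5 * d)"
  proof -
    have "6 * (d + 1) \<le> 2 * (5 * d)" using assms by simp
    also have "\<dots> \<le> s * (5 * d)" using assms(1) by (rule mult_le_mono1)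
    finally show ?thesis .
  qed
  then have "(6 * (d + 1)) * (d choose (s - 1)) \<le> (s * (5 * d)) * (d choose (s - 1))" by (rule mult_le_mono1)
  also have "\<dots> = s * (5 * (d choose (s - 1)) * d)" by (simp add: algebra_simps)
  finally have "6 * ((d + 1) choose s) \<le> 5 * (d choose (s - 1)) * d" using assms(1) by simp
  then show ?thesis using h by simp
next
  assume h: "h = d + 1"
  have e1: "s * ((d + 2) choose s) = (d + 2) * ((d + 1) choose (s - 1))"
    using times_binomial_minus1_eq[of s "d + 2"] assms by simp
  have e2: "(d + 1 - (s - 1)) * ((d + 1) choose (s - 1)) = (d + 1) * (d choose (s - 1))"
    using binomial_absorb_comp[of "d + 1" "s - 1"] by simp
  obtain u where u: "d = s + u" using assms(2) le_Suc_ex by blast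
  let ?v = "d + 1 - (s - 1)"
  have "2 * d \<le> ?v * s"
  proof -
    have v: "?v = u + 2" using u assms by simp
    have "2 * u \<le> u * s" using assms(1) by simp
    then show ?thesis unfolding v using u by (simp add: algebra_simps)
  qed
  then have "6 * (d + 2) \<le> 5 * (?v * s)" using assms(3) by simp
  then have le: "(6 * (d + 2)) * ((d + 1) * (d choose (s - 1))) \<le> (5 * (?v * s)) * ((d + 1) * (d choose (s - 1)))"
    by (rule mult_le_mono1)
  have "(?v * s) * (6 * ((d + 2) choose s)) = 6 * (?v * (s * ((d + 2) choose s)))"
    by (simp only: mult.assoc mult.left_commute mult.commute)
  also have "\<dots> = (6 * (d + 2)) * (?v * ((d + 1) choose (s - 1)))" unfolding e1
    by (simp only: mult.assoc mult.left_commute mult.commute)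
  also have "\<dots> = (6 * (d + 2)) * ((d + 1) * (d choose (s - 1)))" unfolding e2 ..
  also note le
  also have "(5 * (?v * s)) * ((d + 1) * (d choose (s - 1))) = (?v * s) * (5 * (d choose (s - 1)) * (d + 1))"
    by (simp only: mult.assoc mult.left_commute mult.commute)
  finally have "(?v * s) * (6 * ((d + 2) choose s)) \<le> (?v * s) * (5 * (d choose (s - 1)) * (d + 1))" .
  moreover have "0 < ?v * s" using assms by simp
  ultimately have "6 * ((d + 2) choose s) \<le> 5 * (d choose (s - 1)) * (d + 1)" by (rule mult_left_le_imp_le)
  then show ?thesis using h by simp
qed

lemma two_long_comps:
  assumes W: "finite W" "\<forall>v\<in>W. d \<le> card (nb W v)" "\<not> packs W [l, l]" and l: "l \<le> 2 * d + 1"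
    and C: "comp W C" "comp W C'" "l \<le> card C" "l \<le> card C'"
  shows "C = C'"
proof (rule ccontr)
  assume ne: "C \<noteq> C'"
  obtain xs where xs: "path C xs" "min (card C) (2 * d + 1) \<le> length xs"
    using comp_card_le_path[OF W(1) C(1) W(2)] by blast
  obtain ys where ys: "path C' ys" "min (card C') (2 * d + 1) \<le> length ys"
    using comp_card_le_path[OF W(1) C(2) W(2)] by blast
  have "C \<inter> C' = {}" using comp_disjoint[OF C(1,2) ne] .
  then have "set xs \<inter> set ys = {}" using path_set[OF xs(1)] path_set[OF ys(1)] by blast
  moreover have "path W xs" "path W ys" using xs ys path_mono comp_subset C by blast+
  moreover have "fits [l, l] (length xs) (length ys)" using xs(2) ys(2) l C by (intro fits_pair) auto
  ultimately show False using packs_fits W(3) by blast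
qed

lemma upper_special:
  assumes V: "finite V" "card V = n" "\<not> packs V [l, l]" and l: "odd l" "5 \<le> l" "l = d + 2" and sd': "s \<le> d"
    and b: "budget d s (2 * l) n A c c' k"
  shows "card (cl s V) \<le> num_cliques s {0..<n} (GF_E [l, l] n)"
proof -
  interpret budget d s "2 * l" n A c c' k by (rule b)
  let ?ls = "[l, l]"
  have s1: "1 \<le> s" using s2 by simp
  have "l div 2 + l div 2 = Suc d" using l by presburger
  then have dF: "delta_F ?ls = d" by (simp add: delta_F_def)
  obtain W where W: "W \<subseteq> V" "card (cl s V) \<le> card (cl s W) + k * card (V - W)"
    "\<And>X. X \<subseteq> W \<Longrightarrow> X \<noteq> {} \<Longrightarrow> k * card X < card (touching s W X)"
    using deletion[OF V(1)] by blast
  have fW: "finite W" using W(1) V(1) finite_subset by blast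
  let ?n = "card W"
  have nn: "?n \<le> n" using W(1) V card_mono by blast
  have "card (V - W) = n - ?n" using V(2) W(1) fW card_Diff_subset by blast
  then have N: "card (cl s V) \<le> card (cl s W) + k * (n - ?n)" using W(2) by simp
  have deg: "\<forall>v\<in>W. d \<le> card (nb W v)" using deletion_degree[OF fW W(3) k_def s1] by blast
  have np: "\<not> packs W ?ls" using V(3) W(1) packs_mono by blast
  have GF: "c * (n - d) \<le> num_cliques s {0..<n} (GF_E ?ls n)"
    using GF_cliques_ge[of ?ls n s] dF dn s1 by (simp add: c_def)
  show ?thesis
  proof (cases "?n \<le> 4 * (2 * l - 1)")
    case True
    have "card (cl s W) \<le> 4 * A"
      unfolding A_def using small_graph_cliques[OF fW np _ s1] True l by (simp add: mult_2)
    then show ?thesis using remainder_four[OF N nn] GF by linarith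
  next
    case False
    then have big: "4 * (2 * l - 1) < ?n" by simp
    have n8: "8 * d + 4 < ?n" using big p by simp
    have cW: "conn W"
    proof (rule ccontr)
      assume nc: "\<not> conn W"
      \<comment> \<open>A component on \<open>d + 1 = l - 1\<close> vertices would have been deleted
        as a set. So all components have at least \<open>l\<close> vertices, and two of them would
        contain F.\<close>
      have cge: "l \<le> card C" if C: "comp W C" for C
      proof (rule ccontr)
        assume "\<not> l \<le> card C"
        then have cC: "card C = d + 1" using comp_card_ge[OF fW deg C] l by simp
        have "card (touching s W C) \<le> (d + 1) choose s" using card_touching_comp[of W "{}" C s] fW C cC by simp
        also have "\<dots> \<le> k * card C" unfolding k_def cC using s2 sd' by (rule binomial_clique_comp_le)
        finally show False using W(3)[of C] comp_subset[OF C] comp_nonempty[OF C] by simp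
      qed
      have "W \<noteq> {}" using n8 by auto
      then obtain v where "v \<in> W" by blast
      then obtain C where C: "comp W C" using comp_exists[OF fW] by blast
      then have "C \<noteq> W" using nc comp_conn by blast
      then obtain v where v: "v \<in> W" "v \<notin> C" using comp_subset[OF C] by blast
      obtain C' where C': "comp W C'" "v \<in> C'" using comp_exists[OF fW v(1)] by blast
      then have "C = C'" using two_long_comps[OF fW deg np _ C C'(1)] cge C l by simp
      then show False using v C' by blast
    qed
    from connected_special[OF fW cW deg np l big] show ?thesis
    proof (elim disjE)
      assume "\<forall>s. card (cl s W) \<le> num_cliques s {0..<?n} (GF_E ?ls ?n)"
      then have a: "card (cl s W) \<le> num_cliques s {0..<?n} (GF_E ?ls ?n)" by blast
      have "num_cliques s {0..<?n} (GF_E ?ls ?n) + c * (n - ?n) \<le> num_cliques s {0..<n} (GF_E ?ls n)"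
        using GF_cliques_step[of ?ls ?n n s] dF n8 nn s1 by (simp add: c_def)
      moreover have "k * (n - ?n) \<le> c * (n - ?n)" using c_split by (intro mult_le_mono1) simp
      ultimately show ?thesis using a N by linarith
    next
      assume "\<exists>z\<in>W. \<forall>C. comp (W - {z}) C \<longrightarrow> card C < l \<and> d \<le> card C"
      then obtain z where z: "z \<in> W" "\<forall>C. comp (W - {z}) C \<longrightarrow> card C < l \<and> d \<le> card C" by blast
      have "6 * ((card C + card {z}) choose s) \<le> (5 * c) * card C" if C: "comp (W - {z}) C" for C
      proof -
        have "card C < l" "d \<le> card C" using z(2) C by auto
        then have "card C = d \<or> card C = d + 1" using l by linarith
        then show ?thesis unfolding c_def using binomial_sparse_le[OF s2 sd'] l by simp
      qed
      then have "6 * card (cl s W) \<le> (5 * c) * card (W - {z}) + 6 * (card {z} choose s)"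
        using cliques_small_comps[OF fW, of "{z}"] z(1) by blast
      moreover have "card {z} choose s = 0" using s2 by (simp add: binomial_eq_0)
      moreover have "card (W - {z}) \<le> ?n" using fW by (intro card_mono) auto
      then have "(5 * c) * card (W - {z}) \<le> (5 * c) * ?n" by (rule mult_le_mono2)
      ultimately have "6 * card (cl s W) \<le> 5 * c * ?n + 6" by linarith
      then show ?thesis using remainder_sparse[OF N nn _ n8] GF by simp
    qed
  qed
qed

end

section \<open>The case \<open>F = 2P\<^sub>l\<close>, \<open>l\<close> odd, \<open>s = \<delta>\<^sub>F + 1\<close>\<close>

text \<open>\<open>top_count l (n - 1)\<close> is the number of \<open>K\<^sub>l\<^sub>-\<^sub>1\<close> in the \<open>n\<close>-vertex graph that arises from disjoint copies of
  \<open>K\<^sub>l\<^sub>-\<^sub>1\<close> and one smaller clique by joining a new vertex.\<close>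

definition top_count :: "nat \<Rightarrow> nat \<Rightarrow> nat" where
  "top_count l N = N div (l - 1) * l + (if N mod (l - 1) = l - 2 then 1 else 0)"

lemma top_count_add:
  assumes "3 \<le> l"
  shows "top_count l (N + (l - 1)) = top_count l N + l"
proof -
  have "(N + (l - 1)) div (l - 1) = N div (l - 1) + 1" "(N + (l - 1)) mod (l - 1) = N mod (l - 1)"
    using assms by (simp_all only: mod_add_self2) (rule div_add_self2, simp)
  then show ?thesis unfolding top_count_def by (simp only: add_mult_distrib)
qed

lemma top_count_Suc:
  assumes "3 \<le> l"
  shows "top_count l N \<le> top_count l (Suc N)" "top_count l (Suc N) + 1 \<le> top_count l N + l"
proof -
  have "top_count l N \<le> top_count l (Suc N) \<and> top_count l (Suc N) + 1 \<le> top_count l N + l"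
  proof (cases "N mod (l - 1) = l - 2")
    case True
    then have e: "Suc (N mod (l - 1)) = l - 1" using assms by simp
    then have "Suc N mod (l - 1) = 0" "Suc N div (l - 1) = Suc (N div (l - 1))"
      by (simp_all add: mod_Suc div_Suc)
    then show ?thesis using True assms by (simp add: top_count_def)
  next
    case False
    moreover have "N mod (l - 1) < l - 1" using assms by simp
    ultimately have "Suc (N mod (l - 1)) \<noteq> l - 1" using assms by simp
    then have "Suc N div (l - 1) = N div (l - 1)" by (simp add: div_Suc mod_Suc)
    then show ?thesis using False assms by (simp add: top_count_def)
  qed
  then show "top_count l N \<le> top_count l (Suc N)" "top_count l (Suc N) + 1 \<le> top_count l N + l" by auto
qed

lemma top_count_mono: "3 \<le> l \<Longrightarrow> M \<le> N \<Longrightarrow> top_count l M \<le> top_count l N"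
  using lift_Suc_mono_le[of "top_count l"] top_count_Suc(1) by blast

text \<open>A block that is one vertex short still forms one clique with the centre.\<close>

lemma top_count_add_less:
  assumes "3 \<le> l"
  shows "top_count l N + 1 \<le> top_count l (N + (l - 2))"
proof -
  have "Suc (N + (l - 2)) = N + (l - 1)" using assms by simp
  then have "top_count l (N + (l - 1)) + 1 \<le> top_count l (N + (l - 2)) + l"
    using top_count_Suc(2)[OF assms, of "N + (l - 2)"] by (simp only:)
  then show ?thesis using top_count_add[OF assms, of N] by linarith
qed

lemma top_count_blocks: "3 \<le> l \<Longrightarrow> top_count l N + m \<le> top_count l (N + m * (l - 1))"
proof (induction m)
  case (Suc m)
  have "N + Suc m * (l - 1) = (N + m * (l - 1)) + (l - 1)" by simp
  then have "top_count l (N + Suc m * (l - 1)) = top_count l (N + m * (l - 1)) + l"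
    using top_count_add[OF Suc.prems] by metis
  then show ?case using Suc by simp
qed simp

text \<open>Each full block has one clique more than vertices, so \<open>l - 2\<close> full blocks
  make up for the incomplete one and for the centre.\<close>

lemma top_count_ge:
  assumes "3 \<le> l" "(l - 2) * (l - 1) < n"
  shows "n \<le> top_count l (n - 1)"
proof -
  let ?D = "(n - 1) div (l - 1)" and ?r = "(n - 1) mod (l - 1)"
  have n: "n - 1 = ?D * (l - 1) + ?r" by (rule div_mult_mod_eq[symmetric])
  have r: "?r < l - 1" using assms by simp
  have "l - 2 \<le> ?D" using assms by (simp add: less_eq_div_iff_mult_less_eq)
  moreover have "?D * l = ?D * (l - 1) + ?D"
  proof -
    have "l = (l - 1) + 1" using assms by simp
    then show ?thesis by (metis add_mult_distrib2 nat_mult_1_right)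
  qed
  moreover have "?r + 1 \<le> l - 2 + (if ?r = l - 2 then 1 else 0)" using r by auto
  ultimately have "?D * (l - 1) + ?r + 1 \<le> top_count l (n - 1)" unfolding top_count_def by linarith
  then show ?thesis using n assms by linarith
qed

context loopless
begin

text \<open>A component on \<open>l - 1\<close> vertices touches at most
  \<open>l choose (l - 1) = l\<close> cliques, one on \<open>l - 2\<close> vertices at most one, and
  smaller ones none, just as the blocks counted by \<open>top_count\<close>.\<close>

lemma one_center_top_cliques:
  assumes "finite V" "z \<in> V" "\<And>C. comp (V - {z}) C \<Longrightarrow> card C < l" and l: "3 \<le> l"
  shows "card (cl (l - 1) V) \<le> top_count l (card V - 1)"
  using assms(1-3)
proof (induction "card V" arbitrary: V rule: less_induct)
  case less
  show ?case
  proof (cases "V - {z} = {}")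
    case True
    then have "V = {z}" using less.prems(2) by blast
    then have "card (cl (l - 1) V) \<le> 1 choose (l - 1)" using card_cl_le_binomial[of "{z}" "l - 1"] by simp
    also have "\<dots> = 0" using l by (simp add: binomial_eq_0)
    finally show ?thesis by simp
  next
    case False
    then obtain C where C: "comp (V - {z}) C" using comp_exists[of "V - {z}"] less.prems(1) by blast
    have C': "C \<subseteq> V - {z}" "C \<noteq> {}" using C comp_subset comp_nonempty by auto
    have fC: "finite C" using C' less.prems(1) by (meson finite_Diff finite_subset)
    have lt: "card (V - C) < card V" using C' less.prems by (intro psubset_card_mono) auto
    have zC: "z \<in> V - C" using C' less.prems by blast
    have "card D < l" if "comp (V - C - {z}) D" for D
    proof -
      have "V - C - {z} = V - {z} - C" by blast
      then have "comp (V - {z}) D" using comp_Diff[OF C, of D] that by simp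
      then show ?thesis using less.prems(3) by blast
    qed
    then have IH: "card (cl (l - 1) (V - C)) \<le> top_count l (card (V - C) - 1)"
      using less.hyps[OF lt _ zC] less.prems(1) by blast
    have cV: "card V - 1 = (card (V - C) - 1) + card C"
    proof -
      have "card (V - C) = card V - card C" using C' fC by (intro card_Diff_subset) auto
      moreover have "card C \<le> card V" using C' less.prems(1) by (intro card_mono) auto
      moreover have "card (V - C) > 0" using zC less.prems(1) by (auto simp: card_gt_0_iff)
      ultimately show ?thesis by linarith
    qed
    have t: "card (touching (l - 1) V C) \<le> (card C + 1) choose (l - 1)"
      using card_touching_comp[OF less.prems(1) _ C] less.prems(2) by simp
    have "top_count l (card (V - C) - 1) + ((card C + 1) choose (l - 1)) \<le> top_count l ((card (V - C) - 1) + card C)"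
    proof -
      consider "card C = l - 1" | "card C = l - 2" | "card C + 1 < l - 1" using less.prems(3)[OF C] by linarith
      then show ?thesis
      proof cases
        case 1
        then have "card C + 1 = Suc (l - 1)" by simp
        then have "(card C + 1) choose (l - 1) = Suc (l - 1)" by (simp only: binomial_Suc_n)
        then have "(card C + 1) choose (l - 1) = l" using l by simp
        moreover have "top_count l ((card (V - C) - 1) + card C) = top_count l (card (V - C) - 1) + l"
          using top_count_add[OF l] by (simp only: 1)
        ultimately show ?thesis by linarith
      next
        case 2
        then have "card C + 1 = l - 1" using l by simp
        then have "(card C + 1) choose (l - 1) = 1" by simp
        then show ?thesis using top_count_add_less[OF l] 2 by simp
      next
        case 3
        then have "(card C + 1) choose (l - 1) = 0" by (rule binomial_eq_0)
        moreover have "top_count l (card (V - C) - 1) \<le> top_count l ((card (V - C) - 1) + card C)"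
          by (rule top_count_mono[OF l]) simp
        ultimately show ?thesis by linarith
      qed
    qed
    then show ?thesis using IH t card_cl_le_Diff[OF less.prems(1), of "l - 1" C] unfolding cV by linarith
  qed
qed

text \<open>At most one component has \<open>l\<close> or more vertices, and only that one can
  resemble the extremal graph; every other one has exactly \<open>l - 1\<close> vertices and at most
  one clique.\<close>

lemma upper_special_top:
  assumes V: "finite V" "card V = n" "\<not> packs V [l, l]" and l: "odd l" "5 \<le> l" "l = d + 2"
    and b: "budget d (d + 1) (2 * l) n A c c' k"
  shows "card (cl (d + 1) V) \<le> top_count l (n - 1)"
proof -
  interpret budget d "d + 1" "2 * l" n A c c' k by (rule b)
  let ?ls = "[l, l]" and ?s = "d + 1"
  have l3: "3 \<le> l" and sl: "l - 1 = d + 1" using l by auto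
  \<comment> \<open>\<open>(d - 1) choose d\<close> vanishes, so deletions destroy no clique at
    all.\<close>
  have k0: "k = 0" using k_def d1 by (simp add: binomial_eq_0)
  have c1: "c = 1" "c' = 1" using c_def c'_def by auto
  have "l div 2 + l div 2 = Suc d" using l by presburger
  then have dF: "delta_F ?ls = d" by (simp add: delta_F_def)
  have nA: "(2 * l + 1) * A \<le> n"
  proof -
    have "(2 * l + 1) * A \<le> c' * (n - d)" using l by (intro many) simp
    then show ?thesis using c1 by simp
  qed
  have T: "n \<le> top_count l (n - 1)"
  proof (rule top_count_ge[OF l3])
    have "2 * l - 1 \<le> A" using A_ge c1 by simp
    then have "(2 * l + 1) * (2 * l - 1) \<le> n" using nA by (meson le_trans mult_le_mono2)
    moreover have "(l - 2) * (l - 1) < (2 * l + 1) * (2 * l - 1)" using l by (intro mult_strict_mono) auto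
    ultimately show "(l - 2) * (l - 1) < n" by linarith
  qed
  obtain W where W: "W \<subseteq> V" "card (cl ?s V) \<le> card (cl ?s W) + k * card (V - W)"
    "\<And>X. X \<subseteq> W \<Longrightarrow> X \<noteq> {} \<Longrightarrow> k * card X < card (touching ?s W X)"
    using deletion[OF V(1)] by blast
  have fW: "finite W" using W(1) V(1) finite_subset by blast
  have nn: "card W \<le> n" using W(1) V card_mono by blast
  have deg: "\<forall>v\<in>W. d \<le> card (nb W v)" using deletion_degree[OF fW W(3) k_def] by simp
  have np: "\<not> packs W ?ls" using V(3) W(1) packs_mono by blast
  let ?CC = "{C. comp W C}"
  have fCC: "finite ?CC" using finite_comps[OF fW] .
  have fC: "finite C" if "comp W C" for C using comp_subset[OF that] fW finite_subset by blast
  have S: "card (cl ?s W) \<le> (\<Sum>C\<in>?CC. card (cl ?s C))" using card_cl_le_sum_comps[OF fW] by simp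
  have sumC: "(\<Sum>C\<in>?CC. card C) = card W"
  proof -
    have "card (\<Union> ?CC) = (\<Sum>C\<in>?CC. card C)"
      using fC comp_disjoint by (intro card_Union_disjoint) (auto simp: pairwise_def disjnt_def)
    then show ?thesis using Union_comps[OF fW] by simp
  qed
  have cge: "l - 1 \<le> card C" if "comp W C" for C using comp_card_ge[OF fW deg that] sl by simp
  have one: "card (cl ?s C) \<le> 1" if C: "comp W C" "card C < l" for C
  proof -
    have "card C = ?s" using cge[OF C(1)] C(2) sl l by simp
    then show ?thesis using card_cl_le_binomial[OF fC[OF C(1)], of ?s] by simp
  qed
  have "card (cl ?s W) \<le> top_count l (n - 1)"
  proof (cases "\<exists>C. comp W C \<and> l \<le> card C")
    case False
    then have "(\<Sum>C\<in>?CC. card (cl ?s C)) \<le> (\<Sum>C\<in>?CC. card C)"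
    proof (intro sum_mono)
      fix C assume "C \<in> ?CC"
      then have C: "comp W C" "card C < l" using False by (auto simp: not_le)
      then show "card (cl ?s C) \<le> card C" using one[OF C] cge[OF C(1)] l by linarith
    qed
    then show ?thesis using S sumC nn T by linarith
  next
    case True
    then obtain C0 where C0: "comp W C0" "l \<le> card C0" by blast
    let ?D = "?CC - {C0}"
    have small: "card C < l" if "C \<in> ?D" for C
    proof (rule ccontr)
      assume "\<not> card C < l"
      then have "C0 = C" using two_long_comps[OF fW deg np _ C0(1), of C] C0(2) that l by simp
      then show False using that by simp
    qed
    have "(\<Sum>C\<in>?CC. card (cl ?s C)) = card (cl ?s C0) + (\<Sum>C\<in>?D. card (cl ?s C))"
      using fCC C0 by (intro sum.remove) auto
    moreover have "(\<Sum>C\<in>?D. card (cl ?s C)) \<le> (\<Sum>C\<in>?D. 1)" using one small by (intro sum_mono) auto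
    ultimately have S': "card (cl ?s W) \<le> card (cl ?s C0) + card ?D" using S by simp
    have "card W = card C0 + (\<Sum>C\<in>?D. card C)" unfolding sumC[symmetric] using fCC C0 by (intro sum.remove) auto
    moreover have "(\<Sum>C\<in>?D. l - 1) \<le> (\<Sum>C\<in>?D. card C)" using cge by (intro sum_mono) auto
    ultimately have cW: "card C0 + card ?D * (l - 1) \<le> n" using nn by simp
    have "card ?D * 4 \<le> card ?D * (l - 1)" using l by (intro mult_le_mono2) simp
    then have D4: "card ?D * 4 \<le> n" "card C0 + card ?D \<le> n" using cW by linarith+
    have npC: "\<not> packs C0 ?ls" using np packs_mono comp_subset[OF C0(1)] by blast
    show ?thesis
    proof (cases "card C0 \<le> 4 * (2 * l - 1)")
      case True
      have "card (cl ?s C0) \<le> 4 * A"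
        unfolding A_def using small_graph_cliques[OF fC[OF C0(1)] npC, of ?s] True l by (simp add: mult_2)
      moreover have "8 * A \<le> (2 * l + 1) * A" using l by (intro mult_le_mono1) simp
      ultimately show ?thesis using S' D4(1) nA T by linarith
    next
      case False
      then have big: "4 * (2 * l - 1) < card C0" by simp
      have degC: "\<forall>v\<in>C0. d \<le> card (nb C0 v)"
        using deg comp_nb[OF C0(1)] comp_subset[OF C0(1)] by (metis subsetD)
      from connected_special[OF fC[OF C0(1)] comp_conn[OF C0(1)] degC npC l big] show ?thesis
      proof (elim disjE)
        assume "\<forall>s. card (cl s C0) \<le> num_cliques s {0..<card C0} (GF_E ?ls (card C0))"
        then have "card (cl ?s C0) \<le> num_cliques ?s {0..<card C0} (GF_E ?ls (card C0))" by blast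
        also have "\<dots> \<le> card C0" using GF_top_cliques_le[of ?ls "card C0"] dF C0(2) l by simp
        finally show ?thesis using S' D4(2) T by linarith
      next
        assume "\<exists>z\<in>C0. \<forall>C. comp (C0 - {z}) C \<longrightarrow> card C < l \<and> d \<le> card C"
        then obtain z where z: "z \<in> C0" "\<And>C. comp (C0 - {z}) C \<Longrightarrow> card C < l" by blast
        have "card (cl ?s C0) \<le> top_count l (card C0 - 1)"
          using one_center_top_cliques[OF fC[OF C0(1)] z l3] sl by simp
        \<comment> \<open>A separate component counts one clique; used as a further block at the
          centre it would count \<open>l\<close>.\<close>
        moreover have "top_count l (card C0 - 1) + card ?D \<le> top_count l (card C0 - 1 + card ?D * (l - 1))"
          by (rule top_count_blocks[OF l3])
        moreover have "card C0 - 1 + card ?D * (l - 1) \<le> n - 1" using cW C0(2) l by simp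
        then have "top_count l (card C0 - 1 + card ?D * (l - 1)) \<le> top_count l (n - 1)" by (rule top_count_mono[OF l3])
        ultimately show ?thesis using S' by linarith
      qed
    qed
  qed
  then show ?thesis using W(2) k0 by simp
qed

end

section \<open>Copies of linear forests\<close>

lemma distinct_concat_disjoint:
  "distinct (concat xss) \<Longrightarrow> i < j \<Longrightarrow> j < length xss \<Longrightarrow> set (xss ! i) \<inter> set (xss ! j) = {}"
proof (induction xss arbitrary: i j)
  case (Cons xs xss)
  show ?case
  proof (cases i)
    case 0
    then obtain j' where j: "j = Suc j'" "j' < length xss" using Cons.prems by (cases j) auto
    then have "set (xss ! j') \<subseteq> set (concat xss)" using nth_mem by fastforce
    then show ?thesis using Cons.prems(1) 0 j by auto
  next
    case (Suc i')
    then obtain j' where "j = Suc j'" using Cons.prems by (cases j) auto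
    then show ?thesis using Cons Suc by simp
  qed
qed simp

lemma lf_edge: "i < length ls \<Longrightarrow> Suc j < ls ! i \<Longrightarrow> {(i, j), (i, Suc j)} \<in> lf_E ls"
  unfolding lf_E_def by blast

context loopless
begin

lemma packs_imp_copy:
  assumes "packs V ls"
  shows "subgraph_copy (lf_V ls) (lf_E ls) V E"
proof -
  obtain pss where pss: "map length pss = ls" "distinct (concat pss)" "\<forall>ps\<in>set pss. path V ps"
    using assms by (auto simp: packs_def)
  define f where "f = (\<lambda>(i, j). pss ! i ! j)"
  have len: "length pss = length ls" "\<And>i. i < length ls \<Longrightarrow> length (pss ! i) = ls ! i"
    using pss(1) by (metis length_map, metis length_map nth_map)
  have p: "path V (pss ! i)" if "i < length ls" for i using that pss(3) len(1) by auto
  have inset: "pss ! i ! j \<in> set (pss ! i)" if "i < length ls" "j < ls ! i" for i j using that len by simp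
  have "inj_on f (lf_V ls)"
  proof (rule inj_onI)
    fix a b assume ab: "a \<in> lf_V ls" "b \<in> lf_V ls" "f a = f b"
    obtain i j i' j' where e: "a = (i, j)" "b = (i', j')" by (cases a; cases b)
    have b: "i < length ls" "j < ls ! i" "i' < length ls" "j' < ls ! i'" using ab e by (auto simp: lf_V_def)
    have eq: "pss ! i ! j = pss ! i' ! j'" using ab(3) e by (simp add: f_def)
    have "i = i'"
    proof (rule ccontr)
      assume "i \<noteq> i'"
      then have "set (pss ! i) \<inter> set (pss ! i') = {}"
        using distinct_concat_disjoint[OF pss(2)] b len(1) by (metis inf_commute linorder_neqE_nat)
      then show False using inset[OF b(1,2)] inset[OF b(3,4)] eq by auto
    qed
    moreover have "distinct (pss ! i)" using p[OF b(1)] path_distinct by blast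
    ultimately have "j = j'" using eq b len by (metis nth_eq_iff_index_eq)
    then show "a = b" using e \<open>i = i'\<close> by simp
  qed
  moreover have "f ` lf_V ls \<subseteq> V"
    using inset p path_set by (fastforce simp: f_def lf_V_def)
  moreover have "{f u, f v} \<in> E" if uv: "{u, v} \<in> lf_E ls" for u v
  proof -
    obtain i j where ij: "{u, v} = {(i, j), (i, Suc j)}" "i < length ls" "Suc j < ls ! i"
      using uv by (auto simp: lf_E_def)
    have "{pss ! i ! j, pss ! i ! Suc j} \<in> E"
      using path_nth_adj[OF p[OF ij(2)], of j] ij len by (simp add: adj_def)
    moreover have "{f u, f v} = {pss ! i ! j, pss ! i ! Suc j}"
    proof -
      have "f ` {u, v} = f ` {(i, j), (i, Suc j)}" using ij(1) by simp
      then show ?thesis by (simp add: f_def)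
    qed
    ultimately show ?thesis by simp
  qed
  ultimately show ?thesis unfolding subgraph_copy_def by blast
qed

lemma copy_imp_path:
  assumes "subgraph_copy (lf_V [l]) (lf_E [l]) V E"
  obtains xs where "path V xs" "length xs = l"
proof -
  obtain f where f: "inj_on f (lf_V [l])" "f ` lf_V [l] \<subseteq> V" "\<forall>u v. {u, v} \<in> lf_E [l] \<longrightarrow> {f u, f v} \<in> E"
    using assms by (auto simp: subgraph_copy_def)
  have V: "(0, j) \<in> lf_V [l]" if "j < l" for j using that by (simp add: lf_V_def)
  define xs where "xs = map (\<lambda>j. f (0, j)) [0..<l]"
  have "distinct xs"
  proof -
    have "inj_on (\<lambda>j. f (0, j)) (set [0..<l])"
    proof (rule inj_onI)
      fix x y assume "x \<in> set [0..<l]" "y \<in> set [0..<l]" "f (0, x) = f (0, y)"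
      then have "(0::nat, x) = (0, y)" using inj_onD[OF f(1), of "(0, x)" "(0, y)"] V by auto
      then show "x = y" by simp
    qed
    then show ?thesis by (simp add: xs_def distinct_map)
  qed
  moreover have "set xs \<subseteq> V" unfolding xs_def using f(2) V by auto
  moreover have "successively adj xs"
    unfolding successively_conv_nth
  proof (intro allI impI)
    fix j assume "Suc j < length xs"
    then have "Suc j < l" by (simp add: xs_def)
    moreover from this have "{(0, j), (0, Suc j)} \<in> lf_E [l]" using lf_edge[of 0 "[l]" j] by simp
    ultimately show "adj (xs ! j) (xs ! Suc j)" using f(3) by (simp add: xs_def adj_def)
  qed
  ultimately have "path V xs" by (simp add: path_def)
  then show thesis using that[of xs] by (simp add: xs_def)
qed

end

section \<open>Extremal numbers\<close>

lemma finite_graphs_on: "finite (graphs_on n)"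
proof -
  have "{{u, v} | u v. u < n \<and> v < n \<and> u \<noteq> v} \<subseteq> Pow {0..<n}" by auto
  then have "finite {{u, v} | u v. u < n \<and> v < n \<and> u \<noteq> v}" using finite_subset by blast
  moreover have "graphs_on n = Pow {{u, v} | u v. u < n \<and> v < n \<and> u \<noteq> v}" by (auto simp: graphs_on_def)
  ultimately show ?thesis by simp
qed

lemma graphs_on_loopless: "E \<in> graphs_on n \<Longrightarrow> loopless E"
  by unfold_locales (auto simp: graphs_on_def)

lemma finite_ex_set:
  "finite {num_cliques s {0..<n} E | E. E \<in> graphs_on n \<and> H_free {0..<n} E VH EH}"
  using finite_graphs_on[of n] by simp

lemma ex_gen_ge:
  "E \<in> graphs_on n \<Longrightarrow> H_free {0..<n} E VH EH \<Longrightarrow> num_cliques s {0..<n} E \<le> ex_gen n s VH EH"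
  unfolding ex_gen_def by (rule Max_ge[OF finite_ex_set]) blast

lemma ex_lf_attained:
  assumes "ls \<noteq> []" "\<forall>l\<in>set ls. 2 \<le> l"
  obtains E where "E \<in> graphs_on n" "H_free {0..<n} E (lf_V ls) (lf_E ls)"
    "num_cliques s {0..<n} E = ex_lf n s ls"
proof -
  let ?S = "{num_cliques s {0..<n} E | E. E \<in> graphs_on n \<and> H_free {0..<n} E (lf_V ls) (lf_E ls)}"
  \<comment> \<open>F has an edge, so the edgeless graph is F-free and the maximum is taken over a
    nonempty set.\<close>
  have "{(0, 0), (0, Suc 0)} \<in> lf_E ls" 
  proof (rule lf_edge)
    show "0 < length ls" using assms(1) by simp
    then have "ls ! 0 \<in> set ls" by (rule nth_mem)
    then show "Suc 0 < ls ! 0" using assms(2) by fastforce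
  qed
  then have "H_free {0..<n} {} (lf_V ls) (lf_E ls)" unfolding H_free_def subgraph_copy_def by blast
  moreover have "{} \<in> graphs_on n" by (simp add: graphs_on_def)
  ultimately have "?S \<noteq> {}" by blast
  then have "ex_lf n s ls \<in> ?S" unfolding ex_lf_def ex_gen_def using finite_ex_set by (rule Max_in[rotated])
  then show thesis using that by auto
qed

lemma H_free_first:
  assumes "H_free V E (lf_V [ls ! 0]) (lf_E [ls ! 0])" "ls \<noteq> []"
  shows "H_free V E (lf_V ls) (lf_E ls)"
  unfolding H_free_def
proof
  assume "subgraph_copy (lf_V ls) (lf_E ls) V E"
  then obtain f where f: "inj_on f (lf_V ls)" "f ` lf_V ls \<subseteq> V" "\<forall>u v. {u, v} \<in> lf_E ls \<longrightarrow> {f u, f v} \<in> E"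
    by (auto simp: subgraph_copy_def)
  have "lf_V [ls ! 0] \<subseteq> lf_V ls" using assms(2) by (auto simp: lf_V_def)
  moreover have "lf_E [ls ! 0] \<subseteq> lf_E ls" using assms(2) unfolding lf_E_def by fastforce
  ultimately have "subgraph_copy (lf_V [ls ! 0]) (lf_E [ls ! 0]) V E"
    unfolding subgraph_copy_def using f by (intro exI[of _ f]) (auto intro: inj_on_subset)
  then show False using assms(1) by (simp add: H_free_def)
qed

subsection \<open>Lower bounds\<close>

lemma GF_graphs_on: "GF_E ls n \<in> graphs_on n"
  unfolding GF_E_def graphs_on_def by fastforce

lemma GF_edge_meets:
  assumes "{u, v} \<in> GF_E ls n" "\<not> u < delta_F ls" "\<not> v < delta_F ls"
  shows "(\<forall>l\<in>set ls. odd l) \<and> {u, v} = {delta_F ls, Suc (delta_F ls)}"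
proof -
  obtain a b where ab: "{u, v} = {a, b}"
    "a < delta_F ls \<or> ((\<forall>l\<in>set ls. odd l) \<and> a = delta_F ls \<and> b = Suc (delta_F ls))"
    using assms(1) unfolding GF_E_def by blast
  have "\<not> a < delta_F ls" using ab(1) assms(2,3) by (metis doubleton_eq_iff)
  then show ?thesis using ab by blast
qed

text \<open>Each path \<open>P\<^sub>l\<close> of a copy of \<open>F\<close> has a matching of \<open>l div 2\<close> edges all of which meet the dominating clique:
  if the exceptional edge spoils one of the two matchings of an odd path, the other one is used.\<close>

lemma GF_H_free:
  assumes "1 \<le> (\<Sum>l\<leftarrow>ls. l div 2)"
  shows "H_free {0..<n} (GF_E ls n) (lf_V ls) (lf_E ls)"
  unfolding H_free_def
proof
  let ?d = "delta_F ls"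
  assume "subgraph_copy (lf_V ls) (lf_E ls) {0..<n} (GF_E ls n)"
  then obtain f where f: "inj_on f (lf_V ls)" "\<forall>u v. {u, v} \<in> lf_E ls \<longrightarrow> {f u, f v} \<in> GF_E ls n"
    by (auto simp: subgraph_copy_def)
  have inj: "j = j' \<and> i = i'" if "f (i, j) = f (i', j')" "i < length ls" "j < ls ! i" "i' < length ls" "j' < ls ! i'" for i j i' j'
    using f(1) that unfolding inj_on_def lf_V_def by blast
  \<comment> \<open>The shift \<open>e\<close> selects the matching of positions
    \<open>2 * j + e\<close>, \<open>2 * j + 1 + e\<close>. If both shifts 0 and 1 failed, the
    exceptional edge would be used by two different edges of the same path.\<close>
  have "\<exists>e. \<forall>j<ls ! i div 2. 2 * j + 1 + e < ls ! i \<and> (f (i, 2 * j + e) < ?d \<or> f (i, 2 * j + 1 + e) < ?d)"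
    if i: "i < length ls" for i
  proof (rule ccontr)
    assume no: "\<not> ?thesis"
    let ?l = "ls ! i"
    have edge: "{f (i, j), f (i, Suc j)} \<in> GF_E ls n" if "Suc j < ?l" for j using f(2) lf_edge[OF i that] by blast
    obtain j where j: "j < ?l div 2" "\<not> (2 * j + 1 + 0 < ?l \<and> (f (i, 2 * j + 0) < ?d \<or> f (i, 2 * j + 1 + 0) < ?d))"
      using no by blast
    have j1: "2 * j + 1 < ?l" using j(1) by linarith
    then have n1: "\<not> f (i, 2 * j) < ?d" "\<not> f (i, Suc (2 * j)) < ?d" using j(2) by auto
    then have o: "\<forall>l\<in>set ls. odd l" and e1: "{f (i, 2 * j), f (i, Suc (2 * j))} = {?d, Suc ?d}"
      using GF_edge_meets[OF edge[of "2 * j"]] j1 by auto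
    obtain k where k: "k < ?l div 2" "\<not> (2 * k + 1 + 1 < ?l \<and> (f (i, 2 * k + 1) < ?d \<or> f (i, 2 * k + 1 + 1) < ?d))"
      using no by blast
    have "odd ?l" using o i by simp
    then have k1: "2 * k + 2 < ?l" using k(1) by presburger
    then have n2: "\<not> f (i, Suc (2 * k)) < ?d" "\<not> f (i, Suc (Suc (2 * k))) < ?d" using k(2) by auto
    then have e2: "{f (i, Suc (2 * k)), f (i, Suc (Suc (2 * k)))} = {?d, Suc ?d}"
      using GF_edge_meets[OF edge[of "Suc (2 * k)"]] k1 by auto
    have "f (i, 2 * j) = f (i, Suc (2 * k)) \<or> f (i, 2 * j) = f (i, Suc (Suc (2 * k)))"
      "f (i, Suc (2 * j)) = f (i, Suc (2 * k)) \<or> f (i, Suc (2 * j)) = f (i, Suc (Suc (2 * k)))"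
      using e1 e2 by (metis insertCI insertE singletonD)+
    moreover have injx: "x = y" if "f (i, x) = f (i, y)" "x < ?l" "y < ?l" for x y using inj[OF that(1) i that(2) i that(3)] ..
    moreover have "2 * j < ?l" "Suc (2 * j) < ?l" "Suc (2 * k) < ?l" "Suc (Suc (2 * k)) < ?l" using j1 k1 by linarith+
    ultimately have "2 * j = Suc (2 * k) \<or> 2 * j = Suc (Suc (2 * k))" "Suc (2 * j) = Suc (2 * k) \<or> Suc (2 * j) = Suc (Suc (2 * k))"
      by blast+
    then show False by presburger
  qed
  then obtain e where e: "\<And>i j. i < length ls \<Longrightarrow> j < ls ! i div 2 \<Longrightarrow>
      2 * j + 1 + e i < ls ! i \<and> (f (i, 2 * j + e i) < ?d \<or> f (i, 2 * j + 1 + e i) < ?d)"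
    by metis
  define g where "g = (\<lambda>(i, j). if f (i, 2 * j + e i) < ?d then 2 * j + e i else 2 * j + 1 + e i)"
  \<comment> \<open>One matching edge per index: \<open>F\<close> sends these \<open>d + 1\<close>
    indices injectively into the clique on \<open>d\<close> vertices.\<close>
  let ?I = "SIGMA i:{..<length ls}. {..<ls ! i div 2}"
  define F where "F = (\<lambda>x. f (fst x, g x))"
  have "inj_on F ?I"
  proof (rule inj_onI)
    fix x y assume x: "x \<in> ?I" "y \<in> ?I" "F x = F y"
    obtain i j i' j' where xy: "x = (i, j)" "y = (i', j')" by (cases x; cases y)
    have b: "i < length ls" "j < ls ! i div 2" "i' < length ls" "j' < ls ! i' div 2" using x xy by auto
    have "g (i, j) < ls ! i" "g (i', j') < ls ! i'" using e[OF b(1,2)] e[OF b(3,4)] by (auto simp: g_def)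
    then have "g (i, j) = g (i', j') \<and> i = i'" using inj[of i "g (i, j)" i' "g (i', j')"] x(3) xy b by (auto simp: F_def)
    then show "x = y" using xy by (auto simp: g_def split: if_splits)
  qed
  moreover have "F ` ?I \<subseteq> {..<?d}" using e by (fastforce simp: F_def g_def)
  ultimately have "card ?I \<le> card {..<?d}" by (intro card_inj_on_le[of F]) auto
  moreover have "card ?I = (\<Sum>l\<leftarrow>ls. l div 2)"
    by (simp add: sum_list_sum_nth atLeast0LessThan)
  ultimately show False using assms by (simp add: delta_F_def)
qed

text \<open>The centre is \<open>0\<close>, and the other vertices, shifted by one, fall into
  consecutive blocks of \<open>l - 1\<close> numbers, each a clique.\<close>

definition top_graph :: "nat \<Rightarrow> nat \<Rightarrow> nat set set" where
  "top_graph l n = {{u, v} | u v. u < v \<and> v < n \<and> (u = 0 \<or> (u - 1) div (l - 1) = (v - 1) div (l - 1))}"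

lemma top_graph_graphs_on: "top_graph l n \<in> graphs_on n"
  unfolding top_graph_def graphs_on_def by fastforce

text \<open>One of two disjoint paths misses the centre; it never changes its block, which has only
  \<open>l - 1\<close> vertices.\<close>

lemma top_graph_H_free:
  assumes "2 \<le> l"
  shows "H_free {0..<n} (top_graph l n) (lf_V [l, l]) (lf_E [l, l])"
  unfolding H_free_def
proof
  let ?L = "l - 1"
  assume "subgraph_copy (lf_V [l, l]) (lf_E [l, l]) {0..<n} (top_graph l n)"
  then obtain f where f: "inj_on f (lf_V [l, l])" "\<forall>u v. {u, v} \<in> lf_E [l, l] \<longrightarrow> {f u, f v} \<in> top_graph l n"
    by (auto simp: subgraph_copy_def)
  have inV: "(i, j) \<in> lf_V [l, l]" if "i < 2" "j < l" for i j
    using that by (auto simp: lf_V_def less_2_cases_iff)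
  have "\<exists>i<2. \<forall>j<l. f (i, j) \<noteq> 0"
  proof (rule ccontr)
    assume "\<not> ?thesis"
    then obtain j j' where j: "j < l" "f (0, j) = 0" "j' < l" "f (1, j') = 0"
      by (metis one_less_numeral_iff pos2 semiring_norm(76))
    then have "(0, j) = (1::nat, j')" using inj_onD[OF f(1), of "(0, j)" "(1, j')"] inV by simp
    then show False by simp
  qed
  then obtain i where i: "i < 2" "\<forall>j<l. f (i, j) \<noteq> 0" by blast
  have step: "(f (i, j) - 1) div ?L = (f (i, Suc j) - 1) div ?L" if j: "Suc j < l" for j
  proof -
    have "{(i, j), (i, Suc j)} \<in> lf_E [l, l]" using i(1) j by (intro lf_edge) (auto simp: less_2_cases_iff)
    then have "{f (i, j), f (i, Suc j)} \<in> top_graph l n" using f(2) by blast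
    then obtain u v where uv: "{f (i, j), f (i, Suc j)} = {u, v}" "u = 0 \<or> (u - 1) div ?L = (v - 1) div ?L"
      unfolding top_graph_def by blast
    have "f (i, j) \<noteq> 0" "f (i, Suc j) \<noteq> 0" using i(2) j by auto
    then show ?thesis using uv by (metis doubleton_eq_iff)
  qed
  have block: "(f (i, j) - 1) div ?L = (f (i, 0) - 1) div ?L" if "j < l" for j
    using that by (induction j) (use step in auto)
  let ?b = "(f (i, 0) - 1) div ?L"
  have "(\<lambda>j. f (i, j) - 1) ` {..<l} \<subseteq> {?b * ?L..<?b * ?L + ?L}"
  proof
    fix x assume "x \<in> (\<lambda>j. f (i, j) - 1) ` {..<l}"
    then obtain j where "j < l" "x = f (i, j) - 1" by blast
    then have "x div ?L = ?b" using block[of j] by (simp only:)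
    moreover have "x mod ?L < ?L" using assms by simp
    moreover have "x = x div ?L * ?L + x mod ?L" by (simp only: div_mult_mod_eq)
    ultimately have "?b * ?L \<le> x" "x < ?b * ?L + ?L" by (metis le_add1) (metis \<open>x mod ?L < ?L\<close> \<open>x div ?L = ?b\<close> \<open>x = x div ?L * ?L + x mod ?L\<close> nat_add_left_cancel_less)
    then show "x \<in> {?b * ?L..<?b * ?L + ?L}" by (simp only: atLeastLessThan_iff)
  qed
  moreover have "inj_on (\<lambda>j. f (i, j) - 1) {..<l}"
  proof (rule inj_onI)
    fix j j' assume j: "j \<in> {..<l}" "j' \<in> {..<l}" "f (i, j) - 1 = f (i, j') - 1"
    then have "f (i, j) = f (i, j')" using i(2) by (metis Suc_diff_1 lessThan_iff not_gr_zero)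
    then have "(i, j) = (i, j')" using inj_onD[OF f(1)] inV i(1) j by blast
    then show "j = j'" by simp
  qed
  ultimately have "card {..<l} \<le> card {?b * ?L..<?b * ?L + ?L}" by (intro card_inj_on_le) auto
  then show False using assms by simp
qed

text \<open>\<open>P b\<close> collects the cliques inside block \<open>b\<close> with the centre
  added. These families are disjoint because every clique contains a vertex of its block; a full
  block gives \<open>l\<close> cliques, and the last one gives a clique when it has
  \<open>l - 2\<close> vertices.\<close>

lemma top_graph_cliques:
  assumes l: "3 \<le> l" and n: "1 \<le> n"
  shows "top_count l (n - 1) \<le> num_cliques (l - 1) {0..<n} (top_graph l n)"
proof -
  let ?L = "l - 1"
  let ?Q = "(n - 1) div ?L" and ?r = "(n - 1) mod ?L"
  define B where "B = (\<lambda>b. {b * ?L + 1..<Suc b * ?L + 1} \<inter> {0..<n})"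
  define K where "K = {K. K \<subseteq> {0..<n} \<and> card K = ?L \<and> (\<forall>u\<in>K. \<forall>v\<in>K. u \<noteq> v \<longrightarrow> {u, v} \<in> top_graph l n)}"
  define P where "P = (\<lambda>b. {K. K \<subseteq> insert 0 (B b) \<and> card K = ?L})"
  have L2: "2 \<le> ?L" using l by simp
  have blk: "(x - 1) div ?L = b" if "x \<in> B b" for x b
  proof -
    have "b * ?L \<le> x - 1" "x - 1 < Suc b * ?L" using that by (auto simp: B_def)
    then show ?thesis using L2 by (intro div_nat_eqI) (auto simp: mult.commute)
  qed
  have nz: "x \<noteq> 0" if "x \<in> B b" for x b using that by (auto simp: B_def)
  have finB: "finite (insert 0 (B b))" for b by (simp add: B_def)
  have PK: "P b \<subseteq> K" for b
  proof
    fix S assume S: "S \<in> P b"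
    have "{u, v} \<in> top_graph l n" if uv: "u \<in> S" "v \<in> S" "u < v" for u v
    proof -
      have "v \<in> B b" "v < n" "u = 0 \<or> u \<in> B b" using uv S by (auto simp: P_def B_def)
      then have "u = 0 \<or> (u - 1) div ?L = (v - 1) div ?L" using blk by metis
      then show ?thesis using uv(3) \<open>v < n\<close> unfolding top_graph_def by blast
    qed
    then have "{u, v} \<in> top_graph l n" if "u \<in> S" "v \<in> S" "u \<noteq> v" for u v
      using that by (metis insert_commute linorder_neqE_nat)
    then show "S \<in> K" using S n by (auto simp: P_def K_def B_def)
  qed
  have elem: "\<exists>x\<in>S. x \<in> B b" if S: "S \<in> P b" for S b
  proof (rule ccontr)
    assume "\<not> ?thesis"
    then have "S \<subseteq> {0}" using S by (auto simp: P_def)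
    then have "card S \<le> card {0::nat}" by (intro card_mono) auto
    then show False using S L2 by (simp add: P_def)
  qed
  have disj: "P b \<inter> P b' = {}" if "b \<noteq> b'" for b b'
  proof (rule ccontr)
    assume "P b \<inter> P b' \<noteq> {}"
    then obtain S where S: "S \<in> P b" "S \<in> P b'" by blast
    obtain x where x: "x \<in> S" "x \<in> B b" using elem[OF S(1)] by blast
    then have "x \<in> B b'" using S(2) nz by (auto simp: P_def)
    then show False using blk x that by blast
  qed
  have finP: "finite (P b)" for b unfolding P_def using finB by simp
  have cP: "card (P b) = card (insert 0 (B b)) choose ?L" for b
    unfolding P_def using n_subsets[OF finB] .
  have cB: "card (insert 0 (B b)) = Suc (card (B b))" for b
    using nz by (subst card_insert_disjoint) (auto simp: B_def)
  have full: "card (P b) = l" if "b < ?Q" for b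
  proof -
    have "Suc b * ?L \<le> ?Q * ?L" using that by (intro mult_le_mono1) simp
    also have "\<dots> \<le> n - 1" by (rule div_times_less_eq_dividend)
    finally have "B b = {b * ?L + 1..<Suc b * ?L + 1}" by (auto simp: B_def)
    then have "card (B b) = ?L" by simp
    then have "card (P b) = Suc ?L choose ?L" using cP cB by simp
    also have "\<dots> = Suc ?L" by (rule binomial_Suc_n)
    finally show ?thesis using l by simp
  qed
  have last: "(if ?r = l - 2 then 1 else 0) \<le> card (P ?Q)"
  proof (cases "?r = l - 2")
    case True
    have "B ?Q = {?Q * ?L + 1..<n}"
    proof -
      have "n - 1 = ?Q * ?L + ?r" by (rule div_mult_mod_eq[symmetric])
      moreover have "?r < ?L" using L2 by simp
      moreover have "Suc ?Q * ?L = ?L + ?Q * ?L" by (rule mult_Suc)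
      ultimately have "n \<le> Suc ?Q * ?L + 1" using n by linarith
      then show ?thesis by (auto simp: B_def)
    qed
    moreover have "n - (?Q * ?L + 1) = ?r"
      using div_mult_mod_eq[of "n - 1" ?L] by linarith
    ultimately have "card (B ?Q) = l - 2" using True by simp
    then have "card (insert 0 (B ?Q)) = ?L" using cB l by simp
    then show ?thesis using cP by simp
  qed simp
  have "card (\<Union>b\<in>{..?Q}. P b) = (\<Sum>b\<in>{..?Q}. card (P b))"
    using finP disj by (intro card_UN_disjoint) auto
  moreover have "(\<Sum>b\<in>{..?Q}. card (P b)) = (\<Sum>b<?Q. card (P b)) + card (P ?Q)"
    by (simp only: lessThan_Suc_atMost[symmetric] sum.lessThan_Suc)
  moreover have "(\<Sum>b<?Q. card (P b)) = ?Q * l" using full by simp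
  moreover have "card (\<Union>b\<in>{..?Q}. P b) \<le> card K"
  proof (rule card_mono)
    show "finite K" unfolding K_def by (rule finite_clique_family)
    show "(\<Union>b\<in>{..?Q}. P b) \<subseteq> K" using PK by blast
  qed
  ultimately have "top_count l (n - 1) \<le> card K" using last unfolding top_count_def by linarith
  then show ?thesis by (simp add: num_cliques_def K_def)
qed

lemma num_cliques_1: "num_cliques (Suc 0) {0..<n} E = n"
proof -
  have "{K. K \<subseteq> {0..<n} \<and> card K = Suc 0 \<and> (\<forall>u\<in>K. \<forall>v\<in>K. u \<noteq> v \<longrightarrow> {u, v} \<in> E)} = (\<lambda>x. {x}) ` {0..<n}"
    by (auto simp: card_1_singleton_iff)
  moreover have "card ((\<lambda>x. {x}) ` {0..<n}) = n" by (subst card_image) (auto simp: inj_on_def)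
  ultimately show ?thesis by (simp add: num_cliques_def)
qed

theorem mainTheorem1:
  fixes ls :: "nat list" and s n :: nat
  assumes k2: "length ls \<ge> 2"
    and sorted: "sorted_wrt (\<ge>) ls"
    and ge2: "\<forall>l\<in>set ls. l \<ge> 2"
    and ne3: "\<forall>l\<in>set ls. l \<noteq> 3"
    and s_pos: "s \<ge> 1"
    and s_le: "s \<le> delta_F ls + 1"
    and n_large: "real n \<ge> 5 * real ((order_lf ls - 1) choose s) ^ 2
                     / (real (order_lf ls - 1) * real (delta_F ls choose (s - 1))) + real (delta_F ls)"
  shows "(\<not> (length ls = 2 \<and> ls ! 0 = ls ! 1 \<and> odd (ls ! 0)) \<longrightarrow>
           ex_lf n s ls = max (num_cliques s {0..<n} (GF_E ls n)) (ex_lf n s [ls ! 0]))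
       \<and> ((length ls = 2 \<and> ls ! 0 = ls ! 1 \<and> odd (ls ! 0)) \<longrightarrow>
           (s \<le> delta_F ls \<longrightarrow> ex_lf n s ls = num_cliques s {0..<n} (GF_E ls n))
         \<and> (s = delta_F ls + 1 \<longrightarrow>
              ex_lf n s ls = (n - 1) div (ls ! 0 - 1) * ls ! 0
                 + (if (n - 1) mod (ls ! 0 - 1) = ls ! 0 - 2 then 1 else 0)))"
proof -
  obtain l1 l2 rs where ls: "ls = l1 # l2 # rs" using k2 by (metis Suc_le_length_iff numeral_2_eq_2)
  define d where "d = delta_F ls"
  define h where "h = (\<Sum>l\<leftarrow>ls. l div 2)"
  define q where "q = (\<Sum>l\<leftarrow>ls. l mod 2)"
  have f: "forest ls l1 l2 rs h q"
    using ls sorted ge2 ne3 by unfold_locales (auto simp: h_def q_def)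
  interpret forest ls l1 l2 rs h q by (rule f)
  have hd: "h = Suc d" using h_ge by (simp add: d_def delta_F_def flip: h_def)
  have d1: "1 \<le> d" using hd h_ge by simp
  let ?p = "sum_list ls"
  have p: "2 * d + 2 \<le> ?p" using sum_ls hd by simp
  define A where "A = (?p - 1) choose s"
  define c where "c = d choose (s - 1)"
  have cpos: "1 \<le> c" using s_le by (simp add: c_def d_def Suc_le_eq zero_less_binomial_iff)
  \<comment> \<open>Clearing the positive denominator moves the hypothesis on \<open>n\<close> to
    natural numbers; \<open>d \<le> n\<close> is needed for the truncated difference.\<close>
  have dn: "d \<le> n" and nl: "5 * A ^ 2 \<le> (n - d) * ((?p - 1) * c)"
  proof -
    have pc: "real ((?p - 1) * c) > 0" using p cpos by simp
    have r: "real n - real d \<ge> 5 * real A ^ 2 / real ((?p - 1) * c)"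
      using n_large by (simp add: A_def c_def d_def order_lf_def)
    have "0 \<le> 5 * real A ^ 2 / real ((?p - 1) * c)" by simp
    then have "0 \<le> real n - real d" using r by (rule order_trans)
    then show dn: "d \<le> n" by simp
    have "5 * real A ^ 2 \<le> (real n - real d) * real ((?p - 1) * c)" using r pc by (simp only: pos_divide_le_eq)
    moreover have "real (5 * A ^ 2) = 5 * real A ^ 2" by simp
    moreover have "real ((n - d) * ((?p - 1) * c)) = (real n - real d) * real ((?p - 1) * c)"
      unfolding of_nat_mult[of "n - d"] of_nat_diff[OF dn] ..
    ultimately have "real (5 * A ^ 2) \<le> real ((n - d) * ((?p - 1) * c))" by (simp only:)
    then show "5 * A ^ 2 \<le> (n - d) * ((?p - 1) * c)" by (simp only: of_nat_le_iff)
  qed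
  have bud: "budget d s ?p n A c ((d - 1) choose (s - 2)) ((d - 1) choose (s - 1))" if "2 \<le> s"
    using that d1 s_le p dn nl by unfold_locales (auto simp: d_def A_def c_def)
  have ls_ne: "ls \<noteq> []" and ls_ge: "\<forall>l\<in>set ls. 2 \<le> l" using ls ge by auto
  have GF_le: "num_cliques s {0..<n} (GF_E ls n) \<le> ex_lf n s ls"
    unfolding ex_lf_def using h_ge by (intro ex_gen_ge GF_graphs_on GF_H_free) (simp flip: h_def)
  have P_le: "ex_lf n s [ls ! 0] \<le> ex_lf n s ls"
  proof -
    obtain E where "E \<in> graphs_on n" "H_free {0..<n} E (lf_V [ls ! 0]) (lf_E [ls ! 0])"
      "num_cliques s {0..<n} E = ex_lf n s [ls ! 0]"
      using ex_lf_attained[of "[ls ! 0]"] ls_ge ls by auto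
    then show ?thesis using ex_gen_ge[of E n] H_free_first[OF _ ls_ne] unfolding ex_lf_def by metis
  qed
  obtain E where E: "E \<in> graphs_on n" "H_free {0..<n} E (lf_V ls) (lf_E ls)"
    "num_cliques s {0..<n} E = ex_lf n s ls" using ex_lf_attained[OF ls_ne ls_ge] by blast
  interpret loopless E using E(1) by (rule graphs_on_loopless)
  have np: "\<not> packs {0..<n} ls" using packs_imp_copy E(2) by (auto simp: H_free_def)
  have N: "card (cl s {0..<n}) = ex_lf n s ls" using E(3) by (simp add: num_cliques_eq)
  \<comment> \<open>For \<open>s = 1\<close> every graph on \<open>n\<close> vertices has
    \<open>n\<close> cliques, so this value is settled directly; the numerical estimates start at
    \<open>s = 2\<close>.\<close>
  have one: "ex_lf n s ls = num_cliques s {0..<n} (GF_E ls n)" "ex_lf n s [ls ! 0] \<le> ex_lf n s ls" if "s = 1"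
    using E(3) P_le that by (simp_all add: num_cliques_1)
  show ?thesis
  proof (intro conjI impI)
    assume ns: "\<not> (length ls = 2 \<and> ls ! 0 = ls ! 1 \<and> odd (ls ! 0))"
    show "ex_lf n s ls = max (num_cliques s {0..<n} (GF_E ls n)) (ex_lf n s [ls ! 0])"
    proof (cases "s = 1")
      case True
      then show ?thesis using one by simp
    next
      case False
      then have s2: "2 \<le> s" using s_pos by simp
      have "\<not> (rs = [] \<and> l1 = l2 \<and> odd l1)" using ns ls by auto
      then have "ex_lf n s ls \<le> num_cliques s {0..<n} (GF_E ls n) \<or> (\<forall>xs. path {0..<n} xs \<longrightarrow> length xs \<noteq> l1)"
        using upper_nonspecial[OF _ _ np f[unfolded hd] _ bud[OF s2]] N by simp
      then have "ex_lf n s ls \<le> max (num_cliques s {0..<n} (GF_E ls n)) (ex_lf n s [ls ! 0])"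
      proof
        assume no: "\<forall>xs. path {0..<n} xs \<longrightarrow> length xs \<noteq> l1"
        have "H_free {0..<n} E (lf_V [l1]) (lf_E [l1])"
          unfolding H_free_def using copy_imp_path[of l1 "{0..<n}"] no by blast
        then have "num_cliques s {0..<n} E \<le> ex_lf n s [l1]"
          unfolding ex_lf_def by (rule ex_gen_ge[OF E(1)])
        then show ?thesis using E(3) ls by simp
      qed simp
      then show ?thesis using GF_le P_le by simp
    qed
  next
    assume sp: "length ls = 2 \<and> ls ! 0 = ls ! 1 \<and> odd (ls ! 0)"
    then have l: "ls = [l1, l1]" "odd l1" using ls by auto
    have l5: "5 \<le> l1"
    proof -
      have "2 \<le> l1" "l1 \<noteq> 3" using l_ge by auto
      then show ?thesis using l(2) by presburger
    qed
    have ld: "l1 = d + 2"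
    proof -
      have "l1 div 2 + l1 div 2 = Suc d" using h_def hd l(1) by simp
      then show ?thesis using l(2) by presburger
    qed
    have p2: "?p = 2 * l1" using l(1) by simp
    {
      assume sd: "s \<le> delta_F ls"
      show "ex_lf n s ls = num_cliques s {0..<n} (GF_E ls n)"
      proof (cases "s = 1")
        case False
        then have s2: "2 \<le> s" using s_pos by simp
        have "card (cl s {0..<n}) \<le> num_cliques s {0..<n} (GF_E [l1, l1] n)"
          using np sd bud[OF s2, unfolded p2]
          by (intro upper_special[OF _ _ _ l(2) l5 ld]) (auto simp: l(1) d_def)
        then show ?thesis using GF_le N l(1) by simp
      qed (use one in simp)
    next
      assume sd: "s = delta_F ls + 1"
      then have s: "s = d + 1" "s = l1 - 1" and s2: "2 \<le> s" using ld d1 by (auto simp: d_def)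
      have "card (cl s {0..<n}) \<le> top_count l1 (n - 1)"
        using np bud[OF s2, unfolded p2] unfolding s(1)
        by (intro upper_special_top[OF _ _ _ l(2) l5 ld]) (auto simp: l(1))
      moreover have "top_count l1 (n - 1) \<le> ex_lf n s ls"
      proof -
        have "top_count l1 (n - 1) \<le> num_cliques (l1 - 1) {0..<n} (top_graph l1 n)"
          using l5 dn d1 by (intro top_graph_cliques) auto
        also have "\<dots> \<le> ex_lf n s ls"
          unfolding ex_lf_def l(1) s(2) using l5 by (intro ex_gen_ge top_graph_graphs_on top_graph_H_free) simp
        finally show ?thesis .
      qed
      ultimately have "ex_lf n s ls = top_count l1 (n - 1)" using N by simp
      then show "ex_lf n s ls = (n - 1) div (ls ! 0 - 1) * ls ! 0
          + (if (n - 1) mod (ls ! 0 - 1) = ls ! 0 - 2 then 1 else 0)"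
        by (simp add: top_count_def ls)
    }
  qed
qed

end
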